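(* Let $(M,\omega)$ be a pre-$m$-symplectic manifold. Let $\Xi(M)$ be the graded vector space $\Xi_k(M)=\bigoplus_{i+j=k}\Xi_i^j(M)$, $k\geq 1$, where $$\Xi_1^j(M)=\Omega_{\mathrm{ham}}^{m-1-j}(M)\ (0\le j\le m-1),\qquad \Xi_i^j(M)=\Omega^{m-i-j}(M)\ (i\ge2,\ 0\le j\le m-i),$$ and $\Xi_i^j(M)=0$ otherwise, with brackets $l_k$ of bidegree $(-1,0)$ (in $(i,j)$) whose only non-zero components are $$l_1(\alpha)=-d\alpha\in\Xi_{i-1}^j(M)\ \text{ for }\alpha\in\Xi_i^j(M),\ i\ge2,$$ $$l_k(\alpha_1\otimes\cdots\otimes\alpha_k)=\iota_{x_1\cdots x_k}\omega\in\Xi_{k-1}^{j_1+\cdots+j_k}(M)\ \text{ for }k\ge2,\ \alpha_s\in\Xi_1^{j_s}(M),$$ where $(x_s,\alpha_s)$ are hamiltonian pairs. Then $(\Xi(M),\{l_k\})$ is an $L_\infty$-algebra.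
   Context: A pre-$m$-symplectic manifold ($m\ge1$) is a smooth manifold $M$ with a closed form $\omega\in\Omega^{m+1}(M)$. Multi-vector fields of degree $k$: $\mathfrak X^k(M)=\Gamma(\wedge^kTM)$, wedge product written $xy$. Contraction: $\iota_{X_1\cdots X_k}\alpha=\alpha(X_k,\dots,X_1,-)=\iota_{X_1}\cdots\iota_{X_k}\alpha$ for vector fields $X_i$, extended linearly. A hamiltonian pair is $(x,\alpha)$ with $x\in\mathfrak X^{k}(M)$, $k\ge1$, $\alpha\in\Omega^{m-k}(M)$ and $\iota_x\omega=d\alpha$; then $\alpha$ is called a hamiltonian form. $\Omega^{m-k}_{\mathrm{ham}}(M)\subset\Omega^{m-k}(M)$ is the space of hamiltonian forms. (The value $\iota_{x_1\cdots x_k}\omega$ does not depend on the chosen $x_s$.) An $L_\infty$-algebra is a graded vector space $L$ concentrated in positive degrees with graded symmetric maps $l_n:L^{\otimes n}\to L$ of degree $-1$ such that for all $n\ge1$: $\sum_{i+j=n+1}\sum_{\sigma\in \mathrm{Sh}(i,j-1)}\epsilon(\sigma)l_j(l_i(x_{\sigma(1)},\dots,x_{\sigma(i)}),x_{\sigma(i+1)},\dots,x_{\sigma(n)})=0$, where $\mathrm{Sh}(i,j-1)$ consists of permutations increasing on the first $i$ and on the last $j-1$ positions and $\epsilon(\sigma)$ is the Koszul sign, $x_1\cdots x_n=\epsilon(\sigma)x_{\sigma(1)}\cdots x_{\sigma(n)}$ in the graded symmetric algebra. Here the degree of an element of $\Xi_i^j(M)$ is $i+j$. *)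

theory Defs
  imports "HOL-Analysis.Analysis" "HOL-Library.Function_Algebras" "HOL-Combinatorics.Permutations"
begin

section \<open>Function spaces as real vector spaces\<close>

instantiation "fun" :: (type, real_vector) real_vector
begin

definition scaleR_fun_def: "r *\<^sub>R f = (\<lambda>x. r *\<^sub>R f x)"

instance
  by standard (auto simp: scaleR_fun_def fun_eq_iff scaleR_add_right scaleR_add_left)

end


section \<open>Smooth maps and smooth manifolds\<close>

fun differentiable_of_order ::
    "nat \<Rightarrow> 'a::real_normed_vector set \<Rightarrow> ('a \<Rightarrow> 'b::real_normed_vector) \<Rightarrow> bool" where
  "differentiable_of_order 0 S f \<longleftrightarrow> continuous_on S f"
| "differentiable_of_order (Suc n) S f \<longleftrightarrow>
     (\<forall>x\<in>S. f differentiable (at x)) \<and>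
     (\<forall>v. differentiable_of_order n S (\<lambda>x. frechet_derivative f (at x) v))"

text \<open>This is meant for open \<open>S\<close> in a finite-dimensional space, where it says that all iterated
  directional derivatives exist and are continuous.\<close>

definition smooth_on :: "'a::real_normed_vector set \<Rightarrow> ('a \<Rightarrow> 'b::real_normed_vector) \<Rightarrow> bool" where
  "smooth_on S f \<longleftrightarrow> (\<forall>n. differentiable_of_order n S f)"

text \<open>A chart is a pair of its domain and its coordinate map; the values of the coordinate map
  outside the domain are irrelevant.\<close>

type_synonym ('p, 'e) chart = "'p set \<times> ('p \<Rightarrow> 'e)"

definition chart_inv :: "('p, 'e) chart \<Rightarrow> 'e \<Rightarrow> 'p" where
  "chart_inv c = inv_into (fst c) (snd c)"

definition transition :: "('p, 'e) chart \<Rightarrow> ('p, 'e) chart \<Rightarrow> 'e \<Rightarrow> 'e" where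
  "transition c c' = snd c' \<circ> chart_inv c"

definition smooth_atlas :: "'p topology \<Rightarrow> ('p, 'e::real_normed_vector) chart set \<Rightarrow> bool" where
  "smooth_atlas X A \<longleftrightarrow>
     (\<Union>c\<in>A. fst c) = topspace X \<and>
     (\<forall>c\<in>A. openin X (fst c) \<and> open (snd c ` fst c) \<and>
        homeomorphic_map (subtopology X (fst c)) (top_of_set (snd c ` fst c)) (snd c)) \<and>
     (\<forall>c\<in>A. \<forall>c'\<in>A. smooth_on (snd c ` (fst c \<inter> fst c')) (transition c c'))"

text \<open>The model space \<open>'e\<close> is an arbitrary finite-dimensional inner product space, i.e. a copy of
  \<open>\<real>\<^sup>n\<close>. The class \<open>real_inner\<close> with an explicit finiteness condition is used in place of
  \<open>euclidean_space\<close> because the latter excludes dimension zero. The atlas need not be maximal.\<close>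

definition smooth_manifold :: "'p topology \<Rightarrow> ('p, 'e::real_inner) chart set \<Rightarrow> bool" where
  "smooth_manifold X A \<longleftrightarrow>
     (\<exists>B. finite B \<and> span B = (UNIV :: 'e set)) \<and>
     Hausdorff_space X \<and> second_countable X \<and> smooth_atlas X A"

definition points :: "('p, 'e) chart set \<Rightarrow> 'p set" where
  "points A = (\<Union>c\<in>A. fst c)"


section \<open>Tangent spaces\<close>

text \<open>A tangent vector at \<open>p\<close> is given by its coordinates in all charts around \<open>p\<close>, related by the
  derivatives of the transition maps. For charts not around \<open>p\<close> the entry is set to zero, so that
  equal tangent vectors are equal as functions.\<close>

type_synonym ('p, 'e) tvec = "('p, 'e) chart \<Rightarrow> 'e"

definition tangent_space ::
    "('p, 'e::real_normed_vector) chart set \<Rightarrow> 'p \<Rightarrow> ('p, 'e) tvec set" where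
  "tangent_space A p = {v.
     (\<forall>c. \<not> (c \<in> A \<and> p \<in> fst c) \<longrightarrow> v c = 0) \<and>
     (\<forall>c\<in>A. \<forall>c'\<in>A. p \<in> fst c \<longrightarrow> p \<in> fst c' \<longrightarrow>
        v c' = frechet_derivative (transition c c') (at (snd c p)) (v c))}"

text \<open>The tangent vector at \<open>p\<close> with coordinates \<open>e\<close> in the chart \<open>c\<close>.\<close>

definition coord_tvec ::
    "('p, 'e::real_normed_vector) chart set \<Rightarrow> ('p, 'e) chart \<Rightarrow> 'p \<Rightarrow> 'e \<Rightarrow> ('p, 'e) tvec" where
  "coord_tvec A c p e = (\<lambda>c'. if c' \<in> A \<and> p \<in> fst c'
     then frechet_derivative (transition c c') (at (snd c p)) e else 0)"


section \<open>Exterior algebra of a vector space\<close>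

text \<open>Forms are functions on lists of vectors; the \<open>k\<close>-forms on the subspace \<open>V\<close> vanish on all lists
  other than those of \<open>k\<close> vectors in \<open>V\<close>.\<close>

definition multilinear_on :: "'v::real_vector set \<Rightarrow> ('v list \<Rightarrow> 'w::real_vector) \<Rightarrow> bool" where
  "multilinear_on V f \<longleftrightarrow> (\<forall>us ws x y a b.
     set us \<subseteq> V \<longrightarrow> set ws \<subseteq> V \<longrightarrow> x \<in> V \<longrightarrow> y \<in> V \<longrightarrow>
     f (us @ (a *\<^sub>R x + b *\<^sub>R y) # ws) = a *\<^sub>R f (us @ x # ws) + b *\<^sub>R f (us @ y # ws))"

definition alt_forms :: "nat \<Rightarrow> 'v::real_vector set \<Rightarrow> ('v list \<Rightarrow> real) set" where
  "alt_forms k V = {\<beta>.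
     (\<forall>vs. \<not> (length vs = k \<and> set vs \<subseteq> V) \<longrightarrow> \<beta> vs = 0) \<and>
     multilinear_on V \<beta> \<and>
     (\<forall>vs. \<not> distinct vs \<longrightarrow> \<beta> vs = 0)}"

text \<open>For finite-dimensional \<open>V\<close>, the exterior power \<open>\<And>\<^sup>kV\<close> is the dual of the space of alternating
  \<open>k\<close>-forms on \<open>V\<close>; the product \<open>X\<^sub>1\<cdots>X\<^sub>k\<close> of vectors is evaluation at \<open>[X\<^sub>1,\<dots>,X\<^sub>k]\<close>, and \<open>\<And>\<^sup>kV\<close> is the span
  of these. The functionals are set to zero outside the \<open>k\<close>-forms, to have them determined by their
  values on \<open>k\<close>-forms.\<close>

type_synonym 'v mvec = "('v list \<Rightarrow> real) \<Rightarrow> real"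

definition decomposable :: "'v::real_vector set \<Rightarrow> 'v list \<Rightarrow> 'v mvec" where
  "decomposable V ws = (\<lambda>\<beta>. if \<beta> \<in> alt_forms (length ws) V then \<beta> ws else 0)"

definition ext_power :: "nat \<Rightarrow> 'v::real_vector set \<Rightarrow> 'v mvec set" where
  "ext_power k V = span {decomposable V ws | ws. length ws = k \<and> set ws \<subseteq> V}"

text \<open>The bilinear extension of \<open>(X\<^sub>1\<cdots>X\<^sub>k) (Y\<^sub>1\<cdots>Y\<^sub>l) = X\<^sub>1\<cdots>X\<^sub>k Y\<^sub>1\<cdots>Y\<^sub>l\<close>, for \<open>x\<close> and \<open>y\<close> of degrees
  \<open>k\<close> and \<open>l\<close>.\<close>

definition ext_mult :: "nat \<Rightarrow> nat \<Rightarrow> 'v::real_vector set \<Rightarrow> 'v mvec \<Rightarrow> 'v mvec \<Rightarrow> 'v mvec" where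
  "ext_mult k l V x y = (\<lambda>\<beta>. if \<beta> \<in> alt_forms (k + l) V
     then x (\<lambda>ws. y (\<lambda>us. \<beta> (ws @ us))) else 0)"

text \<open>The linear extension in \<open>x\<close> of \<open>\<alpha>(X\<^sub>k,\<dots>,X\<^sub>1,-)\<close> for \<open>x = X\<^sub>1\<cdots>X\<^sub>k\<close>. It is zero if \<open>k\<close> exceeds the
  degree of \<open>\<alpha>\<close>.\<close>

definition ext_contract :: "'v mvec \<Rightarrow> ('v list \<Rightarrow> real) \<Rightarrow> ('v list \<Rightarrow> real)" where
  "ext_contract x \<alpha> = (\<lambda>vs. x (\<lambda>ws. \<alpha> (rev ws @ vs)))"


section \<open>Differential forms and multi-vector fields\<close>

type_synonym ('p, 'e) form = "'p \<Rightarrow> ('p, 'e) tvec list \<Rightarrow> real"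

definition local_form ::
    "('p, 'e::real_normed_vector) chart set \<Rightarrow> ('p, 'e) chart \<Rightarrow> ('p, 'e) form \<Rightarrow> 'e \<Rightarrow> 'e list \<Rightarrow> real"
  where "local_form A c \<alpha> u es = \<alpha> (chart_inv c u) (map (coord_tvec A c (chart_inv c u)) es)"

definition diff_forms :: "('p, 'e::real_normed_vector) chart set \<Rightarrow> nat \<Rightarrow> ('p, 'e) form set" where
  "diff_forms A k = {\<alpha>.
     (\<forall>p. p \<notin> points A \<longrightarrow> \<alpha> p = 0) \<and>
     (\<forall>p\<in>points A. \<alpha> p \<in> alt_forms k (tangent_space A p)) \<and>
     (\<forall>c\<in>A. \<forall>es. smooth_on (snd c ` fst c) (\<lambda>u. local_form A c \<alpha> u es))}"

text \<open>In a chart, \<open>d\<alpha>(v\<^sub>0,\<dots>,v\<^sub>k) = \<Sum>\<^sub>i (-1)\<^sup>i D\<alpha>(-)(v\<^sub>0,\<dots>,v\<^sub>i\<^sub>-\<^sub>1,v\<^sub>i\<^sub>+\<^sub>1,\<dots>,v\<^sub>k) v\<^sub>i\<close> where \<open>D\<close> is the derivative with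
  respect to the base point. The result does not depend on the chart around \<open>p\<close> that is used.\<close>

definition chart_at :: "('p, 'e) chart set \<Rightarrow> 'p \<Rightarrow> ('p, 'e) chart" where
  "chart_at A p = (SOME c. c \<in> A \<and> p \<in> fst c)"

definition ext_deriv ::
    "('p, 'e::real_normed_vector) chart set \<Rightarrow> ('p, 'e) form \<Rightarrow> ('p, 'e) form" where
  "ext_deriv A \<alpha> = (\<lambda>p vs. if p \<in> points A \<and> set vs \<subseteq> tangent_space A p then
     (let c = chart_at A p; es = map (\<lambda>v. v c) vs in
       \<Sum>i<length es. (-1) ^ i *
         frechet_derivative (\<lambda>u. local_form A c \<alpha> u (take i es @ drop (Suc i) es))
           (at (snd c p)) (es ! i))
     else 0)"

type_synonym ('p, 'e) mvfield = "'p \<Rightarrow> ('p, 'e) tvec mvec"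

text \<open>The coefficient of a \<open>k\<close>-vector field in the chart \<open>c\<close> with respect to a constant
  alternating \<open>k\<close>-form \<open>b\<close> on the model space.\<close>

definition local_coeff ::
    "('p, 'e::real_normed_vector) chart set \<Rightarrow> ('p, 'e) chart \<Rightarrow> ('p, 'e) mvfield \<Rightarrow> ('e list \<Rightarrow> real) \<Rightarrow>
     'e \<Rightarrow> real" where
  "local_coeff A c x b u = (let p = chart_inv c u in
     x p (\<lambda>ws. if set ws \<subseteq> tangent_space A p then b (map (\<lambda>w. w c) ws) else 0))"

definition multivector_fields ::
    "('p, 'e::real_normed_vector) chart set \<Rightarrow> nat \<Rightarrow> ('p, 'e) mvfield set" where
  "multivector_fields A k = {x.
     (\<forall>p. p \<notin> points A \<longrightarrow> x p = 0) \<and>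
     (\<forall>p\<in>points A. x p \<in> ext_power k (tangent_space A p)) \<and>
     (\<forall>c\<in>A. \<forall>b\<in>alt_forms k UNIV. smooth_on (snd c ` fst c) (local_coeff A c x b))}"

text \<open>The product \<open>x\<^sub>1\<cdots>x\<^sub>n\<close> of multi-vector fields \<open>xs = [x\<^sub>1,\<dots>,x\<^sub>n]\<close> of degrees \<open>ks = [k\<^sub>1,\<dots>,k\<^sub>n]\<close>.\<close>

fun mv_prod ::
    "('p, 'e::real_normed_vector) chart set \<Rightarrow> nat list \<Rightarrow> ('p, 'e) mvfield list \<Rightarrow> ('p, 'e) mvfield"
  where
  "mv_prod A (k # ks) (x # xs) =
     (\<lambda>p. ext_mult k (sum_list ks) (tangent_space A p) (x p) (mv_prod A ks xs p))"
| "mv_prod A _ _ = (\<lambda>p. if p \<in> points A then decomposable (tangent_space A p) [] else 0)"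

definition contract :: "('p, 'e) mvfield \<Rightarrow> ('p, 'e) form \<Rightarrow> ('p, 'e) form" where
  "contract x \<alpha> = (\<lambda>p. ext_contract (x p) (\<alpha> p))"


section \<open>Pre-multisymplectic manifolds and hamiltonian forms\<close>

definition pre_multisymplectic ::
    "'p topology \<Rightarrow> ('p, 'e::real_inner) chart set \<Rightarrow> nat \<Rightarrow> ('p, 'e) form \<Rightarrow> bool" where
  "pre_multisymplectic X A m \<omega> \<longleftrightarrow>
     smooth_manifold X A \<and> 1 \<le> m \<and> \<omega> \<in> diff_forms A (m + 1) \<and> ext_deriv A \<omega> = 0"

definition hamiltonian_pair ::
    "('p, 'e::real_normed_vector) chart set \<Rightarrow> nat \<Rightarrow> ('p, 'e) form \<Rightarrow> nat \<Rightarrow>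
     ('p, 'e) mvfield \<Rightarrow> ('p, 'e) form \<Rightarrow> bool" where
  "hamiltonian_pair A m \<omega> k x \<alpha> \<longleftrightarrow>
     1 \<le> k \<and> k \<le> m \<and> x \<in> multivector_fields A k \<and> \<alpha> \<in> diff_forms A (m - k) \<and>
     contract x \<omega> = ext_deriv A \<alpha>"

text \<open>\<open>ham_forms A m \<omega> k\<close> is \<open>\<Omega>\<^sub>h\<^sub>a\<^sub>m\<^bsup>m-k\<^esup>(M)\<close>.\<close>

definition ham_forms ::
    "('p, 'e::real_normed_vector) chart set \<Rightarrow> nat \<Rightarrow> ('p, 'e) form \<Rightarrow> nat \<Rightarrow> ('p, 'e) form set" where
  "ham_forms A m \<omega> k = {\<alpha>. \<exists>x. hamiltonian_pair A m \<omega> k x \<alpha>}"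


section \<open>\<open>L\<^sub>\<infinity>\<close>-algebras\<close>

text \<open>A graded vector space, concentrated in positive degrees, is given as the internal direct sum
  of its homogeneous components.\<close>

definition pos_graded_space :: "(nat \<Rightarrow> 'v::real_vector set) \<Rightarrow> bool" where
  "pos_graded_space L \<longleftrightarrow>
     (\<forall>k. subspace (L k)) \<and> L 0 = {0} \<and>
     (\<forall>f n. (\<forall>k<n. f k \<in> L k) \<longrightarrow> (\<Sum>k<n. f k) = 0 \<longrightarrow> (\<forall>k<n. f k = 0))"

definition total_space :: "(nat \<Rightarrow> 'v::real_vector set) \<Rightarrow> 'v set" where
  "total_space L = span (\<Union>k. L k)"

definition homogeneous :: "(nat \<Rightarrow> 'v set) \<Rightarrow> nat list \<Rightarrow> 'v list \<Rightarrow> bool" where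
  "homogeneous L ds xs \<longleftrightarrow> list_all2 (\<lambda>d x. x \<in> L d) ds xs"

text \<open>\<open>permute_by \<sigma> [i..<j] xs = [x\<^sub>\<sigma>\<^sub>(\<^sub>i\<^sub>), \<dots>, x\<^sub>\<sigma>\<^sub>(\<^sub>j\<^sub>-\<^sub>1\<^sub>)]\<close>; positions in lists are counted from zero.\<close>

definition permute_by :: "(nat \<Rightarrow> nat) \<Rightarrow> nat list \<Rightarrow> 'v list \<Rightarrow> 'v list" where
  "permute_by \<sigma> rs xs = map (\<lambda>r. xs ! \<sigma> r) rs"

text \<open>Every pair of elements of degrees \<open>d\<close>, \<open>d'\<close> that is put out of order contributes \<open>(-1)\<^bsup>d d'\<^esup>\<close> to
  the sign \<open>\<epsilon>(\<sigma>)\<close> in \<open>x\<^sub>1\<cdots>x\<^sub>n = \<epsilon>(\<sigma>) x\<^sub>\<sigma>\<^sub>(\<^sub>1\<^sub>)\<cdots>x\<^sub>\<sigma>\<^sub>(\<^sub>n\<^sub>)\<close>.\<close>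

definition koszul_sign :: "nat list \<Rightarrow> (nat \<Rightarrow> nat) \<Rightarrow> real" where
  "koszul_sign ds \<sigma> =
     (\<Prod>(r, s) \<in> {(r, s). r < s \<and> s < length ds \<and> \<sigma> s < \<sigma> r}. (-1) ^ (ds ! \<sigma> r * ds ! \<sigma> s))"

definition shuffles_perm :: "nat \<Rightarrow> nat \<Rightarrow> (nat \<Rightarrow> nat) set" where
  "shuffles_perm i k = {\<sigma>. \<sigma> permutes {..<i + k} \<and>
     strict_mono_on {..<i} \<sigma> \<and> strict_mono_on {i..<i + k} \<sigma>}"

text \<open>The map \<open>l\<^sub>n\<close> is the restriction of \<open>l\<close> to lists of length \<open>n\<close>. In the last condition \<open>n\<close> is
  \<open>length xs\<close> and \<open>j = n + 1 - i\<close>.\<close>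

definition L_infinity_algebra ::
    "(nat \<Rightarrow> 'v::real_vector set) \<Rightarrow> ('v list \<Rightarrow> 'v) \<Rightarrow> bool" where
  "L_infinity_algebra L l \<longleftrightarrow>
     pos_graded_space L \<and>
     multilinear_on (total_space L) l \<and>
     (\<forall>ds xs. xs \<noteq> [] \<longrightarrow> homogeneous L ds xs \<longrightarrow> l xs \<in> L (sum_list ds - 1)) \<and>
     (\<forall>ds xs \<sigma>. xs \<noteq> [] \<longrightarrow> homogeneous L ds xs \<longrightarrow> \<sigma> permutes {..<length xs} \<longrightarrow>
        l xs = koszul_sign ds \<sigma> *\<^sub>R l (permute_by \<sigma> [0..<length xs] xs)) \<and>
     (\<forall>ds xs. xs \<noteq> [] \<longrightarrow> homogeneous L ds xs \<longrightarrow>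
        (\<Sum>i\<in>{1..length xs}. \<Sum>\<sigma>\<in>shuffles_perm i (length xs - i). koszul_sign ds \<sigma> *\<^sub>R
           l (l (permute_by \<sigma> [0..<i] xs) # permute_by \<sigma> [i..<length xs] xs)) = 0)"


section \<open>The graded space \<open>\<Xi>(M)\<close> and its brackets\<close>

text \<open>An element of \<open>\<Xi>(M)\<close> is the family of its components in the spaces \<open>\<Xi>\<^sub>i\<^sup>j(M)\<close>.\<close>

type_synonym ('p, 'e) bigraded = "nat \<Rightarrow> nat \<Rightarrow> ('p, 'e) form"

definition Xi_comp ::
    "('p, 'e::real_normed_vector) chart set \<Rightarrow> nat \<Rightarrow> ('p, 'e) form \<Rightarrow> nat \<Rightarrow> nat \<Rightarrow> ('p, 'e) form set"
  where
  "Xi_comp A m \<omega> i j =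
     (if i = 1 \<and> j < m then ham_forms A m \<omega> (1 + j)
      else if 2 \<le> i \<and> i + j \<le> m then diff_forms A (m - i - j)
      else {0})"

definition Xi ::
    "('p, 'e::real_normed_vector) chart set \<Rightarrow> nat \<Rightarrow> ('p, 'e) form \<Rightarrow> nat \<Rightarrow> ('p, 'e) bigraded set"
  where
  "Xi A m \<omega> k = {a. \<forall>i j. a i j \<in> (if i + j = k then Xi_comp A m \<omega> i j else {0})}"

definition in_bidegree :: "nat \<Rightarrow> nat \<Rightarrow> ('p, 'e) form \<Rightarrow> ('p, 'e) bigraded" where
  "in_bidegree i j \<alpha> = (\<lambda>i' j'. if i' = i \<and> j' = j then \<alpha> else 0)"

text \<open>Some multi-vector field \<open>x\<close> such that \<open>(x, \<alpha>)\<close> is a hamiltonian pair.\<close>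

definition ham_mvfield ::
    "('p, 'e::real_normed_vector) chart set \<Rightarrow> nat \<Rightarrow> ('p, 'e) form \<Rightarrow> nat \<Rightarrow> ('p, 'e) form \<Rightarrow>
     ('p, 'e) mvfield" where
  "ham_mvfield A m \<omega> k \<alpha> = (SOME x. hamiltonian_pair A m \<omega> k x \<alpha>)"

text \<open>\<open>contract_prod A \<omega> js xs\<close> is \<open>\<iota>\<^bsub>x\<^sub>1\<cdots>x\<^sub>k\<^esub> \<omega>\<close> for \<open>x\<^sub>s\<close> of degree \<open>1 + j\<^sub>s\<close>, which is the degree of the
  hamiltonian multi-vector fields of elements of \<open>\<Xi>\<^sub>1\<^bsup>j\<^sub>s\<^esup>(M)\<close>.\<close>

definition contract_prod ::
    "('p, 'e::real_normed_vector) chart set \<Rightarrow> ('p, 'e) form \<Rightarrow> nat list \<Rightarrow> ('p, 'e) mvfield list \<Rightarrow>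
     ('p, 'e) form" where
  "contract_prod A \<omega> js xs = contract (mv_prod A (map Suc js) xs) \<omega>"

text \<open>The component in \<open>\<Xi>\<^sub>i\<^sup>j(M)\<close> of the multilinear extension of the brackets to all of \<open>\<Xi>(M)\<close>; for
  \<open>k \<ge> 2\<close> arguments it collects the contributions of all \<open>j\<^sub>1 + \<cdots> + j\<^sub>k = j\<close>.\<close>

definition Xi_bracket ::
    "('p, 'e::real_normed_vector) chart set \<Rightarrow> nat \<Rightarrow> ('p, 'e) form \<Rightarrow> ('p, 'e) bigraded list \<Rightarrow>
     ('p, 'e) bigraded" where
  "Xi_bracket A m \<omega> as = (\<lambda>i j.
     if length as = 1 \<and> 1 \<le> i then - ext_deriv A (hd as (Suc i) j)
     else if 2 \<le> length as \<and> i = length as - 1 then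
       (\<Sum>js\<in>{js. length js = length as \<and> set js \<subseteq> {..<m} \<and> sum_list js = j}.
          contract_prod A \<omega> js (map2 (\<lambda>j a. ham_mvfield A m \<omega> (1 + j) (a 1 j)) js as))
     else 0)"

end

theory Submission
  imports Defs
begin

text \<open>
  The identity behind the theorem is that \<open>d\<close> is an operator of second order with respect to
  contractions. Let \<open>\<iota>\<^sub>x\<close> be the contraction with a multi-vector field \<open>x\<close>, and write brackets for graded
  commutators of operators on forms. Contractions commute in the graded sense, and the double
  commutator \<open>[[d, \<iota>\<^sub>x], \<iota>\<^sub>y]\<close> is again a contraction, with the Schouten bracket of \<open>x\<close> and \<open>y\<close> up to sign.
  Hence \<open>d\<close> can be moved to the right through \<open>\<iota>\<^sub>1 \<cdots> \<iota>\<^sub>n \<omega>\<close>, where \<open>\<iota>\<^sub>s\<close> is the contraction with a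
  hamiltonian \<open>x\<^sub>s\<close>. As \<open>d \<omega> = 0\<close> and \<open>d \<iota>\<^sub>s \<omega> = d d \<alpha>\<^sub>s = 0\<close>, only the double commutators survive:
  \<open>d \<iota>\<^sub>1 \<cdots> \<iota>\<^sub>n \<omega>\<close> is the sum over the pairs \<open>i < j\<close>, with Koszul signs, of \<open>\<iota>\<^bsub>v\<^esub>\<close> applied to the contraction
  of \<open>\<omega>\<close> with the remaining fields, where \<open>v\<close> satisfies \<open>\<iota>\<^bsub>v\<^esub> \<omega> = d \<iota>\<^sub>i \<iota>\<^sub>j \<omega>\<close> (\<open>ext_deriv_iter\<close>).

  In particular \<open>\<iota>\<^sub>1 \<iota>\<^sub>2 \<omega>\<close> is a hamiltonian form with multi-vector field \<open>v\<close>, so that the binary bracket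
  takes its values in \<open>\<Xi>\<^sub>1(M)\<close>, and the formula says that the terms \<open>l\<^sub>n\<^sub>-\<^sub>1(l\<^sub>2(\<alpha>\<^sub>i, \<alpha>\<^sub>j), \<dots>)\<close> of the generalized
  Jacobi identity cancel \<open>l\<^sub>1(l\<^sub>n(\<alpha>\<^sub>1, \<dots>, \<alpha>\<^sub>n))\<close>. All other terms vanish: brackets of arity at least
  two see only the first row, \<open>l\<^sub>1\<close> maps into exact forms, whose hamiltonian multi-vector field may be
  taken to be zero, and \<open>l\<^sub>i\<close> with \<open>i \<ge> 3\<close> maps outside the first row (\<open>jacobi\<close>). Graded symmetry is
  that of contractions. It also shows that \<open>\<iota>\<^sub>1 \<cdots> \<iota>\<^sub>n \<omega>\<close> depends on \<open>x\<^sub>s\<close> only through \<open>\<iota>\<^sub>s \<omega> = d \<alpha>\<^sub>s\<close>, because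
  \<open>\<iota>\<^sub>s\<close> can be moved next to \<open>\<omega>\<close>; this makes the brackets independent of the chosen fields and linear in
  each \<open>\<alpha>\<^sub>s\<close>.

  The analytic part is the existence of the Schouten bracket as a smooth multi-vector field. In a chart,
  all operators are generated by multiplications with functions \<open>f\<close>, contractions \<open>\<iota>\<^sub>a\<close> with constant
  vectors and \<open>d\<close>. From \<open>[d, \<iota>\<^sub>a] = \<partial>\<^sub>a\<close> one computes the double commutator by peeling off one constant
  vector at a time (\<open>derived_bracket_Cons\<close>), and obtains a contraction with smooth coefficients
  (\<open>derived_bracket_is_contraction\<close>). The multi-vector at a point is the same for all charts around it,
  because it is determined by the operator and \<open>d\<close> commutes with coordinate changes (\<open>lder_pullback\<close>);
  so the local fields glue (\<open>schouten_bracket_exists\<close>). Both this and \<open>d \<circ> d = 0\<close> rest on the symmetry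
  of second derivatives.
\<close>



section \<open>Smooth functions\<close>

abbreviation dir_deriv :: "('a::real_normed_vector \<Rightarrow> 'b::real_normed_vector) \<Rightarrow> 'a \<Rightarrow> 'a \<Rightarrow> 'b" where
  "dir_deriv f u v \<equiv> frechet_derivative f (at u) v"

lemma dir_deriv_eqI: "(f has_derivative f') (at u) \<Longrightarrow> dir_deriv f u v = f' v"
  using frechet_derivative_at by metis

lemma frechet_derivative_cong_open:
  assumes "open S" "u \<in> S" "\<And>x. x \<in> S \<Longrightarrow> f x = g x"
  shows "frechet_derivative f (at u) = frechet_derivative g (at u)"
proof -
  have "(f has_derivative f') (at u) \<longleftrightarrow> (g has_derivative f') (at u)" for f'
    using has_derivative_transform_within_open[OF _ assms(1,2)] assms(3) by metis
  then show ?thesis by (simp add: frechet_derivative_def)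
qed

lemma differentiable_cong_open:
  assumes "open S" "u \<in> S" "\<And>x. x \<in> S \<Longrightarrow> f x = g x"
  shows "f differentiable (at u) \<longleftrightarrow> g differentiable (at u)"
  unfolding differentiable_def
  using has_derivative_transform_within_open[OF _ assms(1,2)] assms(3) by metis

lemma differentiable_of_order_cong:
  assumes "open S" "\<And>x. x \<in> S \<Longrightarrow> f x = g x"
  shows "differentiable_of_order n S f = differentiable_of_order n S g"
  using assms(2)
proof (induction n arbitrary: f g)
  case 0
  then show ?case by (auto intro: continuous_on_cong)
next
  case (Suc n)
  have "differentiable_of_order n S (\<lambda>x. dir_deriv f x v)
      = differentiable_of_order n S (\<lambda>x. dir_deriv g x v)" for v
    by (intro Suc.IH) (simp add: frechet_derivative_cong_open[OF assms(1) _ Suc.prems])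
  then show ?case using differentiable_cong_open[OF assms(1) _ Suc.prems] by auto
qed

lemma smooth_on_cong:
  assumes "open S" "\<And>x. x \<in> S \<Longrightarrow> f x = g x"
  shows "smooth_on S f \<longleftrightarrow> smooth_on S g"
  using differentiable_of_order_cong[OF assms] by (simp add: smooth_on_def)

lemma differentiable_of_order_subset:
  "differentiable_of_order n S f \<Longrightarrow> T \<subseteq> S \<Longrightarrow> differentiable_of_order n T f"
  by (induction n arbitrary: f) (auto intro: continuous_on_subset)

lemma smooth_on_subset: "smooth_on S f \<Longrightarrow> T \<subseteq> S \<Longrightarrow> smooth_on T f"
  unfolding smooth_on_def using differentiable_of_order_subset by blast

lemma differentiable_of_order_Suc_D:
  "differentiable_of_order (Suc n) S f \<Longrightarrow> differentiable_of_order n S f"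
proof (induction n arbitrary: f)
  case 0
  then show ?case
    by (auto intro!: continuous_at_imp_continuous_on differentiable_imp_continuous_within)
next
  case (Suc n)
  then show ?case by (metis differentiable_of_order.simps(2))
qed

lemma smooth_on_differentiable: "smooth_on S f \<Longrightarrow> u \<in> S \<Longrightarrow> f differentiable (at u)"
  unfolding smooth_on_def by (metis differentiable_of_order.simps(2))

lemma smooth_on_has_derivative:
  "smooth_on S f \<Longrightarrow> u \<in> S \<Longrightarrow> (f has_derivative frechet_derivative f (at u)) (at u)"
  using smooth_on_differentiable frechet_derivative_works by blast

lemma smooth_on_dir_deriv: "smooth_on S f \<Longrightarrow> smooth_on S (\<lambda>u. dir_deriv f u v)"
  unfolding smooth_on_def by (metis differentiable_of_order.simps(2))

lemma smooth_on_continuous_on: "smooth_on S f \<Longrightarrow> continuous_on S f"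
  unfolding smooth_on_def by (metis differentiable_of_order.simps(1))

lemma linear_dir_deriv: "smooth_on S f \<Longrightarrow> u \<in> S \<Longrightarrow> linear (frechet_derivative f (at u))"
  by (simp add: linear_frechet_derivative smooth_on_differentiable)

lemma dir_deriv_combination:
  assumes "smooth_on S f" "u \<in> S"
  shows "dir_deriv f u (a *\<^sub>R x + b *\<^sub>R y) = a *\<^sub>R dir_deriv f u x + b *\<^sub>R dir_deriv f u y"
  using linear_dir_deriv[OF assms] by (simp add: linear_add linear_scale)

lemma differentiable_of_order_const: "differentiable_of_order n S (\<lambda>_. c)"
  by (induction n arbitrary: c) simp_all

lemma smooth_on_const [simp]: "smooth_on S (\<lambda>_. c)"
  unfolding smooth_on_def by (simp add: differentiable_of_order_const)

lemma dir_deriv_linear_compose: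
  assumes "bounded_linear h" "f differentiable (at u)"
  shows "dir_deriv (\<lambda>x. h (f x)) u v = h (dir_deriv f u v)"
  by (rule dir_deriv_eqI[where f' = "\<lambda>v. h (frechet_derivative f (at u) v)"])
    (use bounded_linear.has_derivative[OF assms(1)] assms(2) frechet_derivative_works in blast)

lemma differentiable_of_order_linear_compose:
  assumes "open S" "bounded_linear h"
  shows "differentiable_of_order n S f \<Longrightarrow> differentiable_of_order n S (\<lambda>u. h (f u))"
proof (induction n arbitrary: f)
  case 0
  then show ?case using assms(2) by (auto intro: bounded_linear.continuous_on)
next
  case (Suc n)
  have d: "f differentiable (at u)" if "u \<in> S" for u using Suc.prems that by simp
  have "differentiable_of_order n S (\<lambda>u. h (dir_deriv f u v))" for v
    using Suc by simp
  moreover have "dir_deriv (\<lambda>x. h (f x)) u v = h (dir_deriv f u v)" if "u \<in> S" for u v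
    using dir_deriv_linear_compose[OF assms(2) d[OF that]] .
  ultimately have "differentiable_of_order n S (\<lambda>u. dir_deriv (\<lambda>x. h (f x)) u v)" for v
    using differentiable_of_order_cong[OF assms(1)] by (metis (no_types, lifting))
  moreover have "(\<lambda>x. h (f x)) differentiable (at u)" if "u \<in> S" for u
    using bounded_linear.has_derivative[OF assms(2)] d[OF that] unfolding differentiable_def by blast
  ultimately show ?case by simp
qed

lemma smooth_on_linear_compose:
  "open S \<Longrightarrow> bounded_linear h \<Longrightarrow> smooth_on S f \<Longrightarrow> smooth_on S (\<lambda>u. h (f u))"
  unfolding smooth_on_def using differentiable_of_order_linear_compose by blast

lemma dir_deriv_add:
  assumes "f differentiable (at u)" "g differentiable (at u)"
  shows "dir_deriv (\<lambda>x. f x + g x) u v = dir_deriv f u v + dir_deriv g u v"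
  using assms by (intro dir_deriv_eqI) (auto intro!: has_derivative_add simp flip: frechet_derivative_works)

lemma differentiable_of_order_add:
  assumes "open S"
  shows "differentiable_of_order n S f \<Longrightarrow> differentiable_of_order n S g \<Longrightarrow>
    differentiable_of_order n S (\<lambda>u. f u + g u)"
proof (induction n arbitrary: f g)
  case 0
  then show ?case by (auto intro: continuous_on_add)
next
  case (Suc n)
  have d: "f differentiable (at u)" "g differentiable (at u)" if "u \<in> S" for u
    using Suc.prems that by simp_all
  have "differentiable_of_order n S (\<lambda>u. dir_deriv f u v + dir_deriv g u v)" for v
    using Suc by simp
  then have "differentiable_of_order n S (\<lambda>u. dir_deriv (\<lambda>x. f x + g x) u v)" for v
    using differentiable_of_order_cong[OF assms] dir_deriv_add[OF d] by (metis (no_types, lifting))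
  then show ?case using d by simp
qed

lemma smooth_on_add:
  "open S \<Longrightarrow> smooth_on S f \<Longrightarrow> smooth_on S g \<Longrightarrow> smooth_on S (\<lambda>u. f u + g u)"
  unfolding smooth_on_def using differentiable_of_order_add by blast

lemma dir_deriv_mult:
  fixes f g :: "'a::real_normed_vector \<Rightarrow> real"
  assumes "f differentiable (at u)" "g differentiable (at u)"
  shows "dir_deriv (\<lambda>x. f x * g x) u v = dir_deriv f u v * g u + f u * dir_deriv g u v"
proof -
  have "((\<lambda>x. f x * g x) has_derivative
      (\<lambda>v. f u * dir_deriv g u v + dir_deriv f u v * g u)) (at u)"
    using assms by (intro has_derivative_mult) (simp_all flip: frechet_derivative_works)
  from dir_deriv_eqI[OF this] show ?thesis by simp
qed

lemma differentiable_of_order_mult: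
  fixes f g :: "'a::real_normed_vector \<Rightarrow> real"
  assumes "open S"
  shows "differentiable_of_order n S f \<Longrightarrow> differentiable_of_order n S g \<Longrightarrow>
    differentiable_of_order n S (\<lambda>u. f u * g u)"
proof (induction n arbitrary: f g)
  case 0
  then show ?case by (auto intro: continuous_on_mult)
next
  case (Suc n)
  have d: "f differentiable (at u)" "g differentiable (at u)" if "u \<in> S" for u
    using Suc.prems that by simp_all
  have "differentiable_of_order n S (\<lambda>u. dir_deriv f u v * g u + f u * dir_deriv g u v)" for v
    using Suc.prems differentiable_of_order_Suc_D
    by (intro differentiable_of_order_add[OF assms] Suc.IH) auto
  then have "differentiable_of_order n S (\<lambda>u. dir_deriv (\<lambda>x. f x * g x) u v)" for v
    using differentiable_of_order_cong[OF assms] dir_deriv_mult[OF d] by (metis (no_types, lifting))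
  then show ?case using d by simp
qed

lemma smooth_on_mult:
  fixes f g :: "'a::real_normed_vector \<Rightarrow> real"
  shows "open S \<Longrightarrow> smooth_on S f \<Longrightarrow> smooth_on S g \<Longrightarrow> smooth_on S (\<lambda>u. f u * g u)"
  unfolding smooth_on_def using differentiable_of_order_mult by blast

lemma smooth_on_cmult:
  fixes f :: "'a::real_normed_vector \<Rightarrow> real"
  shows "open S \<Longrightarrow> smooth_on S f \<Longrightarrow> smooth_on S (\<lambda>u. c * f u)"
  by (simp add: smooth_on_mult)

lemma differentiable_of_order_sum:
  "open S \<Longrightarrow> (\<And>i. i \<in> I \<Longrightarrow> differentiable_of_order n S (f i)) \<Longrightarrow>
    differentiable_of_order n S (\<lambda>u. \<Sum>i\<in>I. f i u)"
  by (induction I rule: infinite_finite_induct)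
    (simp_all add: differentiable_of_order_add differentiable_of_order_const)

lemma smooth_on_sum:
  "open S \<Longrightarrow> (\<And>i. i \<in> I \<Longrightarrow> smooth_on S (f i)) \<Longrightarrow> smooth_on S (\<lambda>u. \<Sum>i\<in>I. f i u)"
  by (simp add: smooth_on_def differentiable_of_order_sum)

lemma smooth_on_sum_list:
  "open S \<Longrightarrow> (\<And>i. i \<in> set is \<Longrightarrow> smooth_on S (f i)) \<Longrightarrow> smooth_on S (\<lambda>u. \<Sum>i\<leftarrow>is. f i u)"
  by (induction "is") (simp_all add: smooth_on_add)

lemma dir_deriv_sum:
  assumes "\<And>i. i \<in> I \<Longrightarrow> f i differentiable (at u)"
  shows "dir_deriv (\<lambda>x. \<Sum>i\<in>I. f i x) u v = (\<Sum>i\<in>I. dir_deriv (f i) u v)"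
  by (intro dir_deriv_eqI has_derivative_sum) (use assms frechet_derivative_works in blast)

lemma dir_deriv_cmult:
  fixes f :: "'a::real_normed_vector \<Rightarrow> real"
  assumes "f differentiable (at u)"
  shows "dir_deriv (\<lambda>x. c * f x) u v = c * dir_deriv f u v"
  using dir_deriv_linear_compose[OF bounded_linear_mult_right assms] .

lemma dir_deriv_chain:
  assumes "g differentiable (at u)" "f differentiable (at (g u))"
  shows "dir_deriv (\<lambda>x. f (g x)) u v = dir_deriv f (g u) (dir_deriv g u v)"
  using frechet_derivative_compose[OF assms] by (simp add: o_def)


text \<open>The symmetry of second derivatives is what \<open>d \<circ> d = 0\<close> and the naturality of \<open>d\<close> rest on.
  The second difference quotient of \<open>f\<close> in the directions \<open>v\<close>, \<open>w\<close> is symmetric in \<open>v\<close> and \<open>w\<close>; by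
  the mean value theorem, applied twice, it is a value of the second derivative at a nearby point,
  in either order.\<close>

lemma second_difference_mean_value:
  fixes f :: "'a::real_normed_vector \<Rightarrow> real"
  assumes sm: "smooth_on S f" and h: "0 < h"
    and seg: "\<And>s t. 0 \<le> s \<Longrightarrow> s \<le> h \<Longrightarrow> 0 \<le> t \<Longrightarrow> t \<le> h \<Longrightarrow> u + s *\<^sub>R v + t *\<^sub>R w \<in> S"
  shows "\<exists>s t. 0 \<le> s \<and> s \<le> h \<and> 0 \<le> t \<and> t \<le> h \<and>
    f (u + h *\<^sub>R v + h *\<^sub>R w) - f (u + h *\<^sub>R v) - f (u + h *\<^sub>R w) + f u
      = h * h * dir_deriv (\<lambda>x. dir_deriv f x v) (u + s *\<^sub>R v + t *\<^sub>R w) w"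
proof -
  have line: "((\<lambda>s. g (a + s *\<^sub>R b)) has_derivative (\<lambda>k. k * dir_deriv g (a + s *\<^sub>R b) b)) (at s)"
    if "smooth_on S g" "a + s *\<^sub>R b \<in> S" for g :: "'a \<Rightarrow> real" and a b s
  proof -
    have "((\<lambda>s. a + s *\<^sub>R b) has_derivative (\<lambda>k. k *\<^sub>R b)) (at s)"
      by (auto intro!: derivative_eq_intros)
    from diff_chain_at[OF this, of g "frechet_derivative g (at (a + s *\<^sub>R b))"]
      smooth_on_has_derivative[OF that] linear_dir_deriv[OF that]
    show ?thesis by (simp add: o_def linear_scale)
  qed
  define G where "G = (\<lambda>s. f (u + s *\<^sub>R v + h *\<^sub>R w) - f (u + s *\<^sub>R v))"
  have G: "(G has_derivative (\<lambda>k. k * (dir_deriv f (u + s *\<^sub>R v + h *\<^sub>R w) v - dir_deriv f (u + s *\<^sub>R v) v)))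
      (at s)" if "0 \<le> s" "s \<le> h" for s
  proof -
    have "u + s *\<^sub>R v + h *\<^sub>R w \<in> S" "u + s *\<^sub>R v \<in> S"
      using seg[of s h] seg[of s 0] that h by simp_all
    then show ?thesis unfolding G_def
      using line[OF sm, of "u + h *\<^sub>R w" s v] line[OF sm, of u s v]
      by (auto intro!: derivative_eq_intros simp: algebra_simps)
  qed
  have "continuous_on {0..h} G"
    using G by (auto intro!: continuous_at_imp_continuous_on has_derivative_continuous)
  then obtain s where s: "0 < s" "s < h"
    and Gs: "G h - G 0 = h * (dir_deriv f (u + s *\<^sub>R v + h *\<^sub>R w) v - dir_deriv f (u + s *\<^sub>R v) v)"
    using mvt[OF h _ G] by auto
  define H where "H = (\<lambda>t. dir_deriv f (u + s *\<^sub>R v + t *\<^sub>R w) v)"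
  have H: "(H has_derivative
      (\<lambda>k. k * dir_deriv (\<lambda>x. dir_deriv f x v) (u + s *\<^sub>R v + t *\<^sub>R w) w)) (at t)"
    if "0 \<le> t" "t \<le> h" for t
    unfolding H_def by (rule line[OF smooth_on_dir_deriv[OF sm]]) (use seg s that in auto)
  have "continuous_on {0..h} H"
    using H by (auto intro!: continuous_at_imp_continuous_on has_derivative_continuous)
  then obtain t where "0 < t" "t < h"
    "H h - H 0 = h * dir_deriv (\<lambda>x. dir_deriv f x v) (u + s *\<^sub>R v + t *\<^sub>R w) w"
    using mvt[OF h _ H] by auto
  with s Gs show ?thesis
    by (intro exI[of _ s] exI[of _ t]) (auto simp: G_def H_def)
qed

lemma dir_deriv_commute_real:
  fixes f :: "'a::real_normed_vector \<Rightarrow> real"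
  assumes S: "open S" "u \<in> S" and sm: "smooth_on S f"
  shows "dir_deriv (\<lambda>x. dir_deriv f x v) u w = dir_deriv (\<lambda>x. dir_deriv f x w) u v"
proof (rule ccontr)
  define P where "P = (\<lambda>x. dir_deriv (\<lambda>x. dir_deriv f x v) x w)"
  define Q where "Q = (\<lambda>x. dir_deriv (\<lambda>x. dir_deriv f x w) x v)"
  assume "\<not> ?thesis"
  then have e: "0 < \<bar>P u - Q u\<bar> / 2" (is "0 < ?e") by (simp add: P_def Q_def)
  have "isCont P u" "isCont Q u"
    unfolding P_def Q_def
    using S sm by (simp_all add: continuous_on_eq_continuous_at[symmetric] continuous_on_interior
      smooth_on_continuous_on[OF smooth_on_dir_deriv[OF smooth_on_dir_deriv]]
      continuous_on_eq_continuous_at[THEN iffD1, rule_format])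
  then obtain d1 d2 where d: "0 < d1" "0 < d2"
    "\<And>x. dist x u < d1 \<Longrightarrow> \<bar>P x - P u\<bar> < ?e" "\<And>x. dist x u < d2 \<Longrightarrow> \<bar>Q x - Q u\<bar> < ?e"
    using e unfolding continuous_at_eps_delta dist_real_def by metis
  obtain d3 where d3: "0 < d3" "\<And>x. dist x u < d3 \<Longrightarrow> x \<in> S"
    using S open_dist by blast
  define D where "D = min d1 (min d2 d3)"
  have D: "0 < D" using d d3 by (simp add: D_def)
  define h where "h = D / (2 * (norm v + norm w + 1))"
  have pos: "0 < 2 * (norm v + norm w + 1)" by (smt (verit) norm_ge_zero)
  have h: "0 < h" using D pos by (simp add: h_def)
  have near: "dist (u + s *\<^sub>R v + t *\<^sub>R w) u < D" if "0 \<le> s" "s \<le> h" "0 \<le> t" "t \<le> h" for s t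
  proof -
    have "dist (u + s *\<^sub>R v + t *\<^sub>R w) u = norm (s *\<^sub>R v + t *\<^sub>R w)"
      by (simp add: dist_norm algebra_simps)
    also have "\<dots> \<le> s * norm v + t * norm w" using norm_triangle_ineq[of "s *\<^sub>R v" "t *\<^sub>R w"] that by simp
    also have "\<dots> \<le> h * norm v + h * norm w" using that by (intro add_mono mult_right_mono) auto
    also have "\<dots> < h * (2 * (norm v + norm w + 1))"
      unfolding distrib_left[symmetric] using h norm_ge_zero[of v] norm_ge_zero[of w]
      by (intro mult_strict_left_mono) (simp_all add: algebra_simps add_nonneg_pos)
    also have "\<dots> = D" unfolding h_def using pos by simp
    finally show ?thesis .
  qed
  have near': "dist (u + t *\<^sub>R w + s *\<^sub>R v) u < D" if "0 \<le> s" "s \<le> h" "0 \<le> t" "t \<le> h" for s t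
    using near[OF that] by (simp add: add_ac)
  obtain s t where st: "0 \<le> s" "s \<le> h" "0 \<le> t" "t \<le> h"
    "f (u + h *\<^sub>R v + h *\<^sub>R w) - f (u + h *\<^sub>R v) - f (u + h *\<^sub>R w) + f u
      = h * h * P (u + s *\<^sub>R v + t *\<^sub>R w)"
    using second_difference_mean_value[OF sm h, of u v w] near d3 unfolding D_def P_def
    by (metis min_less_iff_conj)
  obtain s' t' where st': "0 \<le> s'" "s' \<le> h" "0 \<le> t'" "t' \<le> h"
    "f (u + h *\<^sub>R w + h *\<^sub>R v) - f (u + h *\<^sub>R w) - f (u + h *\<^sub>R v) + f u
      = h * h * Q (u + s' *\<^sub>R w + t' *\<^sub>R v)"
    using second_difference_mean_value[OF sm h, of u w v] near' d3 unfolding D_def Q_def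
    by (metis min_less_iff_conj)
  have "h * h * P (u + s *\<^sub>R v + t *\<^sub>R w) = h * h * Q (u + s' *\<^sub>R w + t' *\<^sub>R v)"
    unfolding st(5)[symmetric] st'(5)[symmetric] by (simp add: add_ac)
  then have "P (u + s *\<^sub>R v + t *\<^sub>R w) = Q (u + s' *\<^sub>R w + t' *\<^sub>R v)" using h by simp
  moreover have "\<bar>P (u + s *\<^sub>R v + t *\<^sub>R w) - P u\<bar> < ?e" "\<bar>Q (u + s' *\<^sub>R w + t' *\<^sub>R v) - Q u\<bar> < ?e"
    using near[OF st(1-4)] near'[OF st'(3,4,1,2)] d unfolding D_def by auto
  ultimately show False by (smt (verit) field_sum_of_halves)
qed

lemma dir_deriv_commute:
  fixes f :: "'a::real_normed_vector \<Rightarrow> 'b::real_inner"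
  assumes S: "open S" "u \<in> S" and sm: "smooth_on S f"
  shows "dir_deriv (\<lambda>x. dir_deriv f x v) u w = dir_deriv (\<lambda>x. dir_deriv f x w) u v"
proof -
  have "dir_deriv (\<lambda>x. dir_deriv f x v) u w \<bullet> b = dir_deriv (\<lambda>x. dir_deriv f x w) u v \<bullet> b" for b
  proof -
    have *: "dir_deriv (\<lambda>x. dir_deriv f x v) u w \<bullet> b
        = dir_deriv (\<lambda>x. dir_deriv (\<lambda>x. f x \<bullet> b) x v) u w" for v w
    proof -
      have "dir_deriv (\<lambda>x. dir_deriv f x v) u w \<bullet> b = dir_deriv (\<lambda>x. dir_deriv f x v \<bullet> b) u w"
        using smooth_on_differentiable[OF smooth_on_dir_deriv[OF sm] S(2)]
        by (simp add: dir_deriv_linear_compose[OF bounded_linear_inner_left])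
      also have "\<dots> = dir_deriv (\<lambda>x. dir_deriv (\<lambda>x. f x \<bullet> b) x v) u w"
        by (subst frechet_derivative_cong_open[OF S])
          (auto simp: dir_deriv_linear_compose[OF bounded_linear_inner_left smooth_on_differentiable[OF sm]])
      finally show ?thesis .
    qed
    show ?thesis unfolding *
      by (rule dir_deriv_commute_real[OF S smooth_on_linear_compose[OF S(1) bounded_linear_inner_left sm]])
  qed
  then show ?thesis by (metis vector_eq_ldot inner_commute)
qed

text \<open>Gram-Schmidt orthogonalization.\<close>

lemma orthonormal_expansion_exists:
  assumes "finite (B :: 'e::real_inner set)"
  shows "\<exists>E. finite E \<and> E \<subseteq> span B \<and> (\<forall>x\<in>span B. x = (\<Sum>b\<in>E. (x \<bullet> b) *\<^sub>R b)) \<and>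
    (\<forall>x\<in>E. \<forall>y\<in>E. x \<bullet> y = (if x = y then 1 else 0))"
  using assms
proof (induction B)
  case empty
  then show ?case by (intro exI[of _ "{}"]) simp
next
  case (insert a B)
  then obtain E where E: "finite E" "E \<subseteq> span B" "\<And>x. x \<in> span B \<Longrightarrow> x = (\<Sum>b\<in>E. (x \<bullet> b) *\<^sub>R b)"
    "\<And>x y. x \<in> E \<Longrightarrow> y \<in> E \<Longrightarrow> x \<bullet> y = (if x = y then 1 else 0)" by auto
  define p where "p = (\<Sum>b\<in>E. (a \<bullet> b) *\<^sub>R b)"
  define r where "r = a - p"
  have p: "p \<in> span B" unfolding p_def using E by (auto intro!: span_sum span_scale)
  have rb: "r \<bullet> b = 0" if "b \<in> E" for b
  proof -
    have "p \<bullet> b = (\<Sum>x\<in>E. if x = b then a \<bullet> b else 0)"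
      unfolding p_def inner_sum_left using E(4) that by (intro sum.cong) auto
    then show ?thesis using that E(1) by (simp add: r_def inner_diff_left)
  qed
  have rx: "r \<bullet> x = 0" if "x \<in> span B" for x
    by (subst E(3)[OF that]) (simp add: inner_sum_right rb)
  show ?case
  proof (cases "r = 0")
    case True
    then have "a \<in> span B" using p by (simp add: r_def)
    then have "span (insert a B) = span B" by (rule span_redundant)
    then show ?thesis using E by (intro exI[of _ E]) auto
  next
    case False
    define e where "e = r /\<^sub>R norm r"
    have ee: "e \<bullet> e = 1" unfolding e_def using False
      by (simp add: dot_square_norm power2_eq_square divide_simps)
    have eb: "e \<bullet> b = 0" "b \<bullet> e = 0" if "b \<in> span B" for b
      using rx[OF that] by (simp_all add: e_def inner_commute)
    have EB: "e \<notin> E" using eb E(2) ee by fastforce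
    have rsp: "r \<in> span (insert a B)" unfolding r_def
      using p span_mono[of B "insert a B"] by (auto intro!: span_diff intro: span_base)
    have esp: "e \<in> span (insert a B)" unfolding e_def by (rule span_scale[OF rsp])
    have exp: "x = (\<Sum>b\<in>insert e E. (x \<bullet> b) *\<^sub>R b)" if x: "x \<in> span (insert a B)" for x
    proof -
      obtain k where k: "x - k *\<^sub>R a \<in> span B" using x span_breakdown_eq by blast
      define y where "y = x - k *\<^sub>R r"
      have y: "y \<in> span B"
      proof -
        have "y = (x - k *\<^sub>R a) + k *\<^sub>R p" unfolding y_def r_def by (simp add: algebra_simps)
        then show ?thesis using k p by (simp add: span_add span_scale)
      qed
      have xy: "x = y + k *\<^sub>R r" by (simp add: y_def)
      have "x \<bullet> e = k * (r \<bullet> e)" using eb[OF y] by (simp add: xy inner_add_left)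
      also have "r \<bullet> e = norm r" unfolding e_def using False
        by (simp add: dot_square_norm power2_eq_square)
      finally have "(x \<bullet> e) *\<^sub>R e = k *\<^sub>R r" using False by (simp add: e_def)
      moreover have "(\<Sum>b\<in>E. (x \<bullet> b) *\<^sub>R b) = y"
        using E(3)[OF y] by (simp add: xy inner_add_left rb)
      ultimately show ?thesis using E(1) EB xy by simp
    qed
    have sub: "insert e E \<subseteq> span (insert a B)"
      using E(2) esp span_mono[of B "insert a B"] by blast
    have orth: "x \<bullet> y = (if x = y then 1 else 0)" if "x \<in> insert e E" "y \<in> insert e E" for x y
      using that E(2,4) ee eb EB by (auto simp: subset_iff)
    show ?thesis
    proof (intro exI[of _ "insert e E"] conjI ballI)
      show "finite (insert e E)" using E(1) by simp
    qed (fact sub exp orth)+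
  qed
qed

text \<open>A finite set in which vectors are expanded through their inner products, such as an orthonormal
  basis. It provides the coordinates on the model space.\<close>

definition expansion_set :: "'e::real_inner set \<Rightarrow> bool" where
  "expansion_set E \<longleftrightarrow> finite E \<and> (\<forall>x. x = (\<Sum>b\<in>E. (x \<bullet> b) *\<^sub>R b))"

lemma expansion_set_exists:
  assumes "finite B" "span B = (UNIV :: 'e::real_inner set)"
  shows "\<exists>E :: 'e set. expansion_set E"
proof -
  obtain E where "finite E" "\<forall>x\<in>span B. x = (\<Sum>b\<in>E. (x \<bullet> b) *\<^sub>R b)"
    using orthonormal_expansion_exists[OF assms(1)] by blast
  then have "expansion_set E" unfolding expansion_set_def assms(2) by blast
  then show ?thesis ..
qed

lemma expansion_set_finite: "expansion_set E \<Longrightarrow> finite E"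
  by (simp add: expansion_set_def)

lemma expansion_set_expand: "expansion_set E \<Longrightarrow> x = (\<Sum>b\<in>E. (x \<bullet> b) *\<^sub>R b)"
  unfolding expansion_set_def by blast

lemma linear_expansion:
  assumes "expansion_set E" "linear f"
  shows "f x = (\<Sum>b\<in>E. (x \<bullet> b) *\<^sub>R f b)"
proof -
  have "f x = f (\<Sum>b\<in>E. (x \<bullet> b) *\<^sub>R b)" by (rule arg_cong[OF expansion_set_expand[OF assms(1)]])
  then show ?thesis by (simp add: linear_sum[OF assms(2)] linear_scale[OF assms(2)])
qed

text \<open>By induction on the order, since the chain rule expresses the derivative of \<open>f \<circ> \<phi>\<close> by products of
  components of \<open>D\<phi>\<close> with functions \<open>\<partial>\<^sub>b f \<circ> \<phi>\<close> of the same kind.\<close>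

lemma smooth_on_compose:
  fixes \<phi> :: "'a::real_normed_vector \<Rightarrow> 'e::real_inner" and f :: "'e \<Rightarrow> real" and E :: "'e set"
  assumes E: "expansion_set E" and S: "open S" "\<phi> ` S \<subseteq> T"
    and \<phi>: "smooth_on S \<phi>" and f: "smooth_on T f"
  shows "smooth_on S (\<lambda>u. f (\<phi> u))"
proof -
  have "differentiable_of_order n S (\<lambda>u. f (\<phi> u))" for n
    using f
  proof (induction n arbitrary: f)
    case 0
    then show ?case
      using continuous_on_compose2[OF smooth_on_continuous_on smooth_on_continuous_on[OF \<phi>] S(2)]
      by simp
  next
    case (Suc n)
    have d: "(\<lambda>u. f (\<phi> u)) differentiable (at u)"
      "dir_deriv (\<lambda>u. f (\<phi> u)) u v = (\<Sum>b\<in>E. (dir_deriv \<phi> u v \<bullet> b) * dir_deriv f (\<phi> u) b)"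
      if u: "u \<in> S" for u v
    proof -
      have 1: "\<phi> differentiable (at u)" "f differentiable (at (\<phi> u))"
        using \<phi> Suc.prems u S(2) smooth_on_differentiable by blast+
      then show "(\<lambda>u. f (\<phi> u)) differentiable (at u)" by (rule differentiable_compose[rotated])
      show "dir_deriv (\<lambda>u. f (\<phi> u)) u v = (\<Sum>b\<in>E. (dir_deriv \<phi> u v \<bullet> b) * dir_deriv f (\<phi> u) b)"
        unfolding dir_deriv_chain[OF 1]
        by (rule linear_expansion[OF E linear_frechet_derivative[OF 1(2)], unfolded real_scaleR_def])
    qed
    have "differentiable_of_order n S (\<lambda>u. (dir_deriv \<phi> u v \<bullet> b) * dir_deriv f (\<phi> u) b)" for v b
      using smooth_on_linear_compose[OF S(1) bounded_linear_inner_left smooth_on_dir_deriv[OF \<phi>]]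
        Suc.IH[OF smooth_on_dir_deriv[OF Suc.prems]]
      by (intro differentiable_of_order_mult[OF S(1)]) (simp_all add: smooth_on_def)
    then have "differentiable_of_order n S (\<lambda>u. \<Sum>b\<in>E. (dir_deriv \<phi> u v \<bullet> b) * dir_deriv f (\<phi> u) b)" for v
      by (intro differentiable_of_order_sum[OF S(1)])
    then have "differentiable_of_order n S (\<lambda>u. dir_deriv (\<lambda>u. f (\<phi> u)) u v)" for v
      using differentiable_of_order_cong[OF S(1)] d(2) by (metis (no_types, lifting))
    then show ?case using d(1) by simp
  qed
  then show ?thesis by (simp add: smooth_on_def)
qed



section \<open>Alternating functions on lists of vectors\<close>

definition alternating_on :: "'v::real_vector set \<Rightarrow> ('v list \<Rightarrow> real) \<Rightarrow> bool" where
  "alternating_on V f \<longleftrightarrow> multilinear_on V f \<and> (\<forall>vs. \<not> distinct vs \<longrightarrow> f vs = 0)"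

lemma alternating_onD:
  assumes "alternating_on V f"
  shows "set us \<subseteq> V \<Longrightarrow> set ws \<subseteq> V \<Longrightarrow> x \<in> V \<Longrightarrow> y \<in> V \<Longrightarrow>
      f (us @ (a *\<^sub>R x + b *\<^sub>R y) # ws) = a * f (us @ x # ws) + b * f (us @ y # ws)"
    and "\<not> distinct vs \<Longrightarrow> f vs = 0"
  using assms unfolding alternating_on_def multilinear_on_def by simp_all

lemma alternating_on_swap:
  assumes "alternating_on V f" "subspace V" "set us \<subseteq> V" "set ws \<subseteq> V" "x \<in> V" "y \<in> V"
  shows "f (us @ x # y # ws) = - f (us @ y # x # ws)"
proof -
  have V: "x + y \<in> V" using assms by (simp add: subspace_add)
  have 0: "f (us @ z # z # ws) = 0" for z
    using alternating_onD(2)[OF assms(1)] by simp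
  have add: "f (us @ (x + y) # ws) = f (us @ x # ws) + f (us @ y # ws)"
    if "set us \<subseteq> V" "set ws \<subseteq> V" for us ws
    using alternating_onD(1)[OF assms(1) that assms(5,6), of 1 1] by simp
  have "0 = f (us @ (x + y) # (x + y) # ws)" by (simp add: 0)
  also have "\<dots> = f ((us @ [x]) @ (x + y) # ws) + f ((us @ [y]) @ (x + y) # ws)"
    using add[of us "(x + y) # ws"] assms V by simp
  also have "\<dots> = f (us @ x # y # ws) + f (us @ y # x # ws)"
    by (subst add, use assms in simp, use assms in simp)+ (use 0 in simp)
  finally show ?thesis by simp
qed

lemma alternating_on_move:
  assumes "alternating_on V f" "subspace V" "set ps \<subseteq> V" "set us \<subseteq> V" "set ws \<subseteq> V" "x \<in> V"
  shows "f (ps @ us @ x # ws) = (-1) ^ length us * f (ps @ x # us @ ws)"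
  using assms(4,5)
proof (induction us arbitrary: ws rule: rev_induct)
  case (snoc y us)
  have "f (ps @ (us @ [y]) @ x # ws) = f ((ps @ us) @ y # x # ws)" by simp
  also have "\<dots> = - f ((ps @ us) @ x # y # ws)"
    using assms snoc.prems by (intro alternating_on_swap[OF assms(1,2)]) auto
  also have "\<dots> = (-1) ^ length (us @ [y]) * f (ps @ x # (us @ [y]) @ ws)"
    using snoc.IH[of "y # ws"] snoc.prems by simp
  finally show ?case .
qed simp

lemma alternating_on_swap_blocks:
  assumes "alternating_on V f" "subspace V" "set us \<subseteq> V" "set zs \<subseteq> V" "set ps \<subseteq> V" "set ws \<subseteq> V"
  shows "f (ps @ us @ ws @ zs) = (-1) ^ (length us * length ws) * f (ps @ ws @ us @ zs)"
  using assms(5,6)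
proof (induction ws arbitrary: ps)
  case (Cons x ws)
  have "f (ps @ us @ (x # ws) @ zs) = (-1) ^ length us * f (ps @ x # us @ ws @ zs)"
    using alternating_on_move[OF assms(1,2) Cons.prems(1) assms(3), of "ws @ zs" x] Cons.prems assms(4)
    by simp
  also have "f (ps @ x # us @ ws @ zs) = (-1) ^ (length us * length ws) * f (ps @ (x # ws) @ us @ zs)"
    using Cons.IH[of "ps @ [x]"] Cons.prems by simp
  finally show ?case by (simp add: power_add)
qed simp


section \<open>Calculus of differential forms on open subsets of the model space\<close>

type_synonym 'e lform = "'e \<Rightarrow> 'e list \<Rightarrow> real"

definition smooth_coeffs :: "'e::real_normed_vector set \<Rightarrow> 'e lform \<Rightarrow> bool" where
  "smooth_coeffs U F \<longleftrightarrow> (\<forall>es. smooth_on U (\<lambda>u. F u es))"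

text \<open>Smooth forms on \<open>U\<close>, not necessarily homogeneous: the value on a list of vectors belongs to the
  component of degree the length of the list.\<close>

definition lforms :: "'e::real_normed_vector set \<Rightarrow> 'e lform set" where
  "lforms U = {F. (\<forall>u\<in>U. alternating_on UNIV (F u)) \<and> smooth_coeffs U F}"

text \<open>The operators are the exterior derivative (in the form in which it is computed in a chart), the
  derivative in a constant direction, the contraction with a constant vector field, the
  multiplication by a function and the wedge product with the differential of a function.\<close>

definition lder :: "'e::real_normed_vector lform \<Rightarrow> 'e lform" where
  "lder F = (\<lambda>u es. \<Sum>i<length es. (-1) ^ i * dir_deriv (\<lambda>u. F u (take i es @ drop (Suc i) es)) u (es ! i))"

definition ldir :: "'e::real_normed_vector \<Rightarrow> 'e lform \<Rightarrow> 'e lform" where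
  "ldir a F = (\<lambda>u es. dir_deriv (\<lambda>u. F u es) u a)"

definition lins :: "'e \<Rightarrow> 'e lform \<Rightarrow> 'e lform" where
  "lins a F = (\<lambda>u es. F u (a # es))"

definition lmul :: "('e \<Rightarrow> real) \<Rightarrow> 'e lform \<Rightarrow> 'e lform" where
  "lmul f F = (\<lambda>u es. f u * F u es)"

definition lwedge :: "('e::real_normed_vector \<Rightarrow> real) \<Rightarrow> 'e lform \<Rightarrow> 'e lform" where
  "lwedge f F = (\<lambda>u es. \<Sum>i<length es. (-1) ^ i * (dir_deriv f u (es ! i) * F u (take i es @ drop (Suc i) es)))"

text \<open>Cartan's formula for a constant vector field, \<open>\<iota>\<^sub>a d + d \<iota>\<^sub>a = \<partial>\<^sub>a\<close>, holds by the definition of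
  \<open>d\<close>. Together with \<open>lder_Nil\<close> it determines \<open>d\<close>, and the facts about \<open>d\<close> below follow from it by
  induction on the number of arguments.\<close>

lemma lder_Nil [simp]: "lder F u [] = 0"
  by (simp add: lder_def)

lemma lder_Cons: "lder F u (a # es) = ldir a F u es - lder (lins a F) u es"
  by (simp add: lder_def ldir_def lins_def sum.lessThan_Suc_shift sum_negf del: sum.lessThan_Suc)

lemma lins_lder: "lins a (lder F) = (\<lambda>u es. ldir a F u es - lder (lins a F) u es)"
  by (simp add: lins_def lder_Cons[unfolded lins_def])

lemma lwedge_Nil [simp]: "lwedge f F u [] = 0"
  by (simp add: lwedge_def)

lemma lwedge_Cons: "lwedge f F u (a # es) = dir_deriv f u a * F u es - lwedge f (lins a F) u es"
  by (simp add: lwedge_def lins_def sum.lessThan_Suc_shift sum_negf del: sum.lessThan_Suc)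

lemma lder_cong:
  assumes "open U" "\<And>x. x \<in> U \<Longrightarrow> F x = G x" "u \<in> U"
  shows "lder F u es = lder G u es"
  unfolding lder_def
  by (intro sum.cong refl arg_cong2[where f = "(*)"] fun_cong[OF frechet_derivative_cong_open[OF assms(1,3)]])
    (simp add: assms(2))

lemma ldir_cong:
  assumes "open U" "\<And>x. x \<in> U \<Longrightarrow> F x es = G x es" "u \<in> U"
  shows "ldir a F u es = ldir a G u es"
  unfolding ldir_def using frechet_derivative_cong_open[OF assms(1,3), of "\<lambda>u. F u es" "\<lambda>u. G u es"] assms(2)
  by simp

lemma smooth_coeffsD: "smooth_coeffs U F \<Longrightarrow> smooth_on U (\<lambda>u. F u es)"
  by (simp add: smooth_coeffs_def)

lemma smooth_coeffs_differentiable: "smooth_coeffs U F \<Longrightarrow> u \<in> U \<Longrightarrow> (\<lambda>u. F u es) differentiable (at u)"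
  by (rule smooth_on_differentiable[OF smooth_coeffsD])

lemma lformsD:
  assumes "F \<in> lforms U"
  shows "u \<in> U \<Longrightarrow> alternating_on UNIV (F u)" "smooth_coeffs U F"
  using assms by (simp_all add: lforms_def)

lemma lforms_subset: "F \<in> lforms U \<Longrightarrow> W \<subseteq> U \<Longrightarrow> F \<in> lforms W"
  unfolding lforms_def smooth_coeffs_def using smooth_on_subset by blast

lemma lforms_cong:
  assumes "open U" "\<And>u. u \<in> U \<Longrightarrow> F u = G u"
  shows "F \<in> lforms U \<longleftrightarrow> G \<in> lforms U"
proof -
  have "smooth_on U (\<lambda>u. F u es) = smooth_on U (\<lambda>u. G u es)" for es
    by (intro smooth_on_cong[OF assms(1)]) (simp add: assms(2))
  then show ?thesis using assms(2) by (simp add: lforms_def smooth_coeffs_def)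
qed

lemma smooth_coeffs_lins: "smooth_coeffs U F \<Longrightarrow> smooth_coeffs U (lins a F)"
  by (simp add: smooth_coeffs_def lins_def)

lemma smooth_coeffs_ldir: "smooth_coeffs U F \<Longrightarrow> smooth_coeffs U (ldir a F)"
  by (simp add: smooth_coeffs_def ldir_def smooth_on_dir_deriv)

lemma smooth_coeffs_lmul: "open U \<Longrightarrow> smooth_on U f \<Longrightarrow> smooth_coeffs U F \<Longrightarrow> smooth_coeffs U (lmul f F)"
  by (simp add: smooth_coeffs_def lmul_def smooth_on_mult)

lemma smooth_coeffs_lder: "open U \<Longrightarrow> smooth_coeffs U F \<Longrightarrow> smooth_coeffs U (lder F)"
  unfolding smooth_coeffs_def lder_def
  by (auto intro!: smooth_on_sum smooth_on_cmult smooth_on_dir_deriv)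

lemma lder_combination:
  assumes "smooth_coeffs U F" "smooth_coeffs U G" "u \<in> U"
  shows "lder (\<lambda>u es. a * F u es + b * G u es) u es = a * lder F u es + b * lder G u es"
proof -
  have "dir_deriv (\<lambda>u. a * F u es + b * G u es) u v = a * dir_deriv (\<lambda>u. F u es) u v + b * dir_deriv (\<lambda>u. G u es) u v"
    for es v
    using smooth_coeffs_differentiable[OF assms(1,3)] smooth_coeffs_differentiable[OF assms(2,3)]
    by (subst dir_deriv_add) (simp_all add: dir_deriv_cmult)
  then show ?thesis
    by (simp add: lder_def sum_distrib_left sum.distrib[symmetric] algebra_simps)
qed

lemma lder_add:
  assumes "smooth_coeffs U F" "smooth_coeffs U G" "u \<in> U"
  shows "lder (\<lambda>u es. F u es + G u es) u es = lder F u es + lder G u es"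
  using lder_combination[OF assms, of 1 1] by simp

lemma lder_diff:
  assumes "smooth_coeffs U F" "smooth_coeffs U G" "u \<in> U"
  shows "lder (\<lambda>u es. F u es - G u es) u es = lder F u es - lder G u es"
  using lder_combination[OF assms, of 1 "-1"] by simp

lemma lder_sum:
  assumes "\<And>i. i \<in> I \<Longrightarrow> smooth_coeffs U (F i)" "u \<in> U"
  shows "lder (\<lambda>u es. \<Sum>i\<in>I. F i u es) u es = (\<Sum>i\<in>I. lder (F i) u es)"
proof -
  have "dir_deriv (\<lambda>u. \<Sum>i\<in>I. F i u es) u v = (\<Sum>i\<in>I. dir_deriv (\<lambda>u. F i u es) u v)" for es v
    by (intro dir_deriv_sum smooth_coeffs_differentiable[OF assms(1) assms(2)])
  then have "lder (\<lambda>u es. \<Sum>i\<in>I. F i u es) u es = (\<Sum>j<length es. \<Sum>i\<in>I. (-1) ^ j *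
      dir_deriv (\<lambda>u. F i u (take j es @ drop (Suc j) es)) u (es ! j))"
    by (simp add: lder_def sum_distrib_left)
  also have "\<dots> = (\<Sum>i\<in>I. lder (F i) u es)" unfolding lder_def by (rule sum.swap)
  finally show ?thesis .
qed

lemma lder_lmul:
  assumes "smooth_on U f" "smooth_coeffs U F" "u \<in> U"
  shows "lder (lmul f F) u es = f u * lder F u es + lwedge f F u es"
proof -
  have "dir_deriv (\<lambda>u. f u * F u es) u v = f u * dir_deriv (\<lambda>u. F u es) u v + dir_deriv f u v * F u es" for es v
    using dir_deriv_mult[OF smooth_on_differentiable[OF assms(1,3)] smooth_coeffs_differentiable[OF assms(2,3)]]
    by simp
  then show ?thesis
    by (simp add: lder_def lmul_def lwedge_def sum_distrib_left sum.distrib[symmetric] algebra_simps)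
qed

lemma lforms_lins: "F \<in> lforms U \<Longrightarrow> lins a F \<in> lforms U"
  unfolding lforms_def
proof (safe, goal_cases)
  case (1 u)
  then have F: "alternating_on UNIV (F u)" by blast
  show ?case unfolding alternating_on_def multilinear_on_def
  proof (intro conjI allI impI)
    fix us ws :: "'a list" and x y r s
    show "lins a F u (us @ (r *\<^sub>R x + s *\<^sub>R y) # ws) = r *\<^sub>R lins a F u (us @ x # ws) + s *\<^sub>R lins a F u (us @ y # ws)"
      using alternating_onD(1)[OF F, of "a # us" ws x y r s] by (simp add: lins_def)
  next
    fix vs :: "'a list" assume "\<not> distinct vs"
    then show "lins a F u vs = 0" using alternating_onD(2)[OF F] by (simp add: lins_def)
  qed
qed (simp add: smooth_coeffs_lins)

lemma lforms_combination:
  assumes "open U" "F \<in> lforms U" "G \<in> lforms U"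
  shows "(\<lambda>u es. a * F u es + b * G u es) \<in> lforms U"
proof -
  have "alternating_on UNIV (\<lambda>es. a * F u es + b * G u es)" if "u \<in> U" for u
    using lformsD(1)[OF assms(2) that] lformsD(1)[OF assms(3) that]
    unfolding alternating_on_def multilinear_on_def by (simp add: algebra_simps)
  then show ?thesis using lformsD(2)[OF assms(2)] lformsD(2)[OF assms(3)]
    by (auto simp: lforms_def smooth_coeffs_def intro!: smooth_on_add smooth_on_cmult assms(1))
qed

lemma lforms_lmul:
  assumes "open U" "smooth_on U f" "F \<in> lforms U"
  shows "lmul f F \<in> lforms U"
proof -
  have "alternating_on UNIV (lmul f F u)" if "u \<in> U" for u
    using lformsD(1)[OF assms(3) that]
    unfolding alternating_on_def multilinear_on_def by (simp add: algebra_simps lmul_def)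
  then show ?thesis using smooth_coeffs_lmul[OF assms(1,2) lformsD(2)[OF assms(3)]]
    by (simp add: lforms_def)
qed

lemma ldir_alternating:
  assumes "open U" "F \<in> lforms U" "u \<in> U"
  shows "alternating_on UNIV (ldir a F u)"
  unfolding alternating_on_def multilinear_on_def
proof (intro conjI allI impI)
  fix us ws :: "'a list" and x y :: 'a and r s :: real
  have d: "(\<lambda>u. F u es) differentiable (at u)" for es
    by (rule smooth_coeffs_differentiable[OF lformsD(2)[OF assms(2)] assms(3)])
  have "ldir a F u (us @ (r *\<^sub>R x + s *\<^sub>R y) # ws)
      = dir_deriv (\<lambda>u. r * F u (us @ x # ws) + s * F u (us @ y # ws)) u a"
    unfolding ldir_def
    by (subst frechet_derivative_cong_open[OF assms(1,3)])
      (auto simp: alternating_onD(1)[OF lformsD(1)[OF assms(2)]])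
  then show "ldir a F u (us @ (r *\<^sub>R x + s *\<^sub>R y) # ws)
      = r *\<^sub>R ldir a F u (us @ x # ws) + s *\<^sub>R ldir a F u (us @ y # ws)"
    using d by (simp add: dir_deriv_add dir_deriv_cmult ldir_def)
next
  fix vs :: "'a list" assume "\<not> distinct vs"
  then have "ldir a F u vs = dir_deriv (\<lambda>u. 0 :: real) u a"
    unfolding ldir_def
    by (subst frechet_derivative_cong_open[OF assms(1,3)])
      (auto simp: alternating_onD(2)[OF lformsD(1)[OF assms(2)]])
  then show "ldir a F u vs = 0" by simp
qed

lemma lforms_ldir: "open U \<Longrightarrow> F \<in> lforms U \<Longrightarrow> ldir a F \<in> lforms U"
  using ldir_alternating smooth_coeffs_ldir by (auto simp: lforms_def)

lemma lins_lins:
  assumes "F \<in> lforms U" "u \<in> U"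
  shows "lins a (lins b F) u es = - lins b (lins a F) u es"
  using alternating_on_swap[OF lformsD(1)[OF assms], of "[]" es b a] by (simp add: lins_def)

lemma lins_lins_same:
  assumes "F \<in> lforms U" "u \<in> U"
  shows "lins a (lins a F) u es = 0"
  using alternating_onD(2)[OF lformsD(1)[OF assms]] by (simp add: lins_def)

lemma ldir_lins: "ldir a (lins b F) u es = ldir a F u (b # es)"
  by (simp add: ldir_def lins_def)

lemma ldir_linear:
  assumes "smooth_coeffs U F" "u \<in> U"
  shows "ldir (r *\<^sub>R x + s *\<^sub>R y) F u es = r * ldir x F u es + s * ldir y F u es"
  using dir_deriv_combination[OF smooth_coeffsD[OF assms(1)] assms(2)] by (simp add: ldir_def)

lemma lder_zero:
  assumes "open U" "\<And>x es. x \<in> U \<Longrightarrow> F x es = 0" "u \<in> U"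
  shows "lder F u es = 0"
proof -
  have "lder F u es = lder (\<lambda>u es. 0) u es"
    using assms by (intro lder_cong[OF assms(1)]) auto
  then show ?thesis by (simp add: lder_def)
qed

lemma lder_minus:
  assumes "smooth_coeffs U F" "u \<in> U"
  shows "lder (\<lambda>u es. - F u es) u es = - lder F u es"
  using lder_combination[OF assms(1) assms(1) assms(2), of "-1" 0] by simp

text \<open>The exterior derivative was defined by a sum that is not visibly alternating. Multilinearity follows from
  Cartan's formula, by induction on the number of arguments before the one that varies.\<close>

lemma lder_multilinear:
  assumes "open U" "F \<in> lforms U" "u \<in> U"
  shows "lder F u (us @ (r *\<^sub>R x + s *\<^sub>R y) # ws) = r * lder F u (us @ x # ws) + s * lder F u (us @ y # ws)"
  using assms(2)
proof (induction us arbitrary: F)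
  case Nil
  note sm = lformsD(2)[OF lforms_lins[OF Nil]]
  have "lder (lins (r *\<^sub>R x + s *\<^sub>R y) F) u ws = lder (\<lambda>u es. r * lins x F u es + s * lins y F u es) u ws"
    by (rule lder_cong[OF assms(1) _ assms(3)])
      (use alternating_onD(1)[OF lformsD(1)[OF Nil], of _ "[]"] in \<open>auto simp: lins_def fun_eq_iff\<close>)
  also have "\<dots> = r * lder (lins x F) u ws + s * lder (lins y F) u ws"
    by (rule lder_combination[OF sm sm assms(3)])
  finally show ?case
    using ldir_linear[OF lformsD(2)[OF Nil] assms(3)] by (simp add: lder_Cons algebra_simps)
next
  case (Cons e us)
  have "ldir e F u (us @ (r *\<^sub>R x + s *\<^sub>R y) # ws) = r * ldir e F u (us @ x # ws) + s * ldir e F u (us @ y # ws)"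
    using alternating_onD(1)[OF ldir_alternating[OF assms(1) Cons.prems assms(3)]] by simp
  then show ?case using Cons.IH[OF lforms_lins[OF Cons.prems]] by (simp add: lder_Cons algebra_simps)
qed

text \<open>Evaluated at a list that contains \<open>a\<close>, the form \<open>d \<iota>\<^sub>a F\<close> is a derivative of \<open>F\<close>: apply Cartan's formula
  to \<open>\<iota>\<^sub>a F\<close>, where \<open>\<iota>\<^sub>a \<iota>\<^sub>a F = 0\<close>.\<close>

lemma lder_lins_repeated:
  assumes "open U" "F \<in> lforms U" "u \<in> U"
  shows "lder (lins a F) u (es @ a # es') = ldir a F u (es @ a # es')"
  using assms(2)
proof (induction es arbitrary: F)
  case Nil
  have "lder (lins a (lins a F)) u es' = 0"
    by (rule lder_zero[OF assms(1) _ assms(3)]) (simp add: lins_lins_same[OF Nil])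
  then show ?case by (simp add: lder_Cons ldir_lins)
next
  case (Cons b es)
  have "ldir b (lins a F) u (es @ a # es') = 0"
    using alternating_onD(2)[OF ldir_alternating[OF assms(1) Cons.prems assms(3)]] by (simp add: ldir_lins)
  moreover have "lder (lins b (lins a F)) u (es @ a # es') = lder (\<lambda>u es. - lins a (lins b F) u es) u (es @ a # es')"
    by (rule lder_cong[OF assms(1) _ assms(3)]) (intro ext lins_lins[OF Cons.prems])
  moreover have "\<dots> = - lder (lins a (lins b F)) u (es @ a # es')"
    by (rule lder_minus[OF lformsD(2)[OF lforms_lins[OF lforms_lins[OF Cons.prems]]] assms(3)])
  moreover have "lder (lins a (lins b F)) u (es @ a # es') = ldir a F u ((b # es) @ a # es')"
    using Cons.IH[OF lforms_lins[OF Cons.prems]] by (simp add: ldir_lins)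
  ultimately show ?case by (simp add: lder_Cons)
qed

lemma lder_not_distinct:
  assumes "open U" "F \<in> lforms U" "u \<in> U" "\<not> distinct es"
  shows "lder F u es = 0"
  using assms(2,4)
proof (induction es arbitrary: F)
  case (Cons a es)
  show ?case
  proof (cases "a \<in> set es")
    case True
    then obtain es1 es2 where "es = es1 @ a # es2" by (auto simp: in_set_conv_decomp)
    then show ?thesis using lder_lins_repeated[OF assms(1) Cons.prems(1) assms(3)] by (simp add: lder_Cons)
  next
    case False
    then have "\<not> distinct es" using Cons.prems by simp
    then show ?thesis
      using Cons.IH[OF lforms_lins[OF Cons.prems(1)]]
        alternating_onD(2)[OF ldir_alternating[OF assms(1) Cons.prems(1) assms(3)]]
      by (simp add: lder_Cons)
  qed
qed simp

lemma lforms_lder: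
  assumes "open U" "F \<in> lforms U"
  shows "lder F \<in> lforms U"
  using lder_multilinear[OF assms] lder_not_distinct[OF assms]
    smooth_coeffs_lder[OF assms(1) lformsD(2)[OF assms(2)]]
  by (simp add: lforms_def alternating_on_def multilinear_on_def)

lemma ldir_lder:
  assumes "open U" "smooth_coeffs U F" "u \<in> U"
  shows "ldir a (lder F) u es = lder (ldir a F) u es"
proof -
  let ?r = "\<lambda>i. take i es @ drop (Suc i) es"
  have d: "(\<lambda>u. dir_deriv (\<lambda>u. F u vs) u v) differentiable (at u)" for vs v
    by (rule smooth_on_differentiable[OF smooth_on_dir_deriv[OF smooth_coeffsD[OF assms(2)]] assms(3)])
  have "ldir a (lder F) u es = (\<Sum>i<length es. (-1) ^ i * dir_deriv (\<lambda>u. dir_deriv (\<lambda>u. F u (?r i)) u (es ! i)) u a)"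
    unfolding ldir_def lder_def using d by (subst dir_deriv_sum) (auto simp: dir_deriv_cmult)
  also have "\<dots> = (\<Sum>i<length es. (-1) ^ i * dir_deriv (\<lambda>u. dir_deriv (\<lambda>u. F u (?r i)) u a) u (es ! i))"
    by (intro sum.cong refl arg_cong2[where f = "(*)"] dir_deriv_commute[OF assms(1,3) smooth_coeffsD[OF assms(2)]])
  finally show ?thesis by (simp add: ldir_def lder_def)
qed

text \<open>By Cartan's formula, \<open>d \<circ> d\<close> commutes with \<open>\<iota>\<^sub>a\<close> because \<open>d\<close> commutes with \<open>\<partial>\<^sub>a\<close>. So a
  value on \<open>k + 1\<close> arguments reduces to one on \<open>k\<close> arguments, and on no arguments it is zero.\<close>

lemma lder_lder:
  assumes "open U" "smooth_coeffs U F" "u \<in> U"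
  shows "lder (lder F) u es = 0"
  using assms(2)
proof (induction es arbitrary: F)
  case (Cons a es)
  have "lder (lder F) u (a # es) = lder (ldir a F) u es - lder (\<lambda>u es. ldir a F u es - lder (lins a F) u es) u es"
    by (simp add: lder_Cons lins_lder ldir_lder[OF assms(1) Cons.prems assms(3)])
  also have "\<dots> = lder (lder (lins a F)) u es"
    by (simp add: lder_diff[OF smooth_coeffs_ldir[OF Cons.prems]
          smooth_coeffs_lder[OF assms(1) smooth_coeffs_lins[OF Cons.prems]] assms(3)])
  also have "\<dots> = 0" by (rule Cons.IH[OF smooth_coeffs_lins[OF Cons.prems]])
  finally show ?case .
qed simp


section \<open>Naturality of the exterior derivative\<close>

definition pullback :: "('e::real_normed_vector \<Rightarrow> 'e) \<Rightarrow> 'e lform \<Rightarrow> 'e lform" where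
  "pullback \<phi> F = (\<lambda>u es. F (\<phi> u) (map (frechet_derivative \<phi> (at u)) es))"

lemma alternating_expand:
  assumes E: "expansion_set E" and f: "alternating_on UNIV f"
  shows "f (x # es) = (\<Sum>b\<in>E. (x \<bullet> b) * f (b # es))"
proof -
  have "linear (\<lambda>x. f (x # es))"
  proof (rule linearI)
    show "f ((x + y) # es) = f (x # es) + f (y # es)" for x y
      using alternating_onD(1)[OF f, of "[]" es x y 1 1] by simp
    show "f ((r *\<^sub>R x) # es) = r *\<^sub>R f (x # es)" for r x
      using alternating_onD(1)[OF f, of "[]" es x x r 0] by simp
  qed
  from linear_expansion[OF E this, of x] show ?thesis unfolding real_scaleR_def .
qed

lemma pullback_Cons:
  assumes "expansion_set E" "F \<in> lforms T" "\<phi> u \<in> T"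
  shows "pullback \<phi> F u (a # es) = (\<Sum>b\<in>E. (dir_deriv \<phi> u a \<bullet> b) * pullback \<phi> (lins b F) u es)"
  unfolding pullback_def lins_def list.map by (rule alternating_expand[OF assms(1) lformsD(1)[OF assms(2,3)]])

locale smooth_map =
  fixes E S T :: "'e::real_inner set" and \<phi> :: "'e \<Rightarrow> 'e"
  assumes E: "expansion_set E" and S: "open S" and \<phi>: "smooth_on S \<phi>" and ST: "\<phi> ` S \<subseteq> T"
begin

lemma smooth_comp: "smooth_on S (\<lambda>u. dir_deriv \<phi> u a \<bullet> b)"
  by (rule smooth_on_linear_compose[OF S bounded_linear_inner_left smooth_on_dir_deriv[OF \<phi>]])

lemma dir_deriv_comp_sym:
  assumes "u \<in> S"
  shows "dir_deriv (\<lambda>u. dir_deriv \<phi> u a \<bullet> b) u c = dir_deriv (\<lambda>u. dir_deriv \<phi> u c \<bullet> b) u a"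
proof -
  have d: "(\<lambda>u. dir_deriv \<phi> u a) differentiable (at u)" for a
    by (rule smooth_on_differentiable[OF smooth_on_dir_deriv[OF \<phi>] assms])
  show ?thesis
    using dir_deriv_commute[OF S assms \<phi>, of a c] by (simp add: dir_deriv_linear_compose[OF bounded_linear_inner_left d])
qed

lemma smooth_coeffs_pullback:
  assumes "F \<in> lforms T"
  shows "smooth_coeffs S (pullback \<phi> F)"
  unfolding smooth_coeffs_def
proof
  fix es show "smooth_on S (\<lambda>u. pullback \<phi> F u es)"
    using assms
  proof (induction es arbitrary: F)
    case Nil
    then show ?case
      using smooth_on_compose[OF E S ST \<phi> smooth_coeffsD[OF lformsD(2)]] by (simp add: pullback_def)
  next
    case (Cons a es)
    have "smooth_on S (\<lambda>u. pullback \<phi> F u (a # es)) =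
        smooth_on S (\<lambda>u. \<Sum>b\<in>E. (dir_deriv \<phi> u a \<bullet> b) * pullback \<phi> (lins b F) u es)"
      using pullback_Cons[OF E Cons.prems, of \<phi>] ST by (intro smooth_on_cong[OF S]) auto
    also have "\<dots>"
      by (intro smooth_on_sum smooth_on_mult smooth_comp Cons.IH lforms_lins Cons.prems S)
    finally show ?case by simp
  qed
qed

lemma lforms_pullback:
  assumes "F \<in> lforms T"
  shows "pullback \<phi> F \<in> lforms S"
proof -
  have "alternating_on UNIV (pullback \<phi> F u)" if u: "u \<in> S" for u
  proof -
    have F: "alternating_on UNIV (F (\<phi> u))" using u ST by (auto intro: lformsD(1)[OF assms])
    have l: "linear (frechet_derivative \<phi> (at u))" by (rule linear_dir_deriv[OF \<phi> u])
    show ?thesis unfolding alternating_on_def multilinear_on_def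
      using alternating_onD[OF F] by (auto simp: pullback_def linear_add[OF l] linear_scale[OF l] distinct_map)
  qed
  then show ?thesis using smooth_coeffs_pullback[OF assms] by (simp add: lforms_def)
qed

lemma lwedge_combination:
  assumes "finite I" 
  shows "lwedge f (\<lambda>u es. \<Sum>i\<in>I. g i u * G i u es) u es = (\<Sum>i\<in>I. g i u * lwedge f (G i) u es)"
proof -
  have "lwedge f (\<lambda>u es. \<Sum>i\<in>I. g i u * G i u es) u es =
    (\<Sum>j<length es. \<Sum>i\<in>I. g i u * ((-1) ^ j * (dir_deriv f u (es ! j) * G i u (take j es @ drop (Suc j) es))))"
    by (simp add: lwedge_def sum_distrib_left mult_ac)
  also have "\<dots> = (\<Sum>i\<in>I. g i u * lwedge f (G i) u es)"
    unfolding lwedge_def sum_distrib_left by (rule sum.swap)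
  finally show ?thesis .
qed

lemma lwedge_cong: "F u = G u \<Longrightarrow> lwedge f F u es = lwedge f G u es"
  by (simp add: lwedge_def)

lemma lwedge_minus: "lwedge f (\<lambda>u es. - F u es) u es = - lwedge f F u es"
  by (simp add: lwedge_def sum_negf)

text \<open>The derivative of a pullback in the direction \<open>a\<close>. The second sum collects the derivatives of
  the arguments \<open>D\<phi>(e\<^sub>j)\<close>: each is a second derivative of \<open>\<phi>\<close> in the directions \<open>e\<^sub>j\<close> and \<open>a\<close>, which by
  symmetry is the derivative of \<open>D\<phi>(a)\<close> in the direction \<open>e\<^sub>j\<close>; moving the argument to the front makes
  it a term of a wedge product.\<close>

lemma ldir_pullback:
  assumes "F \<in> lforms T" "u \<in> S" and T: "open T"
  shows "ldir a (pullback \<phi> F) u es = (\<Sum>b\<in>E. (dir_deriv \<phi> u a \<bullet> b) * pullback \<phi> (ldir b F) u es) +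
    (\<Sum>b\<in>E. lwedge (\<lambda>u. dir_deriv \<phi> u a \<bullet> b) (pullback \<phi> (lins b F)) u es)"
  using assms(1)
proof (induction es arbitrary: F)
  case Nil
  have 1: "\<phi> differentiable (at u)" by (rule smooth_on_differentiable[OF \<phi> assms(2)])
  have 2: "(\<lambda>x. F x []) differentiable (at (\<phi> u))"
    using ST assms(2) by (intro smooth_coeffs_differentiable[OF lformsD(2)[OF Nil]]) auto
  have "ldir a (pullback \<phi> F) u [] = dir_deriv (\<lambda>x. F x []) (\<phi> u) (dir_deriv \<phi> u a)"
    unfolding ldir_def pullback_def using dir_deriv_chain[OF 1 2] by simp
  also have "\<dots> = (\<Sum>b\<in>E. (dir_deriv \<phi> u a \<bullet> b) *\<^sub>R dir_deriv (\<lambda>x. F x []) (\<phi> u) b)"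
    by (rule linear_expansion[OF E linear_frechet_derivative[OF 2]])
  finally show ?case by (simp add: pullback_def ldir_def)
next
  case (Cons c es)
  note F = \<open>F \<in> lforms T\<close>
  let ?g = "\<lambda>b u. dir_deriv \<phi> u c \<bullet> b" and ?f = "\<lambda>b u. dir_deriv \<phi> u a \<bullet> b"
  note fin = expansion_set_finite[OF E]
  have Tu: "\<phi> x \<in> T" if "x \<in> S" for x using ST that by auto
  have d1: "?g d differentiable (at u)" for d
    by (rule smooth_on_differentiable[OF smooth_comp assms(2)])
  have d2: "(\<lambda>u. pullback \<phi> (lins d F) u es) differentiable (at u)" for d
    by (rule smooth_coeffs_differentiable[OF smooth_coeffs_pullback[OF lforms_lins[OF F]] assms(2)])
  have "ldir a (pullback \<phi> F) u (c # es) = dir_deriv (\<lambda>u. \<Sum>d\<in>E. ?g d u * pullback \<phi> (lins d F) u es) u a"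
    unfolding ldir_def
    by (subst frechet_derivative_cong_open[OF S assms(2)]) (auto intro: pullback_Cons[where \<phi> = \<phi>, OF E F Tu])
  also have "\<dots> = (\<Sum>d\<in>E. dir_deriv (?g d) u a * pullback \<phi> (lins d F) u es + ?g d u * ldir a (pullback \<phi> (lins d F)) u es)"
    by (subst dir_deriv_sum) (simp_all add: d1 d2 dir_deriv_mult ldir_def)
  also have "\<dots> = (\<Sum>d\<in>E. dir_deriv (?f d) u c * pullback \<phi> (lins d F) u es) +
     (\<Sum>d\<in>E. ?g d u * (\<Sum>b\<in>E. ?f b u * pullback \<phi> (ldir b (lins d F)) u es)) +
     (\<Sum>d\<in>E. ?g d u * (\<Sum>b\<in>E. lwedge (?f b) (pullback \<phi> (lins b (lins d F))) u es))"
    using Cons.IH[OF lforms_lins[OF F]] dir_deriv_comp_sym[OF assms(2), of c _ a]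
    by (simp add: sum.distrib distrib_left)
  also have "(\<Sum>d\<in>E. ?g d u * (\<Sum>b\<in>E. ?f b u * pullback \<phi> (ldir b (lins d F)) u es)) =
      (\<Sum>b\<in>E. ?f b u * pullback \<phi> (ldir b F) u (c # es))"
  proof -
    have "pullback \<phi> (ldir b F) u (c # es) = (\<Sum>d\<in>E. ?g d u * pullback \<phi> (ldir b (lins d F)) u es)" for b
    proof -
      have "lins d (ldir b F) = ldir b (lins d F)" for d by (simp add: lins_def ldir_def)
      then show ?thesis using pullback_Cons[where \<phi> = \<phi>, OF E lforms_ldir[OF T F] Tu[OF assms(2)]] by simp
    qed
    then show ?thesis by (simp add: sum_distrib_left mult_ac) (rule sum.swap)
  qed
  also have "(\<Sum>d\<in>E. ?g d u * (\<Sum>b\<in>E. lwedge (?f b) (pullback \<phi> (lins b (lins d F))) u es)) =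
      - (\<Sum>b\<in>E. lwedge (?f b) (lins c (pullback \<phi> (lins b F))) u es)"
  proof -
    have "lwedge (?f b) (lins c (pullback \<phi> (lins b F))) u es =
        (\<Sum>d\<in>E. ?g d u * lwedge (?f b) (pullback \<phi> (lins d (lins b F))) u es)" for b
    proof -
      have "lins c (pullback \<phi> (lins b F)) u = (\<lambda>es. \<Sum>d\<in>E. ?g d u * pullback \<phi> (lins d (lins b F)) u es)"
        by (auto simp: lins_def pullback_Cons[where \<phi> = \<phi>, OF E lforms_lins[OF F] Tu[OF assms(2)], unfolded lins_def])
      then have "lwedge (?f b) (lins c (pullback \<phi> (lins b F))) u es
          = lwedge (?f b) (\<lambda>u es. \<Sum>d\<in>E. ?g d u * pullback \<phi> (lins d (lins b F)) u es) u es"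
        by (intro lwedge_cong) simp
      then show ?thesis by (simp add: lwedge_combination[OF fin])
    qed
    moreover have "lwedge (?f b) (pullback \<phi> (lins b (lins d F))) u es
        = - lwedge (?f b) (pullback \<phi> (lins d (lins b F))) u es" for b d
      unfolding lwedge_minus[symmetric]
      unfolding pullback_def by (intro lwedge_cong ext lins_lins[OF F Tu[OF assms(2)]])
    ultimately show ?thesis
      by (simp add: sum_distrib_left sum_negf) (rule sum.swap)
  qed
  finally show ?case by (simp add: lwedge_Cons sum_subtractf)
qed

text \<open>By induction on the number of arguments: contract with \<open>a\<close> and use Cartan's formula on both sides. The
  terms \<open>df\<^sub>b \<and> _\<close>, which come from the coefficients \<open>f\<^sub>b\<close> of the vector \<open>D\<phi>(a)\<close>, cancel those in the
  derivative of the pullback.\<close>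

lemma lder_pullback:
  assumes "F \<in> lforms T" "u \<in> S" and T: "open T"
  shows "lder (pullback \<phi> F) u es = pullback \<phi> (lder F) u es"
  using assms(1)
proof (induction es arbitrary: F)
  case Nil
  then show ?case by (simp add: pullback_def)
next
  case (Cons a es)
  note F = \<open>F \<in> lforms T\<close>
  let ?f = "\<lambda>b u. dir_deriv \<phi> u a \<bullet> b"
  have Tu: "\<phi> x \<in> T" if "x \<in> S" for x using ST that by auto
  have sm: "smooth_coeffs S (pullback \<phi> (lins b F))" for b
    by (rule smooth_coeffs_pullback[OF lforms_lins[OF F]])
  have "lder (lins a (pullback \<phi> F)) u es = lder (\<lambda>u es. \<Sum>b\<in>E. lmul (?f b) (pullback \<phi> (lins b F)) u es) u es"
    by (rule lder_cong[OF S _ assms(2)]) (auto simp: lins_def lmul_def pullback_Cons[where \<phi> = \<phi>, OF E F Tu, unfolded lins_def])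
  also have "\<dots> = (\<Sum>b\<in>E. lder (lmul (?f b) (pullback \<phi> (lins b F))) u es)"
    by (rule lder_sum[OF smooth_coeffs_lmul[OF S smooth_comp sm] assms(2)])
  also have "\<dots> = (\<Sum>b\<in>E. ?f b u * pullback \<phi> (lder (lins b F)) u es + lwedge (?f b) (pullback \<phi> (lins b F)) u es)"
    by (simp add: lder_lmul[OF smooth_comp sm assms(2)] Cons.IH[OF lforms_lins[OF F]])
  finally have "lder (pullback \<phi> F) u (a # es) =
      (\<Sum>b\<in>E. ?f b u * pullback \<phi> (ldir b F) u es) - (\<Sum>b\<in>E. ?f b u * pullback \<phi> (lder (lins b F)) u es)"
    by (simp add: lder_Cons ldir_pullback[OF F assms(2) T] sum.distrib)
  also have "\<dots> = (\<Sum>b\<in>E. ?f b u * pullback \<phi> (lins b (lder F)) u es)"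
    by (simp add: lins_lder sum_subtractf[symmetric] pullback_def right_diff_distrib)
  also have "\<dots> = pullback \<phi> (lder F) u (a # es)"
    by (rule pullback_Cons[where \<phi> = \<phi>, OF E lforms_lder[OF T F] Tu[OF assms(2)], symmetric])
  finally show ?case .
qed

end



section \<open>Contractions and their derived bracket\<close>

text \<open>In a chart, a multi-vector field is a sum of products of functions \<open>f\<close> and products \<open>K\<close> of
  constant vectors; this is the contraction with it.\<close>

definition lcontract :: "(('e \<Rightarrow> real) \<times> 'e list) list \<Rightarrow> 'e lform \<Rightarrow> 'e lform" where
  "lcontract L F = (\<lambda>u es. \<Sum>(f, K)\<leftarrow>L. f u * F u (rev K @ es))"

definition smooth_terms :: "'e::real_normed_vector set \<Rightarrow> nat \<Rightarrow> (('e \<Rightarrow> real) \<times> 'e list) list \<Rightarrow> bool" where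
  "smooth_terms U k L \<longleftrightarrow> (\<forall>(f, K)\<in>set L. smooth_on U f \<and> length K = k)"

lemma smooth_terms_simps [simp]:
  "smooth_terms U k []"
  "smooth_terms U k ((f, K) # L) \<longleftrightarrow> smooth_on U f \<and> length K = k \<and> smooth_terms U k L"
  "smooth_terms U k (L @ L') \<longleftrightarrow> smooth_terms U k L \<and> smooth_terms U k L'"
  by (auto simp: smooth_terms_def)

lemma smooth_terms_subset: "smooth_terms U k L \<Longrightarrow> W \<subseteq> U \<Longrightarrow> smooth_terms W k L"
  unfolding smooth_terms_def using smooth_on_subset by blast

lemma lcontract_Nil [simp]: "lcontract [] F = (\<lambda>u es. 0)"
  by (simp add: lcontract_def)

lemma lcontract_Cons: "lcontract (t # L) F = (\<lambda>u es. lcontract [t] F u es + lcontract L F u es)"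
  by (simp add: lcontract_def)

lemma lcontract_append: "lcontract (L @ L') F u es = lcontract L F u es + lcontract L' F u es"
  by (simp add: lcontract_def)

lemma lcontract_cong: "F u = G u \<Longrightarrow> lcontract L F u es = lcontract L G u es"
  by (simp add: lcontract_def)

lemma lcontract_combination:
  "lcontract L (\<lambda>u es. a * F u es + b * G u es) u es = a * lcontract L F u es + b * lcontract L G u es"
  by (induction L) (auto simp: lcontract_def algebra_simps)

lemma lcontract_zero: "lcontract L (\<lambda>u es. 0) u es = 0"
  using lcontract_combination[of L 0 "\<lambda>u es. 0" 0 "\<lambda>u es. 0"] by simp

lemma lcontract_add: "lcontract L (\<lambda>u es. F u es + G u es) u es = lcontract L F u es + lcontract L G u es"
  using lcontract_combination[of L 1 F 1 G] by simp

lemma lcontract_diff: "lcontract L (\<lambda>u es. F u es - G u es) u es = lcontract L F u es - lcontract L G u es"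
  using lcontract_combination[of L 1 F "-1" G] by simp

lemma lcontract_single: "lcontract [(f, [])] F = lmul f F"
  by (simp add: lcontract_def lmul_def)

lemma lcontract_Cons_vector: "lcontract [(f, a # K)] F = lins a (lcontract [(f, K)] F)"
  by (simp add: lcontract_def lins_def)

lemma lforms_zero: "(\<lambda>u es. 0) \<in> lforms U"
  by (simp add: lforms_def alternating_on_def multilinear_on_def smooth_coeffs_def)

lemma lforms_lcontract:
  assumes "open U" "F \<in> lforms U"
  shows "smooth_terms U k L \<Longrightarrow> lcontract L F \<in> lforms U"
proof (induction L)
  case Nil
  then show ?case by (simp add: lforms_zero)
next
  case (Cons t L)
  obtain f K where t: "t = (f, K)" by force
  have "lcontract [(f, K)] F \<in> lforms U" if "smooth_on U f" for K
    by (induction K) (simp_all add: lcontract_single lcontract_Cons_vector lforms_lins lforms_lmul assms that)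
  then show ?case using lforms_combination[OF assms(1), of _ _ 1 1] Cons
    by (subst lcontract_Cons) (auto simp: t)
qed

lemma lcontract_lins:
  assumes "F \<in> lforms U" "u \<in> U" "smooth_terms U k L"
  shows "lcontract L (lins a F) u es = (-1) ^ k * lins a (lcontract L F) u es"
  using assms(3)
proof (induction L)
  case (Cons t L)
  obtain f K where t: "t = (f, K)" by force
  have "F u (rev K @ a # es) = (-1) ^ k * F u (a # rev K @ es)"
    using alternating_on_move[OF lformsD(1)[OF assms(1,2)], of "[]" "rev K" es a] Cons t by simp
  then have "F u (a # rev K @ es) = (-1) ^ k * F u (rev K @ a # es)" by simp
  then show ?case using Cons by (simp add: lcontract_def lins_def t algebra_simps)
qed (simp add: lins_def)

lemma lcontract_commute_single:
  assumes "F \<in> lforms U" "u \<in> U"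
  shows "lcontract [(f, K)] (lcontract [(g, J)] F) u es
    = (-1) ^ (length K * length J) * lcontract [(g, J)] (lcontract [(f, K)] F) u es"
  using alternating_on_swap_blocks[OF lformsD(1)[OF assms], of "rev K" es "[]" "rev J"]
  by (simp add: lcontract_def mult.commute)

lemma ldir_lcontract_single:
  assumes "smooth_on U g" "smooth_coeffs U F" "u \<in> U"
  shows "ldir a (lcontract [(g, J)] F) u es
    = lcontract [(\<lambda>u. dir_deriv g u a, J)] F u es + lcontract [(g, J)] (ldir a F) u es"
  using dir_deriv_mult[OF smooth_on_differentiable[OF assms(1,3)] smooth_coeffs_differentiable[OF assms(2,3)]]
  by (simp add: ldir_def lcontract_def)

text \<open>The graded commutator \<open>[[d, P], Q]\<close>, for operators \<open>P\<close>, \<open>Q\<close> of degrees \<open>-k\<close>, \<open>-l\<close>.\<close>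

definition derived_bracket ::
    "nat \<Rightarrow> nat \<Rightarrow> ('e::real_normed_vector lform \<Rightarrow> 'e lform) \<Rightarrow> ('e lform \<Rightarrow> 'e lform) \<Rightarrow> 'e lform \<Rightarrow> 'e lform"
  where
  "derived_bracket k l P Q F = (\<lambda>u es. lder (P (Q F)) u es - (-1) ^ k * P (lder (Q F)) u es
     - (-1) ^ (Suc k * l) * (Q (lder (P F)) u es - (-1) ^ k * Q (P (lder F)) u es))"

text \<open>The operator \<open>T\<close> is a contraction with a multi-vector field of degree \<open>d - 1\<close>. The shift allows
  for the bracket of two functions, which would have degree \<open>-1\<close> and is zero. One list of terms has to
  serve for all open subsets \<open>W\<close>, since charts are compared on their overlap.\<close>

definition is_contraction :: "'e::real_normed_vector set \<Rightarrow> nat \<Rightarrow> ('e lform \<Rightarrow> 'e lform) \<Rightarrow> bool" where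
  "is_contraction U d T \<longleftrightarrow> (\<exists>L. (\<forall>(f, K)\<in>set L. smooth_on U f \<and> Suc (length K) = d) \<and>
     (\<forall>W F u es. open W \<longrightarrow> W \<subseteq> U \<longrightarrow> F \<in> lforms W \<longrightarrow> u \<in> W \<longrightarrow> T F u es = lcontract L F u es))"

lemma is_contractionI:
  assumes "\<And>f K. (f, K) \<in> set L \<Longrightarrow> smooth_on U f \<and> Suc (length K) = d"
    "\<And>W F u es. open W \<Longrightarrow> W \<subseteq> U \<Longrightarrow> F \<in> lforms W \<Longrightarrow> u \<in> W \<Longrightarrow> T F u es = lcontract L F u es"
  shows "is_contraction U d T"
  unfolding is_contraction_def using assms by blast

lemma is_contraction_cong:
  assumes "is_contraction U d T"
    "\<And>W F u es. open W \<Longrightarrow> W \<subseteq> U \<Longrightarrow> F \<in> lforms W \<Longrightarrow> u \<in> W \<Longrightarrow> T' F u es = T F u es"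
  shows "is_contraction U d T'"
  using assms unfolding is_contraction_def by metis

lemma is_contraction_zero: "is_contraction U d (\<lambda>F u es. 0)"
  by (rule is_contractionI[of "[]"]) auto

lemma is_contraction_add:
  assumes "is_contraction U d T" "is_contraction U d T'"
  shows "is_contraction U d (\<lambda>F u es. T F u es + T' F u es)"
proof -
  obtain L where L: "\<forall>(f, K)\<in>set L. smooth_on U f \<and> Suc (length K) = d"
    "\<forall>W F u es. open W \<longrightarrow> W \<subseteq> U \<longrightarrow> F \<in> lforms W \<longrightarrow> u \<in> W \<longrightarrow> T F u es = lcontract L F u es"
    using assms(1) unfolding is_contraction_def by blast
  obtain L' where L': "\<forall>(f, K)\<in>set L'. smooth_on U f \<and> Suc (length K) = d"
    "\<forall>W F u es. open W \<longrightarrow> W \<subseteq> U \<longrightarrow> F \<in> lforms W \<longrightarrow> u \<in> W \<longrightarrow> T' F u es = lcontract L' F u es"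
    using assms(2) unfolding is_contraction_def by blast
  show ?thesis
    by (rule is_contractionI[of "L @ L'"]) (use L L' in \<open>auto simp: lcontract_append\<close>)
qed

lemma is_contraction_cmult_lins:
  assumes "is_contraction U d T" "open U"
  shows "is_contraction U (Suc d) (\<lambda>F u es. c * lins a (T F) u es)"
proof -
  obtain L where L: "\<forall>(f, K)\<in>set L. smooth_on U f \<and> Suc (length K) = d"
    "\<forall>W F u es. open W \<longrightarrow> W \<subseteq> U \<longrightarrow> F \<in> lforms W \<longrightarrow> u \<in> W \<longrightarrow> T F u es = lcontract L F u es"
    using assms(1) unfolding is_contraction_def by blast
  have "c * lins a (lcontract L F) u es = lcontract (map (\<lambda>(f, K). (\<lambda>u. c * f u, a # K)) L) F u es" for F u es
    by (induction L) (auto simp: lcontract_def lins_def algebra_simps)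
  with L show ?thesis
    by (intro is_contractionI[of "map (\<lambda>(f, K). (\<lambda>u. c * f u, a # K)) L"])
      (auto simp: smooth_on_cmult assms(2) lins_def)
qed

lemma is_contraction_single_single:
  assumes "smooth_on U g" "smooth_on U f" "open U" "Suc (length J + length K) = d"
  shows "is_contraction U d (\<lambda>F u es. c * lcontract [(g, J)] (lcontract [(f, K)] F) u es)"
  by (rule is_contractionI[of "[(\<lambda>u. c * (g u * f u), J @ K)]"])
    (use assms in \<open>auto simp: lcontract_def intro!: smooth_on_mult\<close>)

lemma minus_one_power_self_mult: "((-1::real) ^ n) * ((-1) ^ n * x) = x"
  by (simp add: mult.assoc[symmetric] power_mult_distrib[symmetric])

text \<open>For \<open>P = f\<close> and \<open>Q = \<iota>\<^sub>b Q'\<close>, where \<open>[d, f] = df \<and> _\<close> and \<open>[df \<and> _, \<iota>\<^sub>b] = \<partial>\<^sub>b f\<close>.\<close>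

lemma derived_bracket_function_Cons:
  assumes "open W" "F \<in> lforms W" "u \<in> W" "smooth_on W f" "smooth_on W g"
  shows "derived_bracket 0 (Suc (length J)) (lcontract [(f, [])]) (lcontract [(g, b # J)]) F u es
     = lcontract [(\<lambda>u. dir_deriv f u b, [])] (lcontract [(g, J)] F) u es
       - lins b (derived_bracket 0 (length J) (lcontract [(f, [])]) (lcontract [(g, J)]) F) u es"
proof -
  have *: "derived_bracket 0 (length J) (lcontract [(f, [])]) (lcontract [(g, J)]) F u es
      = lwedge f (lcontract [(g, J)] F) u es - (-1) ^ length J * lcontract [(g, J)] (lwedge f F) u es"
    for J es
  proof -
    have "lder (lmul f F) u = (\<lambda>es. f u * lder F u es + 1 * lwedge f F u es)"
      using lder_lmul[OF assms(4) lformsD(2)[OF assms(2)] assms(3)] by auto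
    then have "lcontract [(g, J)] (lder (lmul f F)) u es
        = lcontract [(g, J)] (\<lambda>v es. f u * lder F v es + 1 * lwedge f F v es) u es"
      by (intro lcontract_cong) auto
    also have "\<dots> = f u * lcontract [(g, J)] (lder F) u es + lcontract [(g, J)] (lwedge f F) u es"
      using lcontract_combination[of _ "f u" "lder F" 1 "lwedge f F"] by simp
    finally have "lcontract [(g, J)] (lder (lmul f F)) u es = \<dots>" .
    moreover have "lcontract [(g, J)] F \<in> lforms W"
      by (rule lforms_lcontract[OF assms(1,2)]) (use assms(5) in simp)
    moreover have "lcontract [(g, J)] (lmul f (lder F)) u es = f u * lcontract [(g, J)] (lder F) u es"
      by (simp add: lcontract_def lmul_def)
    ultimately show ?thesis
      unfolding derived_bracket_def lcontract_single
      using lder_lmul[OF assms(4) lformsD(2) assms(3), of "lcontract [(g, J)] F"]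
      by (simp add: algebra_simps) (simp add: lmul_def)
  qed
  show ?thesis
    using *[of "b # J" es] *[of J "b # es"]
    by (simp add: lins_def lwedge_Cons[unfolded lins_def] lcontract_Cons_vector lcontract_single lmul_def)
      (simp add: lwedge_def lcontract_def)?
qed

lemma derived_bracket_functions:
  assumes "open W" "F \<in> lforms W" "u \<in> W" "smooth_on W f" "smooth_on W g"
  shows "derived_bracket 0 0 (lcontract [(f, [])]) (lcontract [(g, [])]) F u es = 0"
proof -
  have "lder (lmul f (lmul g F)) u es = f u * lder (lmul g F) u es + lwedge f (lmul g F) u es"
    using lder_lmul[OF assms(4) smooth_coeffs_lmul[OF assms(1,5) lformsD(2)[OF assms(2)]] assms(3)] .
  moreover have "lwedge f (lmul g F) u es = g u * lwedge f F u es"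
    by (simp add: lwedge_def lmul_def sum_distrib_left mult_ac)
  ultimately show ?thesis
    using lder_lmul[OF assms(4) lformsD(2)[OF assms(2)] assms(3)]
    unfolding derived_bracket_def lcontract_single by (simp add: lmul_def algebra_simps)
qed

text \<open>For \<open>P = \<iota>\<^sub>a P'\<close>, the identity
  \<open>[[d, \<iota>\<^sub>a P'], Q] = \<plusminus> [\<partial>\<^sub>a, Q] P' - \<iota>\<^sub>a [[d, P'], Q]\<close>, which follows from \<open>[d, \<iota>\<^sub>a] = \<partial>\<^sub>a\<close> because
  contractions commute with each other.\<close>

lemma derived_bracket_Cons:
  assumes "open W" "F \<in> lforms W" "u \<in> W" "smooth_on W f" "smooth_on W g"
  shows "derived_bracket (Suc (length K)) (length J) (lcontract [(f, a # K)]) (lcontract [(g, J)]) F u es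
     = (-1) ^ (length K * length J) * lcontract [(\<lambda>u. dir_deriv g u a, J)] (lcontract [(f, K)] F) u es
       - lins a (derived_bracket (length K) (length J) (lcontract [(f, K)]) (lcontract [(g, J)]) F) u es"
proof -
  let ?P = "lcontract [(f, K)]" and ?Q = "lcontract [(g, J)]"
  let ?s = "(-1::real) ^ length K" and ?t = "(-1::real) ^ length J" and ?st = "(-1::real) ^ (length K * length J)"
  have Q: "smooth_terms W (length J) [(g, J)]" and P: "smooth_terms W (length K) [(f, K)]" using assms by simp_all
  have PF: "?P F \<in> lforms W" by (rule lforms_lcontract[OF assms(1,2) P])
  have 1: "lder (lins a (?P (?Q F))) u es = ldir a (?P (?Q F)) u es - lins a (lder (?P (?Q F))) u es"
    by (simp add: lins_lder)
  have 2: "ldir a (?P (?Q F)) u es = ?st * (lcontract [(\<lambda>u. dir_deriv g u a, J)] (?P F) u es + ?Q (ldir a (?P F)) u es)"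
  proof -
    have "ldir a (?P (?Q F)) u es = ldir a (\<lambda>u es. ?st * ?Q (?P F) u es) u es"
      by (rule ldir_cong[OF assms(1) _ assms(3)]) (rule lcontract_commute_single[OF assms(2)])
    also have "\<dots> = ?st * ldir a (?Q (?P F)) u es"
      unfolding ldir_def using smooth_coeffs_differentiable[OF lformsD(2)[OF lforms_lcontract[OF assms(1) PF Q]] assms(3)]
      by (simp add: dir_deriv_cmult)
    also have "ldir a (?Q (?P F)) u es = lcontract [(\<lambda>u. dir_deriv g u a, J)] (?P F) u es + ?Q (ldir a (?P F)) u es"
      by (rule ldir_lcontract_single[OF assms(5) lformsD(2)[OF PF] assms(3)])
    finally show ?thesis .
  qed
  have 3: "?Q (lder (lins a (?P F))) u es = ?Q (ldir a (?P F)) u es - ?t * lins a (?Q (lder (?P F))) u es"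
  proof -
    have "?Q (lder (lins a (?P F))) u es = ?Q (\<lambda>u es. ldir a (?P F) u es - lins a (lder (?P F)) u es) u es"
      by (simp add: lins_lder)
    then show ?thesis
      using lcontract_lins[OF lforms_lder[OF assms(1) PF] assms(3) Q] by (simp add: lcontract_diff)
  qed
  have 4: "?Q (lins a (?P (lder F))) u es = ?t * lins a (?Q (?P (lder F))) u es"
    by (rule lcontract_lins[OF lforms_lcontract[OF assms(1) lforms_lder[OF assms(1,2)] P] assms(3) Q])
  have s: "?t * (?t * x) = x" for x :: real by (rule minus_one_power_self_mult)
  show ?thesis
    unfolding derived_bracket_def lcontract_Cons_vector 1 2 3 4
    by (simp add: lins_def power_add algebra_simps s power_mult_distrib)
qed

text \<open>The induction peels off the constant vectors of both factors; the case without any is that of two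
  functions, whose double commutator with \<open>d\<close> is zero.\<close>

lemma derived_bracket_single:
  assumes "open U" "smooth_on U f" "smooth_on U g"
  shows "is_contraction U (length K + length J)
    (derived_bracket (length K) (length J) (lcontract [(f, K)]) (lcontract [(g, J)]))"
proof (induction K)
  case Nil
  show ?case
  proof (induction J)
    case Nil
    show ?case
      by (rule is_contraction_cong[OF is_contraction_zero])
        (simp add: derived_bracket_functions smooth_on_subset[OF assms(2)] smooth_on_subset[OF assms(3)])
  next
    case (Cons b J)
    have "is_contraction U (length ([] :: 'a list) + length (b # J)) (\<lambda>F u es.
        1 * lcontract [(\<lambda>u. dir_deriv f u b, [])] (lcontract [(g, J)] F) u es
         + (-1) * lins b (derived_bracket (length ([] :: 'a list)) (length J) (lcontract [(f, [])]) (lcontract [(g, J)]) F) u es)"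
      using is_contraction_cmult_lins[OF Cons assms(1), of "-1" b]
      by (intro is_contraction_add is_contraction_single_single assms smooth_on_dir_deriv) simp_all
    then show ?case
      by (rule is_contraction_cong)
        (simp add: derived_bracket_function_Cons smooth_on_subset[OF assms(2)] smooth_on_subset[OF assms(3)])
  qed
next
  case (Cons a K)
  have "is_contraction U (length (a # K) + length J) (\<lambda>F u es.
      (-1) ^ (length K * length J) * lcontract [(\<lambda>u. dir_deriv g u a, J)] (lcontract [(f, K)] F) u es
       + (-1) * lins a (derived_bracket (length K) (length J) (lcontract [(f, K)]) (lcontract [(g, J)]) F) u es)"
    using is_contraction_cmult_lins[OF Cons assms(1), of "-1" a]
    by (intro is_contraction_add is_contraction_single_single assms smooth_on_dir_deriv) simp_all
  then show ?case
    by (rule is_contraction_cong)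
      (simp add: derived_bracket_Cons smooth_on_subset[OF assms(2)] smooth_on_subset[OF assms(3)])
qed

lemma derived_bracket_Cons_left:
  assumes "open W" "F \<in> lforms W" "u \<in> W" "smooth_terms W k (t # L)" "smooth_terms W l L'"
  shows "derived_bracket k l (lcontract (t # L)) (lcontract L') F u es =
    derived_bracket k l (lcontract [t]) (lcontract L') F u es + derived_bracket k l (lcontract L) (lcontract L') F u es"
proof -
  have t: "smooth_terms W k [t]" and L: "smooth_terms W k L"
    using assms(4) by (cases t; simp)+
  note lf = lformsD(2)[OF lforms_lcontract[OF assms(1)]]
  have "lder (lcontract (t # L) G) u es' = lder (lcontract [t] G) u es' + lder (lcontract L G) u es'"
    if "G \<in> lforms W" for G es'
    by (subst lcontract_Cons, rule lder_add[OF lf[OF that t] lf[OF that L] assms(3)])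
  then have "lcontract L' (lder (lcontract (t # L) F)) u es
     = lcontract L' (\<lambda>u es. lder (lcontract [t] F) u es + lder (lcontract L F) u es) u es"
    "lder (lcontract (t # L) (lcontract L' F)) u es =
      lder (lcontract [t] (lcontract L' F)) u es + lder (lcontract L (lcontract L' F)) u es"
    using assms(2) lforms_lcontract[OF assms(1,2,5)] by (auto intro!: lcontract_cong)
  then show ?thesis
    unfolding derived_bracket_def by (subst (1 4) lcontract_Cons) (simp add: lcontract_add algebra_simps)
qed

lemma derived_bracket_Cons_right:
  assumes "open W" "F \<in> lforms W" "u \<in> W" "smooth_terms W k L" "smooth_terms W l (t # L')"
  shows "derived_bracket k l (lcontract L) (lcontract (t # L')) F u es =
    derived_bracket k l (lcontract L) (lcontract [t]) F u es + derived_bracket k l (lcontract L) (lcontract L') F u es"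
proof -
  have t: "smooth_terms W l [t]" and L: "smooth_terms W l L'"
    using assms(5) by (cases t; simp)+
  note lf = lforms_lcontract[OF assms(1)]
  note sm = lformsD(2)[OF lf]
  have "lcontract L (lcontract (t # L') F) = (\<lambda>u es. lcontract L (lcontract [t] F) u es + lcontract L (lcontract L' F) u es)"
    by (subst lcontract_Cons) (intro ext lcontract_add)
  then have "lder (lcontract L (lcontract (t # L') F)) u es
      = lder (lcontract L (lcontract [t] F)) u es + lder (lcontract L (lcontract L' F)) u es"
    using lder_add[OF sm[OF lf[OF assms(2) t] assms(4)] sm[OF lf[OF assms(2) L] assms(4)] assms(3)] by simp
  moreover have "lcontract L (lder (lcontract (t # L') F)) u es
      = lcontract L (\<lambda>u es. lder (lcontract [t] F) u es + lder (lcontract L' F) u es) u es"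
    by (rule lcontract_cong, subst lcontract_Cons)
      (auto simp: lder_add[OF sm[OF assms(2) t] sm[OF assms(2) L] assms(3)])
  ultimately show ?thesis
    unfolding derived_bracket_def by (subst (3 4) lcontract_Cons) (simp add: lcontract_add algebra_simps)
qed

text \<open>The Schouten bracket in a chart, obtained from that of single terms by bilinearity.\<close>

theorem derived_bracket_is_contraction:
  assumes "open U" "smooth_terms U k L" "smooth_terms U l L'"
  shows "is_contraction U (k + l) (derived_bracket k l (lcontract L) (lcontract L'))"
  using assms(2)
proof (induction L)
  case Nil
  show ?case
    by (rule is_contraction_cong[OF is_contraction_zero])
      (simp add: derived_bracket_def lcontract_zero lder_def)
next
  case (Cons t L)
  obtain f K where t: "t = (f, K)" by force
  have "is_contraction U (k + l) (derived_bracket k l (lcontract [t]) (lcontract L'))"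
    using assms(3)
  proof (induction L')
    case Nil
    show ?case
      by (rule is_contraction_cong[OF is_contraction_zero])
        (simp add: derived_bracket_def lcontract_zero lder_def)
  next
    case (Cons t' L')
    obtain g J where t': "t' = (g, J)" by force
    have "is_contraction U (k + l) (\<lambda>F u es. derived_bracket k l (lcontract [t]) (lcontract [t']) F u es
       + derived_bracket k l (lcontract [t]) (lcontract L') F u es)"
    proof (rule is_contraction_add)
      show "is_contraction U (k + l) (derived_bracket k l (lcontract [t]) (lcontract [t']))"
        using derived_bracket_single[OF assms(1), of f g K J] Cons.prems \<open>smooth_terms U k (t # L)\<close>
        by (simp add: t t')
      show "is_contraction U (k + l) (derived_bracket k l (lcontract [t]) (lcontract L'))"
        using Cons by (simp add: t')
    qed
    then show ?case
      by (rule is_contraction_cong)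
        (rule derived_bracket_Cons_right, assumption, assumption, assumption; use Cons.prems \<open>smooth_terms U k (t # L)\<close> in
          \<open>auto simp: t t' intro: smooth_on_subset smooth_terms_subset\<close>)
  qed
  moreover have "is_contraction U (k + l) (derived_bracket k l (lcontract L) (lcontract L'))"
    using Cons by (simp add: t)
  ultimately have "is_contraction U (k + l) (\<lambda>F u es. derived_bracket k l (lcontract [t]) (lcontract L') F u es
       + derived_bracket k l (lcontract L) (lcontract L') F u es)"
    by (rule is_contraction_add)
  then show ?case
    by (rule is_contraction_cong)
      (rule derived_bracket_Cons_left, assumption, assumption, assumption; use Cons.prems assms(3) in
        \<open>auto simp: t intro: smooth_on_subset smooth_terms_subset\<close>)
qed



section \<open>Contractions in the exterior algebra\<close>

lemma alt_forms_iff: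
  "\<beta> \<in> alt_forms k V \<longleftrightarrow> alternating_on V \<beta> \<and> (\<forall>vs. \<not> (length vs = k \<and> set vs \<subseteq> V) \<longrightarrow> \<beta> vs = 0)"
  by (auto simp: alt_forms_def alternating_on_def)

lemma alt_forms_outside:
  "\<beta> \<in> alt_forms k V \<Longrightarrow> \<not> (length vs = k \<and> set vs \<subseteq> V) \<Longrightarrow> \<beta> vs = 0"
  unfolding alt_forms_iff by blast

lemma alt_forms_zero: "(\<lambda>vs. 0) \<in> alt_forms k V"
  by (simp add: alt_forms_iff alternating_on_def multilinear_on_def)

lemma alt_forms_combination:
  assumes "\<beta> \<in> alt_forms k V" "\<gamma> \<in> alt_forms k V"
  shows "(\<lambda>vs. a * \<beta> vs + b * \<gamma> vs) \<in> alt_forms k V"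
  using assms unfolding alt_forms_iff alternating_on_def multilinear_on_def
  by (auto simp: algebra_simps)

lemma alt_forms_sum_list:
  "(\<And>t. t \<in> set L \<Longrightarrow> g t \<in> alt_forms k V) \<Longrightarrow> (\<lambda>vs. \<Sum>t\<leftarrow>L. c t * g t vs) \<in> alt_forms k V"
proof (induction L)
  case (Cons t L)
  then show ?case
    using alt_forms_combination[of "g t" k V "\<lambda>vs. \<Sum>t\<leftarrow>L. c t * g t vs" "c t" 1] by simp
qed (simp add: alt_forms_zero)

lemma alternating_on_append_left:
  assumes "alternating_on V \<beta>" "set ws \<subseteq> V"
  shows "alternating_on V (\<lambda>vs. \<beta> (ws @ vs))"
  unfolding alternating_on_def multilinear_on_def
proof (intro conjI allI impI)
  fix us zs x y and a b :: real
  assume "set us \<subseteq> V" "set zs \<subseteq> V" "x \<in> V" "y \<in> V"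
  then show "\<beta> (ws @ us @ (a *\<^sub>R x + b *\<^sub>R y) # zs) = a *\<^sub>R \<beta> (ws @ us @ x # zs) + b *\<^sub>R \<beta> (ws @ us @ y # zs)"
    using alternating_onD(1)[OF assms(1), of "ws @ us" zs x y a b] assms(2) by simp
qed (use alternating_onD(2)[OF assms(1)] in simp)

lemma alternating_on_rev_append:
  assumes "alternating_on V \<beta>" "set vs \<subseteq> V"
  shows "alternating_on V (\<lambda>ws. \<beta> (rev ws @ vs))"
  unfolding alternating_on_def multilinear_on_def
proof (intro conjI allI impI)
  fix us zs x y and a b :: real
  assume "set us \<subseteq> V" "set zs \<subseteq> V" "x \<in> V" "y \<in> V"
  then show "\<beta> (rev (us @ (a *\<^sub>R x + b *\<^sub>R y) # zs) @ vs)
      = a *\<^sub>R \<beta> (rev (us @ x # zs) @ vs) + b *\<^sub>R \<beta> (rev (us @ y # zs) @ vs)"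
    using alternating_onD(1)[OF assms(1), of "rev zs" "rev us @ vs" x y a b] assms(2) by simp
qed (use alternating_onD(2)[OF assms(1)] in simp)

lemma alt_forms_append_left:
  assumes "\<beta> \<in> alt_forms n V" "set ws \<subseteq> V"
  shows "(\<lambda>vs. \<beta> (ws @ vs)) \<in> alt_forms (n - length ws) V"
proof -
  have "\<beta> (ws @ vs) = 0" if "\<not> (length vs = n - length ws \<and> set vs \<subseteq> V)" for vs
    using assms(2) that by (intro alt_forms_outside[OF assms(1)]) auto
  moreover have "alternating_on V (\<lambda>vs. \<beta> (ws @ vs))"
    using alternating_on_append_left[of V \<beta> ws] assms unfolding alt_forms_iff by blast
  ultimately show ?thesis unfolding alt_forms_iff by blast
qed

text \<open>Explicit linear combinations of products of vectors. Identities that are linear in a multi-vector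
  are checked on these lists of terms.\<close>

definition mvec :: "'v::real_vector set \<Rightarrow> (real \<times> 'v list) list \<Rightarrow> 'v mvec" where
  "mvec V L = (\<lambda>\<beta>. \<Sum>t\<leftarrow>L. fst t * decomposable V (snd t) \<beta>)"

definition mvec_terms :: "nat \<Rightarrow> 'v set \<Rightarrow> (real \<times> 'v list) list \<Rightarrow> bool" where
  "mvec_terms k V L \<longleftrightarrow> (\<forall>(c, ws)\<in>set L. length ws = k \<and> set ws \<subseteq> V)"

lemma mvec_termsD: "mvec_terms k V L \<Longrightarrow> (c, ws) \<in> set L \<Longrightarrow> length ws = k \<and> set ws \<subseteq> V"
  by (auto simp: mvec_terms_def)

lemma mvec_terms_snd: "mvec_terms k V L \<Longrightarrow> t \<in> set L \<Longrightarrow> length (snd t) = k \<and> set (snd t) \<subseteq> V"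
  by (cases t) (simp add: mvec_termsD)

lemma mvec_in_ext_power: "mvec_terms k V L \<Longrightarrow> mvec V L \<in> ext_power k V"
proof (induction L)
  case Nil
  have "mvec V [] = 0" by (auto simp: mvec_def zero_fun_def)
  then show ?case unfolding ext_power_def by (simp only: span_zero)
next
  case (Cons t L)
  obtain c ws where t: "t = (c, ws)" by force
  have "mvec V (t # L) = c *\<^sub>R decomposable V ws + mvec V L"
    by (auto simp: mvec_def t scaleR_fun_def plus_fun_def)
  moreover have "decomposable V ws \<in> ext_power k V"
    unfolding ext_power_def using Cons.prems by (intro span_base) (auto simp: t mvec_terms_def)
  moreover have "mvec V L \<in> ext_power k V" using Cons by (simp add: mvec_terms_def)
  ultimately show ?case unfolding ext_power_def by (simp only: span_add span_scale)
qed

lemma ext_power_mvec: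
  assumes "x \<in> ext_power k V"
  obtains L where "mvec_terms k V L" "x = mvec V L"
proof -
  from assms have "\<exists>L. mvec_terms k V L \<and> x = mvec V L"
    unfolding ext_power_def
  proof (induction rule: span_induct_alt)
    case base
    show ?case by (intro exI[of _ "[]"]) (auto simp: mvec_terms_def mvec_def zero_fun_def)
  next
    case (step c x y)
    then obtain L ws where L: "mvec_terms k V L" "y = mvec V L"
      and ws: "x = decomposable V ws" "length ws = k" "set ws \<subseteq> V" by auto
    then show ?case
      by (intro exI[of _ "(c, ws) # L"]) (auto simp: mvec_terms_def mvec_def scaleR_fun_def plus_fun_def)
  qed
  then show ?thesis using that by blast
qed

lemma subspace_ext_power: "subspace (ext_power k V)"
  unfolding ext_power_def by (rule subspace_span)

lemma mvec_eval:
  assumes "mvec_terms k V L" "\<beta> \<in> alt_forms k V"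
  shows "mvec V L \<beta> = (\<Sum>t\<leftarrow>L. fst t * \<beta> (snd t))"
  using assms(1)
proof (induction L)
  case (Cons t L)
  then show ?case using assms(2) by (auto simp: mvec_def mvec_terms_def decomposable_def)
qed (simp add: mvec_def)

lemma mvec_outside:
  assumes "mvec_terms k V L" "\<beta> \<notin> alt_forms k V"
  shows "mvec V L \<beta> = 0"
  using assms(1)
proof (induction L)
  case (Cons t L)
  then show ?case using assms(2) by (auto simp: mvec_def mvec_terms_def decomposable_def)
qed (simp add: mvec_def)

lemma ext_power_outside: "x \<in> ext_power k V \<Longrightarrow> \<beta> \<notin> alt_forms k V \<Longrightarrow> x \<beta> = 0"
  by (metis ext_power_mvec mvec_outside)

lemma ext_power_linear:
  assumes "x \<in> ext_power k V" "\<beta> \<in> alt_forms k V" "\<gamma> \<in> alt_forms k V"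
  shows "x (\<lambda>vs. a * \<beta> vs + b * \<gamma> vs) = a * x \<beta> + b * x \<gamma>"
proof -
  obtain L where L: "mvec_terms k V L" "x = mvec V L" using assms(1) by (rule ext_power_mvec)
  have "(\<Sum>t\<leftarrow>L. fst t * (a * \<beta> (snd t) + b * \<gamma> (snd t))) = a * (\<Sum>t\<leftarrow>L. fst t * \<beta> (snd t)) + b * (\<Sum>t\<leftarrow>L. fst t * \<gamma> (snd t))"
    by (induction L) (auto simp: algebra_simps)
  then show ?thesis using mvec_eval[OF L(1)] assms alt_forms_combination[OF assms(2,3)] by (simp add: L(2))
qed

lemma ext_power_zero:
  assumes "x \<in> ext_power k V"
  shows "x (\<lambda>vs. 0) = 0"
  using ext_power_linear[OF assms alt_forms_zero alt_forms_zero, of 0 0] by simp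

lemma ext_power_sum_list:
  assumes "x \<in> ext_power k V" "\<And>t. t \<in> set L \<Longrightarrow> g t \<in> alt_forms k V"
  shows "x (\<lambda>vs. \<Sum>t\<leftarrow>L. c t * g t vs) = (\<Sum>t\<leftarrow>L. c t * x (g t))"
  using assms(2)
proof (induction L)
  case (Cons t L)
  then show ?case
    using ext_power_linear[OF assms(1), of "g t" "\<lambda>vs. \<Sum>t\<leftarrow>L. c t * g t vs" "c t" 1] alt_forms_sum_list[of L g k V c]
    by simp
qed (simp add: ext_power_zero[OF assms(1)])

lemma decomposable_contract:
  assumes "\<alpha> \<in> alt_forms n V" "set ws \<subseteq> V"
  shows "decomposable V ws (\<lambda>ws. \<alpha> (rev ws @ vs)) = \<alpha> (rev ws @ vs)"
proof (cases "length ws + length vs = n \<and> set vs \<subseteq> V")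
  case True
  have "(\<lambda>ws. \<alpha> (rev ws @ vs)) \<in> alt_forms (length ws) V"
    unfolding alt_forms_iff
  proof (intro conjI allI impI)
    show "alternating_on V (\<lambda>ws. \<alpha> (rev ws @ vs))"
      using alternating_on_rev_append[of V \<alpha> vs] assms True unfolding alt_forms_iff by blast
    fix us assume "\<not> (length us = length ws \<and> set us \<subseteq> V)"
    then show "\<alpha> (rev us @ vs) = 0" using True by (intro alt_forms_outside[OF assms(1)]) auto
  qed
  then show ?thesis by (simp add: decomposable_def)
next
  case False
  then have "\<alpha> (rev ws @ vs) = 0" by (intro alt_forms_outside[OF assms(1)]) auto
  then show ?thesis by (simp add: decomposable_def)
qed

lemma decomposable_append_left:
  assumes "\<beta> \<in> alt_forms (k + l) V" "set us \<subseteq> V" "length us = l"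
  shows "decomposable V us (\<lambda>us. \<beta> (zs @ us)) = (if length zs = k \<and> set zs \<subseteq> V then \<beta> (zs @ us) else 0)"
proof (cases "length zs = k \<and> set zs \<subseteq> V")
  case True
  then have "(\<lambda>us. \<beta> (zs @ us)) \<in> alt_forms (length us) V"
    using alt_forms_append_left[OF assms(1), of zs] assms(3) by simp
  then show ?thesis using True by (simp add: decomposable_def)
next
  case False
  then have "\<beta> (zs @ us) = 0" using assms by (intro alt_forms_outside[OF assms(1)]) auto
  with False show ?thesis by (simp only: decomposable_def if_False if_cancel)
qed

lemma ext_contract_mvec:
  assumes "mvec_terms k V L" "\<alpha> \<in> alt_forms n V"
  shows "ext_contract (mvec V L) \<alpha> vs = (\<Sum>t\<leftarrow>L. fst t * \<alpha> (rev (snd t) @ vs))"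
  using assms(1)
proof (induction L)
  case (Cons t L)
  then show ?case using decomposable_contract[OF assms(2)]
    by (auto simp: ext_contract_def mvec_def mvec_terms_def)
qed (simp add: ext_contract_def mvec_def)

lemma ext_contract_alt_forms:
  assumes "x \<in> ext_power k V" "\<alpha> \<in> alt_forms n V"
  shows "ext_contract x \<alpha> \<in> alt_forms (n - k) V"
proof -
  obtain L where L: "mvec_terms k V L" "x = mvec V L" using assms(1) by (rule ext_power_mvec)
  have "ext_contract x \<alpha> = (\<lambda>vs. \<Sum>t\<leftarrow>L. fst t * \<alpha> (rev (snd t) @ vs))"
    using ext_contract_mvec[OF L(1) assms(2)] unfolding L(2) by (rule ext)
  moreover have "\<dots> \<in> alt_forms (n - k) V"
  proof (rule alt_forms_sum_list)
    fix t assume "t \<in> set L"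
    then show "(\<lambda>vs. \<alpha> (rev (snd t) @ vs)) \<in> alt_forms (n - k) V"
      using alt_forms_append_left[OF assms(2), of "rev (snd t)"] L(1) by (auto simp: mvec_terms_def)
  qed
  ultimately show ?thesis by simp
qed

lemma ext_contract_linear:
  assumes "x \<in> ext_power k V" "\<alpha> \<in> alt_forms n V" "\<beta> \<in> alt_forms n V"
  shows "ext_contract x (\<lambda>vs. a * \<alpha> vs + b * \<beta> vs) = (\<lambda>vs. a * ext_contract x \<alpha> vs + b * ext_contract x \<beta> vs)"
proof -
  obtain L where L: "mvec_terms k V L" "x = mvec V L" using assms(1) by (rule ext_power_mvec)
  have "(\<Sum>t\<leftarrow>L. fst t * (a * \<alpha> (rev (snd t) @ vs) + b * \<beta> (rev (snd t) @ vs)))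
      = a * (\<Sum>t\<leftarrow>L. fst t * \<alpha> (rev (snd t) @ vs)) + b * (\<Sum>t\<leftarrow>L. fst t * \<beta> (rev (snd t) @ vs))" for vs
    by (induction L) (auto simp: algebra_simps)
  then show ?thesis
    unfolding L(2)
    by (intro ext) (simp only: ext_contract_mvec[OF L(1) assms(2)] ext_contract_mvec[OF L(1) assms(3)]
        ext_contract_mvec[OF L(1) alt_forms_combination[OF assms(2,3)]])
qed

lemma sum_list_swap:
  "(\<Sum>x\<leftarrow>L. \<Sum>y\<leftarrow>M. h x y) = (\<Sum>y\<leftarrow>M. \<Sum>x\<leftarrow>L. h x y :: 'a::comm_monoid_add)"
  by (induction L) (simp_all add: sum_list_addf)

text \<open>By bilinearity, it suffices to compare products of vectors.\<close>

lemma ext_contract_commute: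
  assumes V: "subspace V" and x: "x \<in> ext_power k V" and y: "y \<in> ext_power l V" and \<alpha>: "\<alpha> \<in> alt_forms n V"
  shows "ext_contract x (ext_contract y \<alpha>) = (\<lambda>vs. (-1) ^ (k * l) * ext_contract y (ext_contract x \<alpha>) vs)"
proof
  fix vs
  obtain L where L: "mvec_terms k V L" "x = mvec V L" using x by (rule ext_power_mvec)
  obtain M where M: "mvec_terms l V M" "y = mvec V M" using y by (rule ext_power_mvec)
  have alt: "alternating_on V \<alpha>" using \<alpha> by (simp add: alt_forms_iff)
  have xy: "ext_contract x (ext_contract y \<alpha>) vs = (\<Sum>t\<leftarrow>L. \<Sum>t'\<leftarrow>M. fst t * fst t' * \<alpha> (rev (snd t') @ rev (snd t) @ vs))"
  proof -
    have "ext_contract x (ext_contract y \<alpha>) vs = (\<Sum>t\<leftarrow>L. fst t * (\<Sum>t'\<leftarrow>M. fst t' * \<alpha> (rev (snd t') @ rev (snd t) @ vs)))"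
      using ext_contract_mvec[OF L(1) ext_contract_alt_forms[OF y \<alpha>]] ext_contract_mvec[OF M(1) \<alpha>]
      by (simp add: L(2) M(2))
    then show ?thesis by (simp add: sum_list_const_mult[symmetric] case_prod_beta mult.assoc)
  qed
  have yx: "ext_contract y (ext_contract x \<alpha>) vs = (\<Sum>t'\<leftarrow>M. \<Sum>t\<leftarrow>L. fst t * fst t' * \<alpha> (rev (snd t) @ rev (snd t') @ vs))"
  proof -
    have "ext_contract y (ext_contract x \<alpha>) vs = (\<Sum>t'\<leftarrow>M. fst t' * (\<Sum>t\<leftarrow>L. fst t * \<alpha> (rev (snd t) @ rev (snd t') @ vs)))"
      using ext_contract_mvec[OF M(1) ext_contract_alt_forms[OF x \<alpha>]] ext_contract_mvec[OF L(1) \<alpha>]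
      by (simp add: L(2) M(2))
    then show ?thesis by (simp add: sum_list_const_mult[symmetric] case_prod_beta mult.assoc mult.left_commute)
  qed
  show "ext_contract x (ext_contract y \<alpha>) vs = (-1) ^ (k * l) * ext_contract y (ext_contract x \<alpha>) vs"
  proof (cases "set vs \<subseteq> V")
    case True
    have s: "\<alpha> (rev us @ rev ws @ vs) = (-1) ^ (k * l) * \<alpha> (rev ws @ rev us @ vs)"
      if "(c, ws) \<in> set L" "(d, us) \<in> set M" for c d ws us
      using alternating_on_swap_blocks[OF alt V, of "rev us" vs "[]" "rev ws"] True
        mvec_termsD[OF L(1) that(1)] mvec_termsD[OF M(1) that(2)]
      by (simp add: mult.commute)
    have "ext_contract x (ext_contract y \<alpha>) vs =
        (\<Sum>t\<leftarrow>L. \<Sum>t'\<leftarrow>M. (-1) ^ (k * l) * (fst t * fst t' * \<alpha> (rev (snd t) @ rev (snd t') @ vs)))"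
      unfolding xy case_prod_beta
      by (intro arg_cong[where f = sum_list] map_cong refl) (use s in \<open>auto simp: mult_ac\<close>)
    also have "\<dots> = (\<Sum>t'\<leftarrow>M. \<Sum>t\<leftarrow>L. (-1) ^ (k * l) * (fst t * fst t' * \<alpha> (rev (snd t) @ rev (snd t') @ vs)))"
      by (rule sum_list_swap)
    finally show ?thesis unfolding yx by (simp add: sum_list_const_mult case_prod_beta)
  next
    case False
    then have "ext_contract x (ext_contract y \<alpha>) vs = 0" "ext_contract y (ext_contract x \<alpha>) vs = 0"
      using ext_contract_alt_forms[OF x ext_contract_alt_forms[OF y \<alpha>]]
        ext_contract_alt_forms[OF y ext_contract_alt_forms[OF x \<alpha>]] by (auto intro: alt_forms_outside)
    then show ?thesis by simp
  qed
qed

lemma sum_list_concat_map: "(\<Sum>x\<leftarrow>concat (map g L). h x) = (\<Sum>t\<leftarrow>L. \<Sum>x\<leftarrow>g t. h x)"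
  by (induction L) simp_all

lemma ext_mult_mvec:
  assumes L: "mvec_terms k V L" and M: "mvec_terms l V M"
  shows "ext_mult k l V (mvec V L) (mvec V M) =
    mvec V (concat (map (\<lambda>(c, ws). map (\<lambda>(d, us). (c * d, ws @ us)) M) L))" (is "_ = mvec V ?N")
    and "mvec_terms (k + l) V (concat (map (\<lambda>(c, ws). map (\<lambda>(d, us). (c * d, ws @ us)) M) L))"
proof -
  show N: "mvec_terms (k + l) V ?N" using L M by (fastforce simp: mvec_terms_def)
  show "ext_mult k l V (mvec V L) (mvec V M) = mvec V ?N"
  proof
    fix \<beta>
    show "ext_mult k l V (mvec V L) (mvec V M) \<beta> = mvec V ?N \<beta>"
    proof (cases "\<beta> \<in> alt_forms (k + l) V")
      case True
      define \<gamma> where "\<gamma> = (\<lambda>ws. mvec V M (\<lambda>us. \<beta> (ws @ us)))"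
      have ev: "decomposable V us (\<lambda>us. \<beta> (ws @ us)) = (if length ws = k \<and> set ws \<subseteq> V then \<beta> (ws @ us) else 0)"
        if "t \<in> set M" "t = (d, us)" for t d us ws
        using decomposable_append_left[of \<beta> k l V us ws] True mvec_termsD[OF M, of d us] that
        by simp
      have \<gamma>: "\<gamma> ws = (if length ws = k \<and> set ws \<subseteq> V then \<Sum>t'\<leftarrow>M. fst t' * \<beta> (ws @ snd t') else 0)" for ws
      proof -
        have "\<gamma> ws = (\<Sum>t\<leftarrow>M. fst t * (if length ws = k \<and> set ws \<subseteq> V then \<beta> (ws @ snd t) else 0))"
          unfolding \<gamma>_def mvec_def case_prod_beta
          by (intro arg_cong[where f = sum_list] map_cong refl arg_cong2[where f = "(*)"] ev) (assumption, rule surjective_pairing)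
        then show ?thesis by (cases "length ws = k \<and> set ws \<subseteq> V") (simp_all only: if_True if_False mult_zero_right sum_list_0 simp_thms)
      qed
      have "\<gamma> \<in> alt_forms k V"
        unfolding alt_forms_iff
      proof (intro conjI allI impI)
        have \<beta>: "alternating_on V \<beta>" using True by (simp add: alt_forms_iff)
        show "alternating_on V \<gamma>"
          unfolding alternating_on_def multilinear_on_def
        proof (intro conjI allI impI)
          fix us zs x y and a b :: real
          assume V: "set us \<subseteq> V" "set zs \<subseteq> V" "x \<in> V" "y \<in> V"
          have *: "(us @ z # zs) @ ws = us @ z # (zs @ ws)" for z ws by simp
          have lin: "\<beta> ((us @ (a *\<^sub>R x + b *\<^sub>R y) # zs) @ ws) = a * \<beta> ((us @ x # zs) @ ws) + b * \<beta> ((us @ y # zs) @ ws)"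
            if "set ws \<subseteq> V" for ws
            unfolding * by (rule alternating_onD(1)[OF \<beta>]) (use V that in auto)
          show "\<gamma> (us @ (a *\<^sub>R x + b *\<^sub>R y) # zs) = a *\<^sub>R \<gamma> (us @ x # zs) + b *\<^sub>R \<gamma> (us @ y # zs)"
          proof (cases "Suc (length us + length zs) = k")
            case True
            have "\<gamma> (us @ z # zs) = (\<Sum>t'\<leftarrow>M. fst t' * \<beta> ((us @ z # zs) @ (snd t')))" for z
            proof (cases "z \<in> V")
              case False
              have "\<beta> ((us @ z # zs) @ ws) = 0" for ws
                using False by (intro alt_forms_outside[OF \<open>\<beta> \<in> alt_forms (k + l) V\<close>]) auto
              with False show ?thesis by (simp add: \<gamma>)
            qed (use V True in \<open>simp add: \<gamma>\<close>)
            moreover have "(\<Sum>t'\<leftarrow>M. fst t' * \<beta> ((us @ (a *\<^sub>R x + b *\<^sub>R y) # zs) @ (snd t'))) =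
                a * (\<Sum>t'\<leftarrow>M. fst t' * \<beta> ((us @ x # zs) @ (snd t'))) + b * (\<Sum>t'\<leftarrow>M. fst t' * \<beta> ((us @ y # zs) @ (snd t')))"
              using M
            proof (induction M)
              case (Cons t M)
              then show ?case using lin[of "snd t"]
                by (cases t) (simp add: mvec_terms_def algebra_simps)
            qed simp
            ultimately show ?thesis by simp
          qed (simp add: \<gamma>)
        next
          fix vs :: "'a list" assume "\<not> distinct vs"
          then show "\<gamma> vs = 0" using alternating_onD(2)[OF \<beta>] by (simp add: \<gamma>)
        qed
      qed (auto simp: \<gamma>)
      then have "ext_mult k l V (mvec V L) (mvec V M) \<beta> = (\<Sum>t\<leftarrow>L. fst t * \<gamma> (snd t))"
        using mvec_eval[OF L] True by (simp add: ext_mult_def \<gamma>_def)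
      also have "\<dots> = (\<Sum>t\<leftarrow>L. fst t * (\<Sum>t'\<leftarrow>M. fst t' * \<beta> (snd t @ (snd t'))))"
        unfolding case_prod_beta
        by (intro arg_cong[where f = sum_list] map_cong refl) (use mvec_terms_snd[OF L] in \<open>simp add: \<gamma>\<close>)
      also have "\<dots> = mvec V ?N \<beta>"
        unfolding mvec_eval[OF N True]
        by (simp add: sum_list_concat_map case_prod_beta sum_list_const_mult[symmetric] o_def mult.assoc)
      finally show ?thesis .
    qed (simp add: ext_mult_def mvec_outside[OF N])
  qed
qed

lemma ext_mult_in_ext_power:
  assumes x: "x \<in> ext_power k V" and y: "y \<in> ext_power l V"
  shows "ext_mult k l V x y \<in> ext_power (k + l) V"
proof -
  obtain L where L: "mvec_terms k V L" "x = mvec V L" using x by (rule ext_power_mvec)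
  obtain M where M: "mvec_terms l V M" "y = mvec V M" using y by (rule ext_power_mvec)
  show ?thesis unfolding L(2) M(2) ext_mult_mvec(1)[OF L(1) M(1)]
    by (rule mvec_in_ext_power[OF ext_mult_mvec(2)[OF L(1) M(1)]])
qed

lemma ext_contract_ext_mult:
  assumes x: "x \<in> ext_power k V" and y: "y \<in> ext_power l V" and \<alpha>: "\<alpha> \<in> alt_forms n V"
  shows "ext_contract (ext_mult k l V x y) \<alpha> = ext_contract x (ext_contract y \<alpha>)"
proof
  fix vs
  obtain L where L: "mvec_terms k V L" "x = mvec V L" using x by (rule ext_power_mvec)
  obtain M where M: "mvec_terms l V M" "y = mvec V M" using y by (rule ext_power_mvec)
  have "ext_contract (ext_mult k l V x y) \<alpha> vs =
      (\<Sum>t\<leftarrow>L. fst t * (\<Sum>t'\<leftarrow>M. fst t' * \<alpha> (rev (snd t') @ rev (snd t) @ vs)))"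
    using ext_contract_mvec[OF ext_mult_mvec(2)[OF L(1) M(1)] \<alpha>] ext_mult_mvec(1)[OF L(1) M(1)]
    by (simp add: L(2) M(2) sum_list_concat_map case_prod_beta sum_list_const_mult[symmetric] o_def mult.assoc)
  also have "\<dots> = ext_contract x (ext_contract y \<alpha>) vs"
    using ext_contract_mvec[OF L(1) ext_contract_alt_forms[OF y \<alpha>]] ext_contract_mvec[OF M(1) \<alpha>]
    by (simp add: L(2) M(2))
  finally show "ext_contract (ext_mult k l V x y) \<alpha> vs = ext_contract x (ext_contract y \<alpha>) vs" .
qed

lemma decomposable_Nil_contract:
  assumes "\<alpha> \<in> alt_forms n V"
  shows "ext_contract (decomposable V []) \<alpha> = \<alpha>"
  using ext_contract_mvec[of 0 V "[(1, [])]" \<alpha> n] assms by (auto simp: mvec_terms_def mvec_def)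

lemma decomposable_Nil_in_ext_power: "decomposable V [] \<in> ext_power 0 V"
  unfolding ext_power_def by (intro span_base) auto


lemma dir_deriv_inner: "dir_deriv (\<lambda>u. u \<bullet> a) u v = v \<bullet> a"
  by (rule dir_deriv_eqI) (auto intro!: derivative_eq_intros)

lemma smooth_on_inner:
  assumes "open U"
  shows "smooth_on U (\<lambda>u :: 'e::real_inner. u \<bullet> a)"
  unfolding smooth_on_def
proof
  fix n show "differentiable_of_order n U (\<lambda>u. u \<bullet> a)"
    by (cases n) (auto simp: dir_deriv_inner differentiable_of_order_const intro!: continuous_intros
        bounded_linear_imp_differentiable bounded_linear_inner_left)
qed

text \<open>The product \<open>a \<and> e\<close> of a covector and a constant form is the exterior derivative of \<open>\<langle>u, a\<rangle> e\<close>, so that it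
  is alternating because exterior derivatives are.\<close>

lemma lwedge_inner_alt_forms:
  fixes a :: "'e::real_inner"
  assumes "e \<in> alt_forms k UNIV"
  shows "lwedge (\<lambda>u. u \<bullet> a) (\<lambda>u. e) 0 \<in> alt_forms (Suc k) UNIV"
proof -
  have e: "(\<lambda>u. e) \<in> lforms (UNIV :: 'e set)"
    using assms by (simp add: lforms_def smooth_coeffs_def alt_forms_iff)
  have sm: "smooth_on UNIV (\<lambda>u :: 'e. u \<bullet> a)" by (rule smooth_on_inner) simp
  have "lder (lmul (\<lambda>u. u \<bullet> a) (\<lambda>u. e)) 0 = lwedge (\<lambda>u. u \<bullet> a) (\<lambda>u. e) 0"
    by (rule ext, subst lder_lmul[OF sm lformsD(2)[OF e]]) (simp_all add: lder_def)
  moreover have "alternating_on UNIV (lder (lmul (\<lambda>u. u \<bullet> a) (\<lambda>u. e)) 0)"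
    by (rule lformsD(1)[OF lforms_lder[OF open_UNIV lforms_lmul[OF open_UNIV sm e]]]) simp
  ultimately have "alternating_on UNIV (lwedge (\<lambda>u. u \<bullet> a) (\<lambda>u. e) 0)" by simp
  moreover have "lwedge (\<lambda>u. u \<bullet> a) (\<lambda>u. e) 0 vs = 0" if "length vs \<noteq> Suc k" for vs
    unfolding lwedge_def
    by (intro sum.neutral ballI) (use that in \<open>auto intro!: alt_forms_outside[OF assms]\<close>)
  ultimately show ?thesis by (simp add: alt_forms_iff)
qed

lemma euler_identity:
  assumes E: "expansion_set E" and \<beta>: "\<beta> \<in> alt_forms (Suc k) UNIV"
  shows "(\<Sum>a\<in>E. lwedge (\<lambda>u. u \<bullet> a) (\<lambda>u es. \<beta> (a # es)) 0 es) = real (Suc k) * \<beta> es"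
proof -
  have alt: "alternating_on UNIV \<beta>" using \<beta> by (simp add: alt_forms_iff)
  have move: "(-1) ^ i * \<beta> (es ! i # take i es @ drop (Suc i) es) = \<beta> es" if "i < length es" for i
  proof -
    have "\<beta> es = \<beta> ([] @ take i es @ es ! i # drop (Suc i) es)"
      using that by (simp add: Cons_nth_drop_Suc)
    also have "\<dots> = (-1) ^ i * \<beta> (es ! i # take i es @ drop (Suc i) es)"
      using alternating_on_move[OF alt, of "[]" "take i es" "drop (Suc i) es" "es ! i"] that by simp
    finally show ?thesis by simp
  qed
  have "(\<Sum>a\<in>E. lwedge (\<lambda>u. u \<bullet> a) (\<lambda>u es. \<beta> (a # es)) 0 es) =
      (\<Sum>i<length es. (-1) ^ i * (\<Sum>a\<in>E. (es ! i \<bullet> a) * \<beta> (a # take i es @ drop (Suc i) es)))"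
    unfolding lwedge_def dir_deriv_inner sum_distrib_left by (rule sum.swap)
  also have "\<dots> = (\<Sum>i<length es. \<beta> es)"
    unfolding alternating_expand[OF E alt, symmetric] by (rule sum.cong) (auto simp: move)
  also have "\<dots> = real (length es) * \<beta> es" by simp
  also have "\<dots> = real (Suc k) * \<beta> es"
    using alt_forms_outside[OF \<beta>, of es] by (cases "length es = Suc k") auto
  finally show ?thesis .
qed

text \<open>The alternating forms on the model space are spanned by finitely many, with coefficients that
  are values of the form. In the induction step, a form \<open>\<beta>\<close> of degree \<open>k + 1\<close> is recovered from its
  contractions by Euler's identity \<open>\<Sum>\<^sub>a a \<and> \<iota>\<^sub>a \<beta> = (k + 1) \<beta>\<close>.\<close>

lemma alt_forms_finite_expansion:
  assumes E: "expansion_set (E :: 'e::real_inner set)"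
  shows "\<exists>R. (\<forall>(e, I)\<in>set R. e \<in> alt_forms k (UNIV :: 'e set) \<and> length I = k) \<and>
    (\<forall>\<beta>\<in>alt_forms k UNIV. \<forall>es. \<beta> es = (\<Sum>t\<leftarrow>R. \<beta> (snd t) * fst t es))"
proof (induction k)
  case 0
  define e :: "'e list \<Rightarrow> real" where "e = (\<lambda>es. if es = [] then 1 else 0)"
  have "e \<in> alt_forms 0 UNIV" by (auto simp: e_def alt_forms_iff alternating_on_def multilinear_on_def)
  moreover have "\<beta> es = \<beta> [] * e es" if "\<beta> \<in> alt_forms 0 UNIV" for \<beta> es
    using alt_forms_outside[OF that, of es] by (simp add: e_def)
  ultimately show ?case by (intro exI[of _ "[(e, [])]"]) auto
next
  case (Suc k)
  then obtain R where R: "\<And>e I. (e, I) \<in> set R \<Longrightarrow> e \<in> alt_forms k (UNIV :: 'e set) \<and> length I = k"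
    "\<And>\<beta> es. \<beta> \<in> alt_forms k UNIV \<Longrightarrow> \<beta> es = (\<Sum>t\<leftarrow>R. \<beta> (snd t) * fst t es)" by blast
  obtain as where as: "distinct as" "set as = E"
    using finite_distinct_list[OF expansion_set_finite[OF E]] by blast
  define w where "w a e = (\<lambda>es. 1 / real (Suc k) * lwedge (\<lambda>u. u \<bullet> a) (\<lambda>u. e) 0 es + 0 * e es)" for a :: 'e and e
  have w: "w a e \<in> alt_forms (Suc k) UNIV" if "e \<in> alt_forms k UNIV" for a e
    using alt_forms_combination[OF lwedge_inner_alt_forms[OF that] lwedge_inner_alt_forms[OF that], of "1 / real (Suc k)" a 0]
    by (simp add: w_def)
  define R' where "R' = concat (map (\<lambda>a. map (\<lambda>(e, I). (w a e, a # I)) R) as)"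
  have "\<beta> es = (\<Sum>t\<leftarrow>R'. \<beta> (snd t) * fst t es)" if \<beta>: "\<beta> \<in> alt_forms (Suc k) UNIV" for \<beta> es
  proof -
    have cut: "(\<lambda>es. \<beta> (a # es)) \<in> alt_forms k UNIV" for a
      using alt_forms_append_left[OF \<beta>, of "[a]"] by simp
    have lw: "lwedge (\<lambda>u. u \<bullet> a) (\<lambda>u es. \<beta> (a # es)) 0 es
        = (\<Sum>t\<leftarrow>R. \<beta> (a # snd t) * lwedge (\<lambda>u. u \<bullet> a) (\<lambda>u. fst t) 0 es)" for a
    proof -
      have "lwedge (\<lambda>u. u \<bullet> a) (\<lambda>u es. \<beta> (a # es)) 0 es =
          lwedge (\<lambda>u. u \<bullet> a) (\<lambda>u es. \<Sum>t\<leftarrow>R. \<beta> (a # snd t) * fst t es) 0 es"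
        by (intro arg_cong[where f = "\<lambda>F. lwedge (\<lambda>u. u \<bullet> a) F 0 es"] ext R(2)[OF cut])
      also have "\<dots> = (\<Sum>t\<leftarrow>R. \<beta> (a # snd t) * lwedge (\<lambda>u. u \<bullet> a) (\<lambda>u. fst t) 0 es)"
      proof (induction R)
        case (Cons t R)
        then show ?case
          by (cases t) (simp add: lwedge_def sum.distrib distrib_left sum_distrib_left mult_ac)
      qed (simp add: lwedge_def)
      finally show ?thesis .
    qed
    have "real (Suc k) * \<beta> es = (\<Sum>a\<leftarrow>as. \<Sum>t\<leftarrow>R. \<beta> (a # snd t) * lwedge (\<lambda>u. u \<bullet> a) (\<lambda>u. fst t) 0 es)"
      unfolding euler_identity[OF E \<beta>, symmetric] lw unfolding as(2)[symmetric]
      by (rule sum_list_distinct_conv_sum_set[OF as(1), symmetric])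
    then have "\<beta> es = 1 / real (Suc k) * (\<Sum>a\<leftarrow>as. \<Sum>t\<leftarrow>R. \<beta> (a # snd t) * lwedge (\<lambda>u. u \<bullet> a) (\<lambda>u. fst t) 0 es)"
      by (simp add: field_simps)
    also have "\<dots> = (\<Sum>t\<leftarrow>R'. \<beta> (snd t) * fst t es)"
      unfolding R'_def sum_list_concat_map sum_list_const_mult[symmetric]
      by (simp add: case_prod_beta w_def o_def mult_ac)
    finally show ?thesis .
  qed
  moreover have "\<forall>(e, I)\<in>set R'. e \<in> alt_forms (Suc k) UNIV \<and> length I = Suc k"
    using R(1) w by (fastforce simp: R'_def)
  ultimately show ?case by blast
qed



section \<open>Charts and tangent vectors\<close>

locale manifold =
  fixes X :: "'p topology" and A :: "('p, 'e::real_inner) chart set"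
  assumes manifold: "smooth_manifold X A"
begin

abbreviation img :: "('p, 'e) chart \<Rightarrow> 'e set" where "img c \<equiv> snd c ` fst c"
abbreviation T :: "'p \<Rightarrow> ('p, 'e) tvec set" where "T p \<equiv> tangent_space A p"
abbreviation coord :: "('p, 'e) chart \<Rightarrow> 'p \<Rightarrow> 'e \<Rightarrow> ('p, 'e) tvec" where "coord c p \<equiv> coord_tvec A c p"
abbreviation D :: "('p, 'e) chart \<Rightarrow> ('p, 'e) chart \<Rightarrow> 'p \<Rightarrow> 'e \<Rightarrow> 'e" where
  "D c c' p \<equiv> frechet_derivative (transition c c') (at (snd c p))"

lemma expansion_set_ex: "\<exists>E :: 'e set. expansion_set E"
  using manifold expansion_set_exists unfolding smooth_manifold_def by blast

lemma atlas:
  assumes "c \<in> A"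
  shows "openin X (fst c)" "open (img c)"
    "homeomorphic_map (subtopology X (fst c)) (top_of_set (img c)) (snd c)"
  using manifold assms unfolding smooth_manifold_def smooth_atlas_def by blast+

lemma topspace_chart: "c \<in> A \<Longrightarrow> topspace (subtopology X (fst c)) = fst c"
  using openin_subset[OF atlas(1)] by (simp add: inf.absorb2)

lemma inj_chart: "c \<in> A \<Longrightarrow> inj_on (snd c) (fst c)"
  using homeomorphic_imp_injective_map[OF atlas(3)] topspace_chart by metis

lemma chart_inv_snd [simp]: "c \<in> A \<Longrightarrow> p \<in> fst c \<Longrightarrow> chart_inv c (snd c p) = p"
  by (simp add: chart_inv_def inj_chart)

lemma open_chart_image:
  assumes "c \<in> A" "openin X S" "S \<subseteq> fst c"
  shows "open (snd c ` S)"
proof -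
  have "openin (subtopology X (fst c)) S"
    using assms(2,3) by (metis inf.absorb1 openin_subtopology)
  then have "openin (top_of_set (img c)) (snd c ` S)"
    using homeomorphic_imp_open_map[OF atlas(3)[OF assms(1)]] unfolding open_map_def by blast
  then show ?thesis using atlas(2)[OF assms(1)] openin_open_trans by blast
qed

lemma open_overlap: "c \<in> A \<Longrightarrow> c' \<in> A \<Longrightarrow> open (snd c ` (fst c \<inter> fst c'))"
  by (intro open_chart_image) (auto intro: atlas)

lemma transition_snd: "c \<in> A \<Longrightarrow> p \<in> fst c \<Longrightarrow> transition c c' (snd c p) = snd c' p"
  by (simp add: transition_def)

lemma smooth_transition: "c \<in> A \<Longrightarrow> c' \<in> A \<Longrightarrow> smooth_on (snd c ` (fst c \<inter> fst c')) (transition c c')"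
  using manifold unfolding smooth_manifold_def smooth_atlas_def by blast

lemma smooth_map_transition:
  assumes "expansion_set E" "c \<in> A" "c' \<in> A"
  shows "smooth_map E (snd c ` (fst c \<inter> fst c')) (snd c' ` (fst c \<inter> fst c')) (transition c c')"
  using assms open_overlap smooth_transition by unfold_locales (auto simp: transition_snd)

lemma transition_differentiable:
  "c \<in> A \<Longrightarrow> c' \<in> A \<Longrightarrow> p \<in> fst c \<Longrightarrow> p \<in> fst c' \<Longrightarrow> transition c c' differentiable (at (snd c p))"
  by (rule smooth_on_differentiable[OF smooth_transition]) auto

lemma D_linear: "c \<in> A \<Longrightarrow> c' \<in> A \<Longrightarrow> p \<in> fst c \<Longrightarrow> p \<in> fst c' \<Longrightarrow> linear (D c c' p)"
  by (simp add: linear_frechet_derivative transition_differentiable)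

lemma D_comp:
  assumes "c \<in> A" "c' \<in> A" "c'' \<in> A" "p \<in> fst c" "p \<in> fst c'" "p \<in> fst c''"
  shows "D c c'' p e = D c' c'' p (D c c' p e)"
proof -
  let ?W = "snd c ` (fst c \<inter> fst c' \<inter> fst c'')"
  have W: "open ?W" using assms by (intro open_chart_image openin_Int atlas) auto
  have "D c c'' p e = dir_deriv (\<lambda>u. transition c' c'' (transition c c' u)) (snd c p) e"
    by (rule fun_cong[OF frechet_derivative_cong_open[OF W]])
      (use assms in \<open>auto simp: transition_snd\<close>)
  also have "\<dots> = D c' c'' p (D c c' p e)"
    using dir_deriv_chain[of "transition c c'" "snd c p" "transition c' c''" e]
      transition_differentiable[of c c' p] transition_differentiable[of c' c'' p] assms
    by (simp add: transition_snd)
  finally show ?thesis .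
qed

lemma D_id:
  assumes "c \<in> A" "p \<in> fst c"
  shows "D c c p e = e"
proof -
  have "D c c p = frechet_derivative (\<lambda>u. u) (at (snd c p))"
    by (rule frechet_derivative_cong_open[OF atlas(2)[OF assms(1)]]) (use assms in \<open>auto simp: transition_snd\<close>)
  then show ?thesis by simp
qed

lemma coord_at: "c \<in> A \<Longrightarrow> p \<in> fst c \<Longrightarrow> coord c p e c = e"
  by (simp add: coord_tvec_def D_id)

lemma tangentI:
  assumes "\<And>c. \<not> (c \<in> A \<and> p \<in> fst c) \<Longrightarrow> v c = 0"
    "\<And>c c'. c \<in> A \<Longrightarrow> c' \<in> A \<Longrightarrow> p \<in> fst c \<Longrightarrow> p \<in> fst c' \<Longrightarrow> v c' = D c c' p (v c)"
  shows "v \<in> T p"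
  using assms unfolding tangent_space_def by blast

lemma tangent_outside: "v \<in> T p \<Longrightarrow> \<not> (c \<in> A \<and> p \<in> fst c) \<Longrightarrow> v c = 0"
  unfolding tangent_space_def by blast

lemma tangentD:
  assumes "v \<in> T p" "c \<in> A" "c' \<in> A" "p \<in> fst c" "p \<in> fst c'"
  shows "v c' = D c c' p (v c)"
  using assms unfolding tangent_space_def by blast

lemma coord_in_T:
  assumes "c \<in> A" "p \<in> fst c"
  shows "coord c p e \<in> T p"
proof -
  have *: "coord c p e c'' = D c' c'' p (coord c p e c')" if "c' \<in> A" "c'' \<in> A" "p \<in> fst c'" "p \<in> fst c''" for c' c''
    using D_comp[OF assms(1) that(1,2) assms(2) that(3,4)] that by (simp add: coord_tvec_def)
  show ?thesis
  proof (rule tangentI)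
    fix c' assume "\<not> (c' \<in> A \<and> p \<in> fst c')"
    then show "coord c p e c' = 0" by (simp only: coord_tvec_def if_False)
  qed (rule *)
qed

lemma set_map_coord: "c \<in> A \<Longrightarrow> p \<in> fst c \<Longrightarrow> set (map (coord c p) es) \<subseteq> T p"
  by (auto simp: coord_in_T)

lemma coord_tangent:
  assumes "c \<in> A" "p \<in> fst c" "v \<in> T p"
  shows "coord c p (v c) = v"
proof
  fix c' show "coord c p (v c) c' = v c'"
  proof (cases "c' \<in> A \<and> p \<in> fst c'")
    case True
    then show ?thesis using tangentD[OF assms(3,1)] assms(2) by (simp add: coord_tvec_def)
  next
    case False
    then show ?thesis by (simp only: coord_tvec_def if_False tangent_outside[OF assms(3) False])
  qed
qed

lemma map_coord_tangent:
  assumes "c \<in> A" "p \<in> fst c" "set vs \<subseteq> T p"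
  shows "map (coord c p) (map (\<lambda>v. v c) vs) = vs"
  using assms(3) coord_tangent[OF assms(1,2)] by (induction vs) auto

lemma map_coord_at: "c \<in> A \<Longrightarrow> p \<in> fst c \<Longrightarrow> map (\<lambda>v. v c) (map (coord c p) es) = es"
  by (induction es) (auto simp: coord_at)

lemma coord_change:
  assumes "c \<in> A" "c' \<in> A" "p \<in> fst c" "p \<in> fst c'"
  shows "coord c' p (D c c' p e) = coord c p e"
proof -
  have "D c c' p e = coord c p e c'" using assms by (simp add: coord_tvec_def)
  then show ?thesis using coord_tangent[OF assms(2,4) coord_in_T[OF assms(1,3)]] by simp
qed

lemma map_coord_change:
  "c \<in> A \<Longrightarrow> c' \<in> A \<Longrightarrow> p \<in> fst c \<Longrightarrow> p \<in> fst c' \<Longrightarrow> map (coord c' p) (map (D c c' p) es) = map (coord c p) es"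
  by (simp add: coord_change)

lemma coord_combination:
  assumes "c \<in> A" "p \<in> fst c"
  shows "coord c p (a *\<^sub>R x + b *\<^sub>R y) = a *\<^sub>R coord c p x + b *\<^sub>R coord c p y"
proof
  fix c'
  show "coord c p (a *\<^sub>R x + b *\<^sub>R y) c' = (a *\<^sub>R coord c p x + b *\<^sub>R coord c p y) c'"
  proof (cases "c' \<in> A \<and> p \<in> fst c'")
    case True
    then have l: "linear (D c c' p)" using D_linear assms by blast
    show ?thesis using True by (simp add: coord_tvec_def scaleR_fun_def linear_add[OF l] linear_scale[OF l])
  next
    case False
    then show ?thesis
      by (simp only: coord_tvec_def scaleR_fun_def plus_fun_apply if_False scale_zero_right add_0)
  qed
qed

lemma subspace_T: "subspace (T p)"
proof -
  have "v + w \<in> T p" if "v \<in> T p" "w \<in> T p" for v w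
  proof (rule tangentI)
    fix c c' assume c: "c \<in> A" "c' \<in> A" "p \<in> fst c" "p \<in> fst c'"
    show "(v + w) c' = D c c' p ((v + w) c)"
      by (simp only: plus_fun_apply tangentD[OF that(1) c] tangentD[OF that(2) c] linear_add[OF D_linear[OF c]])
  next
    fix c assume c: "\<not> (c \<in> A \<and> p \<in> fst c)"
    show "(v + w) c = 0"
      by (simp only: plus_fun_apply tangent_outside[OF that(1) c] tangent_outside[OF that(2) c] add_0)
  qed
  moreover have "r *\<^sub>R v \<in> T p" if "v \<in> T p" for r v
  proof (rule tangentI)
    fix c c' assume c: "c \<in> A" "c' \<in> A" "p \<in> fst c" "p \<in> fst c'"
    show "(r *\<^sub>R v) c' = D c c' p ((r *\<^sub>R v) c)"
      by (simp only: scaleR_fun_def tangentD[OF that c] linear_scale[OF D_linear[OF c]])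
  next
    fix c assume c: "\<not> (c \<in> A \<and> p \<in> fst c)"
    show "(r *\<^sub>R v) c = 0" by (simp only: scaleR_fun_def tangent_outside[OF that c] scale_zero_right)
  qed
  moreover have "0 \<in> T p"
    by (rule tangentI) (simp_all only: zero_fun_apply linear_0[OF D_linear])
  ultimately show ?thesis unfolding subspace_def by blast
qed

lemma pullback_coord_alternating:
  assumes "c \<in> A" "p \<in> fst c" "\<beta> \<in> alt_forms n (T p)"
  shows "(\<lambda>es. \<beta> (map (coord c p) es)) \<in> alt_forms n UNIV"
proof -
  have alt: "alternating_on (T p) \<beta>" using assms(3) by (simp add: alt_forms_iff)
  have "alternating_on UNIV (\<lambda>es. \<beta> (map (coord c p) es))"
    unfolding alternating_on_def multilinear_on_def
  proof (intro conjI allI impI)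
    fix us ws :: "'e list" and x y and a b :: real
    show "\<beta> (map (coord c p) (us @ (a *\<^sub>R x + b *\<^sub>R y) # ws)) =
       a *\<^sub>R \<beta> (map (coord c p) (us @ x # ws)) + b *\<^sub>R \<beta> (map (coord c p) (us @ y # ws))"
      using alternating_onD(1)[OF alt set_map_coord set_map_coord coord_in_T coord_in_T] assms(1,2)
      by (simp add: coord_combination)
  next
    fix vs :: "'e list" assume "\<not> distinct vs"
    then show "\<beta> (map (coord c p) vs) = 0"
      using alternating_onD(2)[OF alt] by (simp add: distinct_map)
  qed
  then show ?thesis using alt_forms_outside[OF assms(3)] by (auto simp: alt_forms_iff)
qed

text \<open>The inverse construction: an alternating form on the model space, transported to \<open>T\<^sub>pM\<close>.\<close>

definition transport :: "('p, 'e) chart \<Rightarrow> 'p \<Rightarrow> ('e list \<Rightarrow> real) \<Rightarrow> ('p, 'e) tvec list \<Rightarrow> real" where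
  "transport c p G = (\<lambda>vs. if set vs \<subseteq> T p then G (map (\<lambda>v. v c) vs) else 0)"

lemma transport_alt_forms:
  assumes "G \<in> alt_forms n UNIV"
  shows "transport c p G \<in> alt_forms n (T p)"
proof -
  have alt: "alternating_on UNIV G" using assms by (simp add: alt_forms_iff)
  have "alternating_on (T p) (transport c p G)"
    unfolding alternating_on_def multilinear_on_def
  proof (intro conjI allI impI)
    fix us ws x y and a b :: real
    assume V: "set us \<subseteq> T p" "set ws \<subseteq> T p" "x \<in> T p" "y \<in> T p"
    then have "a *\<^sub>R x + b *\<^sub>R y \<in> T p"
      by (intro subspace_add[OF subspace_T] subspace_scale[OF subspace_T])
    then show "transport c p G (us @ (a *\<^sub>R x + b *\<^sub>R y) # ws) =
       a *\<^sub>R transport c p G (us @ x # ws) + b *\<^sub>R transport c p G (us @ y # ws)"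
      using V alternating_onD(1)[OF alt, of "map (\<lambda>v. v c) us" "map (\<lambda>v. v c) ws" "x c" "y c" a b]
      by (simp add: transport_def scaleR_fun_def)
  next
    fix vs :: "('p, 'e) tvec list" assume "\<not> distinct vs"
    then have "\<not> distinct (map (\<lambda>v. v c) vs)" by (simp add: distinct_map)
    then show "transport c p G vs = 0"
      using alternating_onD(2)[OF alt] by (simp add: transport_def)
  qed
  then show ?thesis using alt_forms_outside[OF assms] by (auto simp: alt_forms_iff transport_def)
qed

lemma transport_coord: "c \<in> A \<Longrightarrow> p \<in> fst c \<Longrightarrow> transport c p G (map (coord c p) es) = G es"
  by (simp only: transport_def map_coord_at set_map_coord if_True)

lemma transport_pullback_coord:
  assumes "c \<in> A" "p \<in> fst c" "\<beta> \<in> alt_forms n (T p)"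
  shows "transport c p (\<lambda>es. \<beta> (map (coord c p) es)) = \<beta>"
proof
  fix vs show "transport c p (\<lambda>es. \<beta> (map (coord c p) es)) vs = \<beta> vs"
  proof (cases "set vs \<subseteq> T p")
    case True
    then show ?thesis unfolding transport_def map_coord_tangent[OF assms(1,2) True] by simp
  next
    case False
    then show ?thesis using alt_forms_outside[OF assms(3), of vs] by (simp add: transport_def)
  qed
qed


section \<open>The exterior derivative on a manifold\<close>

lemma pointsI: "c \<in> A \<Longrightarrow> p \<in> fst c \<Longrightarrow> p \<in> points A"
  by (auto simp: points_def)

lemma chart_at: "p \<in> points A \<Longrightarrow> chart_at A p \<in> A \<and> p \<in> fst (chart_at A p)"
  unfolding chart_at_def points_def by (rule someI_ex) auto

lemma diff_formsD:
  assumes "\<alpha> \<in> diff_forms A n"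
  shows "p \<notin> points A \<Longrightarrow> \<alpha> p = 0" "p \<in> points A \<Longrightarrow> \<alpha> p \<in> alt_forms n (T p)"
    "c \<in> A \<Longrightarrow> smooth_on (img c) (\<lambda>u. local_form A c \<alpha> u es)"
  using assms by (simp_all add: diff_forms_def)

text \<open>Forms that vanish where their values are meaningless are determined by their local forms.\<close>

definition tangential :: "('p, 'e) form \<Rightarrow> bool" where
  "tangential \<alpha> \<longleftrightarrow> (\<forall>p vs. \<not> (p \<in> points A \<and> set vs \<subseteq> T p) \<longrightarrow> \<alpha> p vs = 0)"

lemma diff_forms_tangential: "\<alpha> \<in> diff_forms A n \<Longrightarrow> tangential \<alpha>"
  unfolding tangential_def
proof (intro allI impI)
  fix p vs assume \<alpha>: "\<alpha> \<in> diff_forms A n" and "\<not> (p \<in> points A \<and> set vs \<subseteq> T p)"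
  then show "\<alpha> p vs = 0"
    using diff_formsD(1)[OF \<alpha>, of p] alt_forms_outside[OF diff_formsD(2)[OF \<alpha>], of p vs]
    by (cases "p \<in> points A") auto
qed

lemma tangential_add: "tangential \<alpha> \<Longrightarrow> tangential \<beta> \<Longrightarrow> tangential (\<alpha> + \<beta>)"
  and tangential_diff: "tangential \<alpha> \<Longrightarrow> tangential \<beta> \<Longrightarrow> tangential (\<alpha> - \<beta>)"
  and tangential_scale: "tangential \<alpha> \<Longrightarrow> tangential (r *\<^sub>R \<alpha>)"
  and tangential_zero: "tangential 0"
  by (auto simp: tangential_def scaleR_fun_def)

lemma local_form_snd:
  "c \<in> A \<Longrightarrow> p \<in> fst c \<Longrightarrow> local_form A c \<alpha> (snd c p) es = \<alpha> p (map (coord c p) es)"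
  by (simp add: local_form_def)

lemma local_form_add: "local_form A c (\<alpha> + \<beta>) u es = local_form A c \<alpha> u es + local_form A c \<beta> u es"
  and local_form_diff: "local_form A c (\<alpha> - \<beta>) u es = local_form A c \<alpha> u es - local_form A c \<beta> u es"
  and local_form_scale: "local_form A c (r *\<^sub>R \<alpha>) u es = r * local_form A c \<alpha> u es"
  by (simp_all add: local_form_def scaleR_fun_def)

lemma form_eqI:
  assumes "tangential \<alpha>" "tangential \<beta>"
    "\<And>c p es. c \<in> A \<Longrightarrow> p \<in> fst c \<Longrightarrow> local_form A c \<alpha> (snd c p) es = local_form A c \<beta> (snd c p) es"
  shows "\<alpha> = \<beta>"
proof (intro ext)
  fix p vs show "\<alpha> p vs = \<beta> p vs"
  proof (cases "p \<in> points A \<and> set vs \<subseteq> T p")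
    case True
    then obtain c where c: "c \<in> A" "p \<in> fst c" using chart_at by blast
    then show ?thesis
      using assms(3)[OF c, of "map (\<lambda>v. v c) vs"] True
      unfolding local_form_snd[OF c] using map_coord_tangent[OF c] by metis
  next
    case False
    then show ?thesis using assms(1,2) by (auto simp: tangential_def)
  qed
qed

lemma local_form_alt_forms:
  assumes "\<alpha> \<in> diff_forms A n" "c \<in> A" "u \<in> img c"
  shows "local_form A c \<alpha> u \<in> alt_forms n UNIV"
proof -
  obtain p where p: "p \<in> fst c" "u = snd c p" using assms(3) by blast
  have "local_form A c \<alpha> u = (\<lambda>es. \<alpha> p (map (coord c p) es))"
    using local_form_snd[OF assms(2) p(1)] p(2) by blast
  then show ?thesis
    using pullback_coord_alternating[OF assms(2) p(1) diff_formsD(2)[OF assms(1) pointsI[OF assms(2) p(1)]]]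
    by simp
qed

lemma local_form_lforms: "\<alpha> \<in> diff_forms A n \<Longrightarrow> c \<in> A \<Longrightarrow> local_form A c \<alpha> \<in> lforms (img c)"
  using local_form_alt_forms diff_formsD(3) unfolding lforms_def smooth_coeffs_def alt_forms_iff by blast

lemma local_form_change:
  assumes "c \<in> A" "c' \<in> A" "p \<in> fst c" "p \<in> fst c'"
  shows "local_form A c \<alpha> (snd c p) = pullback (transition c c') (local_form A c' \<alpha>) (snd c p)"
  by (rule ext) (simp only: pullback_def transition_snd[OF assms(1,3)] local_form_snd[OF assms(1,3)]
      local_form_snd[OF assms(2,4)] map_coord_change[OF assms])

lemma lder_change:
  assumes c: "c \<in> A" "c' \<in> A" "p \<in> fst c" "p \<in> fst c'"
    and F: "F \<in> lforms (snd c' ` (fst c \<inter> fst c'))"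
    and G: "\<And>u. u \<in> snd c ` (fst c \<inter> fst c') \<Longrightarrow> G u = pullback (transition c c') F u"
  shows "lder G (snd c p) = pullback (transition c c') (lder F) (snd c p)"
proof
  fix es
  obtain E :: "'e set" where E: "expansion_set E" using expansion_set_ex by blast
  interpret \<phi>: smooth_map E "snd c ` (fst c \<inter> fst c')" "snd c' ` (fst c \<inter> fst c')" "transition c c'"
    by (rule smooth_map_transition[OF E c(1,2)])
  have p: "snd c p \<in> snd c ` (fst c \<inter> fst c')" using c by blast
  have "lder G (snd c p) es = lder (pullback (transition c c') F) (snd c p) es"
    by (rule lder_cong[OF \<phi>.S G p])
  also have "\<dots> = pullback (transition c c') (lder F) (snd c p) es"
    using open_overlap[OF c(2,1)] by (intro \<phi>.lder_pullback[OF F p]) (simp add: Int_commute)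
  finally show "lder G (snd c p) es = pullback (transition c c') (lder F) (snd c p) es" .
qed

text \<open>By naturality, \<open>d\<close> can be computed in any chart.\<close>

lemma ext_deriv_eval:
  assumes \<alpha>: "\<alpha> \<in> diff_forms A n" and c: "c \<in> A" "p \<in> fst c" and vs: "set vs \<subseteq> T p"
  shows "ext_deriv A \<alpha> p vs = lder (local_form A c \<alpha>) (snd c p) (map (\<lambda>v. v c) vs)"
proof -
  let ?c = "chart_at A p"
  have p: "p \<in> points A" by (rule pointsI[OF c])
  have c0: "?c \<in> A" "p \<in> fst ?c" using chart_at[OF p] by auto
  have "ext_deriv A \<alpha> p vs = lder (local_form A ?c \<alpha>) (snd ?c p) (map (\<lambda>v. v ?c) vs)"
    using p vs by (simp add: ext_deriv_def lder_def Let_def)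
  also have "map (\<lambda>v. v ?c) vs = map (D c ?c p) (map (\<lambda>v. v c) vs)"
    using vs c c0 by (auto intro!: tangentD)
  also have "lder (local_form A ?c \<alpha>) (snd ?c p) (map (D c ?c p) (map (\<lambda>v. v c) vs))
      = pullback (transition c ?c) (lder (local_form A ?c \<alpha>)) (snd c p) (map (\<lambda>v. v c) vs)"
    unfolding pullback_def transition_snd[OF c] ..
  also have "\<dots> = lder (local_form A c \<alpha>) (snd c p) (map (\<lambda>v. v c) vs)"
    by (rule fun_cong[OF lder_change[OF c(1) c0(1) c(2) c0(2), symmetric]])
      (use c c0 in \<open>auto intro: lforms_subset[OF local_form_lforms[OF \<alpha> c0(1)]] local_form_change\<close>)
  finally show ?thesis .
qed

lemma local_form_ext_deriv:
  assumes "\<alpha> \<in> diff_forms A n" "c \<in> A" "p \<in> fst c"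
  shows "local_form A c (ext_deriv A \<alpha>) (snd c p) es = lder (local_form A c \<alpha>) (snd c p) es"
  by (simp only: local_form_snd[OF assms(2,3)] ext_deriv_eval[OF assms set_map_coord[OF assms(2,3)]]
      map_coord_at[OF assms(2,3)])

lemma ext_deriv_tangential: "tangential (ext_deriv A \<alpha>)"
  by (auto simp: tangential_def ext_deriv_def)

lemma lder_alt_forms:
  assumes U: "open U" "u \<in> U" and F: "F \<in> lforms U" "\<And>u. u \<in> U \<Longrightarrow> F u \<in> alt_forms n UNIV"
  shows "lder F u \<in> alt_forms (Suc n) UNIV"
proof -
  have "lder F u es = 0" if "length es \<noteq> Suc n" for es
    unfolding lder_def
  proof (intro sum.neutral ballI)
    fix i assume i: "i \<in> {..<length es}"
    have "dir_deriv (\<lambda>u. F u (take i es @ drop (Suc i) es)) u (es ! i) = dir_deriv (\<lambda>u. 0 :: real) u (es ! i)"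
      by (rule fun_cong[OF frechet_derivative_cong_open[OF U]])
        (use i that in \<open>auto intro!: alt_forms_outside[OF F(2)]\<close>)
    then show "(-1) ^ i * dir_deriv (\<lambda>u. F u (take i es @ drop (Suc i) es)) u (es ! i) = 0" by simp
  qed
  then show ?thesis using lformsD(1)[OF lforms_lder[OF U(1) F(1)] U(2)] by (simp add: alt_forms_iff)
qed

lemma diff_formsI_local:
  assumes "tangential \<alpha>"
    and "\<And>c. c \<in> A \<Longrightarrow> \<exists>F. smooth_coeffs (img c) F \<and> (\<forall>u\<in>img c. F u \<in> alt_forms n UNIV) \<and>
      (\<forall>p\<in>fst c. \<forall>es. local_form A c \<alpha> (snd c p) es = F (snd c p) es)"
  shows "\<alpha> \<in> diff_forms A n"
  unfolding diff_forms_def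
proof (intro CollectI conjI allI impI ballI)
  fix p assume "p \<notin> points A"
  then show "\<alpha> p = 0" using assms(1) by (auto simp: tangential_def)
next
  fix p assume p: "p \<in> points A"
  then obtain c where c: "c \<in> A" "p \<in> fst c" using chart_at by blast
  obtain F where "\<forall>u\<in>img c. F u \<in> alt_forms n UNIV" "\<forall>p\<in>fst c. \<forall>es. local_form A c \<alpha> (snd c p) es = F (snd c p) es"
    using assms(2)[OF c(1)] by (elim exE conjE)
  then have F: "F (snd c p) \<in> alt_forms n UNIV" "local_form A c \<alpha> (snd c p) es = F (snd c p) es" for es
    using c(2) by simp_all
  have "\<alpha> p vs = transport c p (F (snd c p)) vs" for vs
  proof (cases "set vs \<subseteq> T p")
    case True
    have "\<alpha> p vs = local_form A c \<alpha> (snd c p) (map (\<lambda>v. v c) vs)"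
      by (simp only: local_form_snd[OF c] map_coord_tangent[OF c True])
    then show ?thesis by (simp only: F(2) transport_def True if_True)
  next
    case False
    then show ?thesis using assms(1) by (simp add: tangential_def transport_def)
  qed
  then have "\<alpha> p = transport c p (F (snd c p))" by (rule ext)
  then show "\<alpha> p \<in> alt_forms n (T p)" by (simp only: transport_alt_forms[OF F(1)])
next
  fix c es assume c: "c \<in> A"
  obtain F where F: "smooth_coeffs (img c) F" "\<forall>p\<in>fst c. \<forall>es. local_form A c \<alpha> (snd c p) es = F (snd c p) es"
    using assms(2)[OF c] by (elim exE conjE)
  have "smooth_on (img c) (\<lambda>u. local_form A c \<alpha> u es) = smooth_on (img c) (\<lambda>u. F u es)"
    using F(2) by (intro smooth_on_cong[OF atlas(2)[OF c]]) auto
  then show "smooth_on (img c) (\<lambda>u. local_form A c \<alpha> u es)" using smooth_coeffsD[OF F(1)] by simp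
qed

lemma ext_deriv_diff_forms:
  assumes \<alpha>: "\<alpha> \<in> diff_forms A n"
  shows "ext_deriv A \<alpha> \<in> diff_forms A (Suc n)"
proof (rule diff_formsI_local[OF ext_deriv_tangential])
  fix c assume c: "c \<in> A"
  show "\<exists>F. smooth_coeffs (img c) F \<and> (\<forall>u\<in>img c. F u \<in> alt_forms (Suc n) UNIV) \<and>
      (\<forall>p\<in>fst c. \<forall>es. local_form A c (ext_deriv A \<alpha>) (snd c p) es = F (snd c p) es)"
  proof (intro exI[of _ "lder (local_form A c \<alpha>)"] conjI ballI allI)
    show "smooth_coeffs (img c) (lder (local_form A c \<alpha>))"
      by (rule smooth_coeffs_lder[OF atlas(2)[OF c] lformsD(2)[OF local_form_lforms[OF \<alpha> c]]])
    show "lder (local_form A c \<alpha>) u \<in> alt_forms (Suc n) UNIV" if "u \<in> img c" for u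
      by (rule lder_alt_forms[OF atlas(2)[OF c] that local_form_lforms[OF \<alpha> c] local_form_alt_forms[OF \<alpha> c]])
  qed (rule local_form_ext_deriv[OF \<alpha> c])
qed

lemma ext_deriv_ext_deriv:
  assumes \<alpha>: "\<alpha> \<in> diff_forms A n"
  shows "ext_deriv A (ext_deriv A \<alpha>) = 0"
proof (rule form_eqI[OF ext_deriv_tangential tangential_zero])
  fix c p es assume c: "c \<in> A" "p \<in> fst c"
  have "local_form A c (ext_deriv A (ext_deriv A \<alpha>)) (snd c p) es = lder (local_form A c (ext_deriv A \<alpha>)) (snd c p) es"
    by (rule local_form_ext_deriv[OF ext_deriv_diff_forms[OF \<alpha>] c])
  also have "\<dots> = lder (lder (local_form A c \<alpha>)) (snd c p) es"
    using c local_form_ext_deriv[OF \<alpha> c(1)] by (intro lder_cong[OF atlas(2)[OF c(1)]]) auto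
  also have "\<dots> = 0"
    using c by (intro lder_lder[OF atlas(2)[OF c(1)] lformsD(2)[OF local_form_lforms[OF \<alpha> c(1)]]]) auto
  finally show "local_form A c (ext_deriv A (ext_deriv A \<alpha>)) (snd c p) es = local_form A c 0 (snd c p) es"
    by (simp add: local_form_def)
qed

lemma diff_forms_combination:
  assumes "\<alpha> \<in> diff_forms A n" "\<beta> \<in> diff_forms A n"
  shows "a *\<^sub>R \<alpha> + b *\<^sub>R \<beta> \<in> diff_forms A n"
proof (rule diff_formsI_local)
  show "tangential (a *\<^sub>R \<alpha> + b *\<^sub>R \<beta>)"
    using assms by (intro tangential_add tangential_scale diff_forms_tangential)
  fix c assume c: "c \<in> A"
  let ?F = "\<lambda>u es. a * local_form A c \<alpha> u es + b * local_form A c \<beta> u es"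
  show "\<exists>F. smooth_coeffs (img c) F \<and> (\<forall>u\<in>img c. F u \<in> alt_forms n UNIV) \<and>
      (\<forall>p\<in>fst c. \<forall>es. local_form A c (a *\<^sub>R \<alpha> + b *\<^sub>R \<beta>) (snd c p) es = F (snd c p) es)"
  proof (intro exI[of _ ?F] conjI ballI allI)
    show "smooth_coeffs (img c) ?F"
      using lforms_combination[OF atlas(2)[OF c] local_form_lforms[OF assms(1) c] local_form_lforms[OF assms(2) c]]
      by (rule lformsD(2))
    show "?F u \<in> alt_forms n UNIV" if "u \<in> img c" for u
      by (rule alt_forms_combination[OF local_form_alt_forms[OF assms(1) c that] local_form_alt_forms[OF assms(2) c that]])
  qed (simp add: local_form_add local_form_scale)
qed

lemma diff_forms_zero: "0 \<in> diff_forms A n"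
proof (rule diff_formsI_local[OF tangential_zero])
  fix c show "\<exists>F. smooth_coeffs (img c) F \<and> (\<forall>u\<in>img c. F u \<in> alt_forms n UNIV) \<and>
      (\<forall>p\<in>fst c. \<forall>es. local_form A c 0 (snd c p) es = F (snd c p) es)"
    by (intro exI[of _ "\<lambda>u es. 0"]) (simp add: smooth_coeffs_def alt_forms_zero local_form_def)
qed

lemma subspace_diff_forms: "subspace (diff_forms A n)"
proof -
  have "\<alpha> + \<beta> \<in> diff_forms A n" "r *\<^sub>R \<alpha> \<in> diff_forms A n"
    if "\<alpha> \<in> diff_forms A n" "\<beta> \<in> diff_forms A n" for \<alpha> \<beta> r
    using diff_forms_combination[OF that, of 1 1] diff_forms_combination[OF that, of r 0] by simp_all
  then show ?thesis using diff_forms_zero unfolding subspace_def by blast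
qed

lemma ext_deriv_combination:
  assumes "\<alpha> \<in> diff_forms A n" "\<beta> \<in> diff_forms A n"
  shows "ext_deriv A (a *\<^sub>R \<alpha> + b *\<^sub>R \<beta>) = a *\<^sub>R ext_deriv A \<alpha> + b *\<^sub>R ext_deriv A \<beta>"
proof (rule form_eqI)
  show "tangential (a *\<^sub>R ext_deriv A \<alpha> + b *\<^sub>R ext_deriv A \<beta>)"
    by (intro tangential_add tangential_scale ext_deriv_tangential)
  fix c p es assume c: "c \<in> A" "p \<in> fst c"
  have "local_form A c (a *\<^sub>R \<alpha> + b *\<^sub>R \<beta>) = (\<lambda>u es. a * local_form A c \<alpha> u es + b * local_form A c \<beta> u es)"
    by (intro ext) (simp add: local_form_add local_form_scale)
  then show "local_form A c (ext_deriv A (a *\<^sub>R \<alpha> + b *\<^sub>R \<beta>)) (snd c p) es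
      = local_form A c (a *\<^sub>R ext_deriv A \<alpha> + b *\<^sub>R ext_deriv A \<beta>) (snd c p) es"
    using lder_combination[OF lformsD(2)[OF local_form_lforms[OF assms(1) c(1)]]
        lformsD(2)[OF local_form_lforms[OF assms(2) c(1)]], of "snd c p" a b es] c
    by (simp add: local_form_add local_form_scale local_form_ext_deriv[OF assms(1)] local_form_ext_deriv[OF assms(2)]
        local_form_ext_deriv[OF diff_forms_combination[OF assms]])
qed (rule ext_deriv_tangential)

lemma ext_deriv_zero: "ext_deriv A 0 = 0"
  using ext_deriv_combination[OF diff_forms_zero diff_forms_zero, of 0 0] by simp

end



section \<open>Multi-vector fields in charts\<close>

context manifold
begin

definition chart_terms :: "('p, 'e) chart \<Rightarrow> 'p \<Rightarrow> (('e \<Rightarrow> real) \<times> 'e list) list \<Rightarrow> (real \<times> ('p, 'e) tvec list) list" where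
  "chart_terms c p L = map (\<lambda>t. (fst t (snd c p), map (coord c p) (snd t))) L"

text \<open>The field \<open>x\<close> on the domain of \<open>c\<close> as a sum of products of smooth functions with coordinate
  multi-vectors.\<close>

definition represents :: "('p, 'e) chart \<Rightarrow> nat \<Rightarrow> (('e \<Rightarrow> real) \<times> 'e list) list \<Rightarrow> ('p, 'e) mvfield \<Rightarrow> bool" where
  "represents c k L x \<longleftrightarrow> smooth_terms (img c) k L \<and> (\<forall>p\<in>fst c. x p = mvec (T p) (chart_terms c p L))"

lemma smooth_terms_snd: "smooth_terms U k L \<Longrightarrow> t \<in> set L \<Longrightarrow> smooth_on U (fst t) \<and> length (snd t) = k"
  unfolding smooth_terms_def by (cases t) auto

lemma mvec_terms_chart_terms:
  assumes "c \<in> A" "p \<in> fst c" "smooth_terms U k L"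
  shows "mvec_terms k (T p) (chart_terms c p L)"
  using smooth_terms_snd[OF assms(3)] set_map_coord[OF assms(1,2)]
  unfolding mvec_terms_def chart_terms_def by auto

lemma lcontract_fst_snd: "lcontract L F u es = (\<Sum>t\<leftarrow>L. fst t u * F u (rev (snd t) @ es))"
  by (simp add: lcontract_def split_def)

lemma lcontract_eq_ext_contract:
  assumes L: "represents c k L x" and c: "c \<in> A" "q \<in> fst c"
    and \<gamma>: "\<gamma> \<in> alt_forms n (T q)" "\<And>es. G (snd c q) es = \<gamma> (map (coord c q) es)"
  shows "lcontract L G (snd c q) es = ext_contract (x q) \<gamma> (map (coord c q) es)"
proof -
  have sm: "smooth_terms (img c) k L" and x: "x q = mvec (T q) (chart_terms c q L)"
    using L c(2) by (auto simp: represents_def)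
  have "ext_contract (x q) \<gamma> (map (coord c q) es) =
      (\<Sum>t\<leftarrow>chart_terms c q L. fst t * \<gamma> (rev (snd t) @ map (coord c q) es))"
    unfolding x by (rule ext_contract_mvec[OF mvec_terms_chart_terms[OF c sm] \<gamma>(1)])
  also have "\<dots> = (\<Sum>t\<leftarrow>L. fst t (snd c q) * \<gamma> (map (coord c q) (rev (snd t) @ es)))"
    by (simp add: chart_terms_def o_def rev_map)
  finally show ?thesis by (simp only: lcontract_fst_snd \<gamma>(2))
qed

lemma represents_ext_power: "represents c k L x \<Longrightarrow> c \<in> A \<Longrightarrow> p \<in> fst c \<Longrightarrow> x p \<in> ext_power k (T p)"
  unfolding represents_def using mvec_in_ext_power[OF mvec_terms_chart_terms] by metis

lemma local_coeff_snd:
  "c \<in> A \<Longrightarrow> p \<in> fst c \<Longrightarrow> local_coeff A c x b (snd c p) = x p (transport c p b)"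
  by (simp add: local_coeff_def transport_def Let_def)

lemma multivector_fieldI:
  assumes "\<And>p. p \<notin> points A \<Longrightarrow> x p = 0" and rep: "\<And>c. c \<in> A \<Longrightarrow> \<exists>L. represents c k L x"
  shows "x \<in> multivector_fields A k"
  unfolding multivector_fields_def
proof (intro CollectI conjI allI impI ballI)
  fix p assume "p \<in> points A"
  then show "x p \<in> ext_power k (T p)" using chart_at[of p] rep represents_ext_power by blast
next
  fix c b assume c: "c \<in> A" and b: "b \<in> alt_forms k (UNIV :: 'e set)"
  obtain L where L: "smooth_terms (img c) k L" "\<forall>p\<in>fst c. x p = mvec (T p) (chart_terms c p L)"
    using rep[OF c] unfolding represents_def by blast
  have "local_coeff A c x b (snd c p) = (\<Sum>t\<leftarrow>L. fst t (snd c p) * b (snd t))" if p: "p \<in> fst c" for p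
  proof -
    have "local_coeff A c x b (snd c p) = mvec (T p) (chart_terms c p L) (transport c p b)"
      using L(2) p by (simp add: local_coeff_snd[OF c p])
    also have "\<dots> = (\<Sum>t\<leftarrow>chart_terms c p L. fst t * transport c p b (snd t))"
      by (rule mvec_eval[OF mvec_terms_chart_terms[OF c p L(1)] transport_alt_forms[OF b]])
    also have "\<dots> = (\<Sum>t\<leftarrow>L. fst t (snd c p) * b (snd t))"
      by (simp add: chart_terms_def o_def transport_coord[OF c p])
    finally show ?thesis .
  qed
  then have "smooth_on (img c) (local_coeff A c x b) = smooth_on (img c) (\<lambda>u. \<Sum>t\<leftarrow>L. fst t u * b (snd t))"
    by (intro smooth_on_cong[OF atlas(2)[OF c]]) auto
  moreover have "smooth_on (img c) (\<lambda>u. \<Sum>t\<leftarrow>L. fst t u * b (snd t))"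
    using smooth_terms_snd[OF L(1)] atlas(2)[OF c] by (intro smooth_on_sum_list smooth_on_mult) auto
  ultimately show "smooth_on (img c) (local_coeff A c x b)" by simp
qed (rule assms(1))

lemma multivector_fieldD:
  assumes "x \<in> multivector_fields A k"
  shows "p \<notin> points A \<Longrightarrow> x p = 0" "p \<in> points A \<Longrightarrow> x p \<in> ext_power k (T p)"
    "c \<in> A \<Longrightarrow> b \<in> alt_forms k UNIV \<Longrightarrow> smooth_on (img c) (local_coeff A c x b)"
  using assms by (simp_all add: multivector_fields_def)

text \<open>Expand the argument of the multi-vector by \<open>alt_forms_finite_expansion\<close>. The coefficients are then the
  values on constant forms, whose smoothness is part of the definition of a multi-vector field.\<close>

lemma multivector_field_represented:
  assumes x: "x \<in> multivector_fields A k" and c: "c \<in> A"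
  shows "\<exists>L. represents c k L x"
proof -
  obtain E :: "'e set" where E: "expansion_set E" using expansion_set_ex by blast
  obtain R where R: "\<forall>(e, I)\<in>set R. e \<in> alt_forms k (UNIV :: 'e set) \<and> length I = k"
    "\<forall>\<beta>\<in>alt_forms k UNIV. \<forall>es. \<beta> es = (\<Sum>t\<leftarrow>R. \<beta> (snd t) * fst t es)"
    using alt_forms_finite_expansion[OF E, of k] by (auto simp: case_prod_beta)
  have Re: "fst t \<in> alt_forms k UNIV" "length (snd t) = k" if "t \<in> set R" for t
    using R(1) that by (cases t; force)+
  define L where "L = map (\<lambda>t. (local_coeff A c x (fst t), snd t)) R"
  have L: "smooth_terms (img c) k L"
    using Re multivector_fieldD(3)[OF x c] by (auto simp: smooth_terms_def L_def)
  have "x p \<beta> = mvec (T p) (chart_terms c p L) \<beta>" if p: "p \<in> fst c" for p \<beta>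
  proof (cases "\<beta> \<in> alt_forms k (T p)")
    case True
    have xp: "x p \<in> ext_power k (T p)" by (rule multivector_fieldD(2)[OF x pointsI[OF c p]])
    define G where "G = (\<lambda>es. \<beta> (map (coord c p) es))"
    have G: "G \<in> alt_forms k UNIV" unfolding G_def by (rule pullback_coord_alternating[OF c p True])
    have "\<beta> vs = (\<Sum>t\<leftarrow>R. G (snd t) * transport c p (fst t) vs)" for vs
    proof -
      have "\<beta> vs = transport c p G vs" unfolding G_def transport_pullback_coord[OF c p True] ..
      also have "\<dots> = transport c p (\<lambda>es. \<Sum>t\<leftarrow>R. G (snd t) * fst t es) vs"
        using R(2) G unfolding transport_def by (intro if_cong refl) blast
      also have "\<dots> = (\<Sum>t\<leftarrow>R. G (snd t) * transport c p (fst t) vs)"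
        by (cases "set vs \<subseteq> T p") (simp_all only: transport_def if_True if_False mult_zero_right sum_list_0)
      finally show ?thesis .
    qed
    then have "x p \<beta> = x p (\<lambda>vs. \<Sum>t\<leftarrow>R. G (snd t) * transport c p (fst t) vs)"
      by (intro arg_cong[where f = "x p"] ext)
    also have "\<dots> = (\<Sum>t\<leftarrow>R. G (snd t) * x p (transport c p (fst t)))"
      by (rule ext_power_sum_list[OF xp transport_alt_forms[OF Re(1)]])
    also have "\<dots> = (\<Sum>t\<leftarrow>chart_terms c p L. fst t * \<beta> (snd t))"
      by (simp add: L_def chart_terms_def o_def local_coeff_snd[OF c p] G_def mult.commute)
    also have "\<dots> = mvec (T p) (chart_terms c p L) \<beta>"
      by (rule mvec_eval[OF mvec_terms_chart_terms[OF c p L] True, symmetric])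
    finally show ?thesis .
  next
    case False
    then show ?thesis
      using ext_power_outside[OF multivector_fieldD(2)[OF x pointsI[OF c p]] False]
        mvec_outside[OF mvec_terms_chart_terms[OF c p L] False] by simp
  qed
  then have "x p = mvec (T p) (chart_terms c p L)" if "p \<in> fst c" for p using that by (intro ext)
  with L show ?thesis unfolding represents_def by blast
qed

lemma contract_tangential:
  assumes "x \<in> multivector_fields A k" "\<alpha> \<in> diff_forms A n"
  shows "tangential (contract x \<alpha>)"
  unfolding tangential_def
proof (intro allI impI)
  fix p vs assume *: "\<not> (p \<in> points A \<and> set vs \<subseteq> T p)"
  show "contract x \<alpha> p vs = 0"
  proof (cases "p \<in> points A")
    case True
    then have "ext_contract (x p) (\<alpha> p) \<in> alt_forms (n - k) (T p)"
      using multivector_fieldD(2)[OF assms(1)] diff_formsD(2)[OF assms(2)] by (intro ext_contract_alt_forms)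
    from alt_forms_outside[OF this, of vs] show ?thesis using * True by (simp add: contract_def)
  next
    case False
    then show ?thesis using multivector_fieldD(1)[OF assms(1)] by (simp add: contract_def ext_contract_def)
  qed
qed

lemma local_form_contract:
  assumes "represents c k L x" "\<alpha> \<in> diff_forms A n" "c \<in> A" "p \<in> fst c"
  shows "local_form A c (contract x \<alpha>) (snd c p) es = lcontract L (local_form A c \<alpha>) (snd c p) es"
  unfolding local_form_snd[OF assms(3,4)] contract_def
  using lcontract_eq_ext_contract[where G = "local_form A c \<alpha>", OF assms(1,3,4)
      diff_formsD(2)[OF assms(2) pointsI[OF assms(3,4)]] local_form_snd[OF assms(3,4)]] by (rule sym)

lemma contract_diff_forms:
  assumes x: "x \<in> multivector_fields A k" and \<alpha>: "\<alpha> \<in> diff_forms A n"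
  shows "contract x \<alpha> \<in> diff_forms A (n - k)"
  unfolding diff_forms_def
proof (intro CollectI conjI allI impI ballI)
  fix p assume "p \<notin> points A"
  then show "contract x \<alpha> p = 0" using contract_tangential[OF assms] by (auto simp: tangential_def)
next
  fix p assume "p \<in> points A"
  then show "contract x \<alpha> p \<in> alt_forms (n - k) (T p)"
    unfolding contract_def
    using multivector_fieldD(2)[OF x] diff_formsD(2)[OF \<alpha>] by (intro ext_contract_alt_forms)
next
  fix c es assume c: "c \<in> A"
  obtain L where L: "represents c k L x" using multivector_field_represented[OF x c] by blast
  then have "lcontract L (local_form A c \<alpha>) \<in> lforms (img c)"
    unfolding represents_def by (intro lforms_lcontract[OF atlas(2)[OF c] local_form_lforms[OF \<alpha> c]]) blast
  then have "smooth_on (img c) (\<lambda>u. lcontract L (local_form A c \<alpha>) u es)"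
    using smooth_coeffsD[OF lformsD(2)] by blast
  moreover have "smooth_on (img c) (\<lambda>u. local_form A c (contract x \<alpha>) u es)
      = smooth_on (img c) (\<lambda>u. lcontract L (local_form A c \<alpha>) u es)"
    using local_form_contract[OF L \<alpha> c] by (intro smooth_on_cong[OF atlas(2)[OF c]]) blast
  ultimately show "smooth_on (img c) (\<lambda>u. local_form A c (contract x \<alpha>) u es)" by simp
qed

lemma contract_combination:
  assumes x: "x \<in> multivector_fields A k" and \<alpha>: "\<alpha> \<in> diff_forms A n" "\<beta> \<in> diff_forms A n"
  shows "contract x (a *\<^sub>R \<alpha> + b *\<^sub>R \<beta>) = a *\<^sub>R contract x \<alpha> + b *\<^sub>R contract x \<beta>"
proof (intro ext)
  fix p vs show "contract x (a *\<^sub>R \<alpha> + b *\<^sub>R \<beta>) p vs = (a *\<^sub>R contract x \<alpha> + b *\<^sub>R contract x \<beta>) p vs"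
  proof (cases "p \<in> points A")
    case True
    have "(a *\<^sub>R \<alpha> + b *\<^sub>R \<beta>) p = (\<lambda>vs. a * \<alpha> p vs + b * \<beta> p vs)"
      by (rule ext) (simp add: scaleR_fun_def)
    then show ?thesis
      using ext_contract_linear[OF multivector_fieldD(2)[OF x True] diff_formsD(2)[OF \<alpha>(1) True]
          diff_formsD(2)[OF \<alpha>(2) True], of a b]
      by (simp add: contract_def scaleR_fun_def)
  next
    case False
    then show ?thesis using multivector_fieldD(1)[OF x False]
      by (simp add: contract_def scaleR_fun_def ext_contract_def)
  qed
qed

lemma contract_zero_form: "x \<in> multivector_fields A k \<Longrightarrow> contract x 0 = 0"
  using contract_combination[OF _ diff_forms_zero diff_forms_zero, of x k 0 0] by simp

lemma contract_scale:
  "x \<in> multivector_fields A k \<Longrightarrow> \<alpha> \<in> diff_forms A n \<Longrightarrow> contract x (a *\<^sub>R \<alpha>) = a *\<^sub>R contract x \<alpha>"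
  using contract_combination[of x k \<alpha> n \<alpha> a 0] by simp

lemma contract_zero_field: "contract 0 \<alpha> = 0"
  by (intro ext) (simp add: contract_def ext_contract_def)

lemma contract_combination_field:
  "contract (a *\<^sub>R x + b *\<^sub>R y) \<alpha> = a *\<^sub>R contract x \<alpha> + b *\<^sub>R contract y \<alpha>"
  by (intro ext) (simp add: contract_def ext_contract_def scaleR_fun_def)

lemma contract_commute:
  assumes x: "x \<in> multivector_fields A k" and y: "y \<in> multivector_fields A l" and \<alpha>: "\<alpha> \<in> diff_forms A n"
  shows "contract x (contract y \<alpha>) = (-1) ^ (k * l) *\<^sub>R contract y (contract x \<alpha>)"
proof (intro ext)
  fix p vs show "contract x (contract y \<alpha>) p vs = ((-1) ^ (k * l) *\<^sub>R contract y (contract x \<alpha>)) p vs"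
  proof (cases "p \<in> points A")
    case True
    then show ?thesis
      using ext_contract_commute[OF subspace_T multivector_fieldD(2)[OF x True] multivector_fieldD(2)[OF y True]
          diff_formsD(2)[OF \<alpha> True]] by (simp add: contract_def scaleR_fun_def)
  next
    case False
    then show ?thesis using multivector_fieldD(1)[OF x False] multivector_fieldD(1)[OF y False]
      by (simp add: contract_def scaleR_fun_def ext_contract_def)
  qed
qed

lemma subspace_multivector_fields: "subspace (multivector_fields A k)"
proof -
  have "x + y \<in> multivector_fields A k" if x: "x \<in> multivector_fields A k" and y: "y \<in> multivector_fields A k" for x y
    unfolding multivector_fields_def
  proof (intro CollectI conjI allI impI ballI)
    fix c b assume c: "c \<in> A" "b \<in> alt_forms k (UNIV :: 'e set)"
    have "smooth_on (img c) (\<lambda>u. local_coeff A c x b u + local_coeff A c y b u)"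
      by (intro smooth_on_add atlas multivector_fieldD(3)[OF x] multivector_fieldD(3)[OF y] c)
    moreover have "local_coeff A c (x + y) b = (\<lambda>u. local_coeff A c x b u + local_coeff A c y b u)"
      by (intro ext) (simp add: local_coeff_def Let_def)
    ultimately show "smooth_on (img c) (local_coeff A c (x + y) b)" by simp
  qed (use multivector_fieldD[OF x] multivector_fieldD[OF y] in
      \<open>simp_all add: subspace_add[OF subspace_ext_power]\<close>)
  moreover have "r *\<^sub>R x \<in> multivector_fields A k" if x: "x \<in> multivector_fields A k" for x r
    unfolding multivector_fields_def
  proof (intro CollectI conjI allI impI ballI)
    fix c b assume c: "c \<in> A" "b \<in> alt_forms k (UNIV :: 'e set)"
    have "smooth_on (img c) (\<lambda>u. r * local_coeff A c x b u)"
      by (intro smooth_on_cmult atlas multivector_fieldD(3)[OF x] c)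
    moreover have "local_coeff A c (r *\<^sub>R x) b = (\<lambda>u. r * local_coeff A c x b u)"
      by (intro ext) (simp add: local_coeff_def Let_def scaleR_fun_def)
    ultimately show "smooth_on (img c) (local_coeff A c (r *\<^sub>R x) b)" by simp
  next
    fix p assume "p \<notin> points A"
    then have "x p = 0" by (rule multivector_fieldD(1)[OF x])
    then show "(r *\<^sub>R x) p = 0" by (simp only: scaleR_fun_def[of r x] scale_zero_right)
  next
    fix p assume "p \<in> points A"
    then show "(r *\<^sub>R x) p \<in> ext_power k (T p)"
      using subspace_scale[OF subspace_ext_power multivector_fieldD(2)[OF x], of p r]
      by (simp only: scaleR_fun_def[of r x])
  qed
  moreover have "0 \<in> multivector_fields A k"
  proof (rule multivector_fieldI)
    fix c
    have "represents c k [] 0"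
      by (auto simp: represents_def chart_terms_def mvec_def)
    then show "\<exists>L. represents c k L 0" ..
  qed simp
  ultimately show ?thesis unfolding subspace_def by blast
qed


section \<open>The Schouten bracket\<close>

text \<open>Local forms in two charts that correspond to each other under the change of coordinates.
  The operators below preserve this relation.\<close>

definition corresponding :: "('p, 'e) chart \<Rightarrow> ('p, 'e) chart \<Rightarrow> nat \<Rightarrow> 'e lform \<Rightarrow> 'e lform \<Rightarrow> bool" where
  "corresponding c c' n F F' \<longleftrightarrow> F \<in> lforms (snd c ` (fst c \<inter> fst c')) \<and>
    (\<forall>u\<in>snd c ` (fst c \<inter> fst c'). F u \<in> alt_forms n UNIV) \<and>
    (\<forall>u\<in>snd c' ` (fst c \<inter> fst c'). F' u = pullback (transition c' c) F u)"

context
  fixes c c' assumes c: "c \<in> A" "c' \<in> A"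
begin

lemma open_overlap': "open (snd c' ` (fst c \<inter> fst c'))"
  using open_overlap[OF c(2,1)] by (simp add: Int_commute)

lemma corresponding_eval:
  assumes "corresponding c c' n F F'" "q \<in> fst c" "q \<in> fst c'"
  shows "F' (snd c' q) es = F (snd c q) (map (D c' c q) es)"
proof -
  have "F' (snd c' q) = pullback (transition c' c) F (snd c' q)"
    using assms by (auto simp: corresponding_def)
  then show ?thesis by (simp only: pullback_def transition_snd[OF c(2) assms(3)])
qed

lemma correspondingI:
  assumes "F \<in> lforms (snd c ` (fst c \<inter> fst c'))"
    "\<And>u. u \<in> snd c ` (fst c \<inter> fst c') \<Longrightarrow> F u \<in> alt_forms n UNIV"
    "\<And>q es. q \<in> fst c \<Longrightarrow> q \<in> fst c' \<Longrightarrow> F' (snd c' q) es = F (snd c q) (map (D c' c q) es)"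
  shows "corresponding c c' n F F'"
proof -
  have "F' u = pullback (transition c' c) F u" if u: "u \<in> snd c' ` (fst c \<inter> fst c')" for u
  proof -
    obtain q where q: "q \<in> fst c" "q \<in> fst c'" "u = snd c' q" using u by blast
    show ?thesis
      by (rule ext) (simp only: q(3) pullback_def transition_snd[OF c(2) q(2)] assms(3)[OF q(1,2)])
  qed
  then show ?thesis using assms(1,2) by (simp add: corresponding_def)
qed

lemma corresponding_lforms:
  assumes "corresponding c c' n F F'"
  shows "F' \<in> lforms (snd c' ` (fst c \<inter> fst c'))"
proof -
  obtain E :: "'e set" where E: "expansion_set E" using expansion_set_ex by blast
  interpret \<phi>: smooth_map E "snd c' ` (fst c' \<inter> fst c)" "snd c ` (fst c' \<inter> fst c)" "transition c' c"
    by (rule smooth_map_transition[OF E c(2,1)])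
  have "pullback (transition c' c) F \<in> lforms (snd c' ` (fst c \<inter> fst c'))"
    using assms \<phi>.lforms_pullback[of F] by (simp add: corresponding_def Int_commute)
  moreover have "F' u = pullback (transition c' c) F u" if "u \<in> snd c' ` (fst c \<inter> fst c')" for u
    using assms that unfolding corresponding_def by blast
  ultimately show ?thesis
    using lforms_cong[OF open_overlap', of F' "pullback (transition c' c) F"] by blast
qed

lemma corresponding_lder:
  assumes F: "corresponding c c' n F F'"
  shows "corresponding c c' (Suc n) (lder F) (lder F')"
proof (rule correspondingI)
  let ?W = "snd c ` (fst c \<inter> fst c')"
  note W = open_overlap[OF c]
  have F1: "F \<in> lforms ?W" "\<And>u. u \<in> ?W \<Longrightarrow> F u \<in> alt_forms n UNIV" using F by (auto simp: corresponding_def)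
  show "lder F \<in> lforms ?W" by (rule lforms_lder[OF W F1(1)])
  show "lder F u \<in> alt_forms (Suc n) UNIV" if "u \<in> ?W" for u by (rule lder_alt_forms[OF W that F1])
  fix q es assume q: "q \<in> fst c" "q \<in> fst c'"
  have "lder F' (snd c' q) = pullback (transition c' c) (lder F) (snd c' q)"
  proof (rule lder_change[OF c(2,1) q(2,1)])
    show "F \<in> lforms (snd c ` (fst c' \<inter> fst c))" using F1(1) by (simp only: Int_commute)
    fix u assume "u \<in> snd c' ` (fst c' \<inter> fst c)"
    then show "F' u = pullback (transition c' c) F u" using F unfolding corresponding_def by blast
  qed
  then show "lder F' (snd c' q) es = lder F (snd c q) (map (D c' c q) es)"
    by (simp only: pullback_def transition_snd[OF c(2) q(2)])
qed

text \<open>On both sides, the value is the contraction of the same form on \<open>T\<^sub>pM\<close> with the same multi-vector.\<close>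

lemma corresponding_lcontract:
  assumes F: "corresponding c c' n F F'" and L: "represents c k L x" "represents c' k L' x"
  shows "corresponding c c' (n - k) (lcontract L F) (lcontract L' F')"
proof (rule correspondingI)
  let ?W = "snd c ` (fst c \<inter> fst c')"
  note W = open_overlap[OF c]
  have F1: "F \<in> lforms ?W" "\<And>u. u \<in> ?W \<Longrightarrow> F u \<in> alt_forms n UNIV" using F by (auto simp: corresponding_def)
  have "smooth_terms (img c) k L" using L(1) unfolding represents_def by (rule conjunct1)
  then have "smooth_terms ?W k L" by (rule smooth_terms_subset) blast
  then show "lcontract L F \<in> lforms ?W" by (rule lforms_lcontract[OF W F1(1)])
  have ev: "lcontract L F (snd c q) es = ext_contract (x q) (transport c q (F (snd c q))) (map (coord c q) es)"
    if q: "q \<in> fst c" "q \<in> fst c'" for q es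
  proof (rule lcontract_eq_ext_contract[OF L(1) c(1) q(1)])
    show "transport c q (F (snd c q)) \<in> alt_forms n (T q)" using q by (intro transport_alt_forms F1(2)) simp
  qed (rule transport_coord[OF c(1) q(1), symmetric])
  show "lcontract L F u \<in> alt_forms (n - k) UNIV" if u: "u \<in> ?W" for u
  proof -
    obtain q where q: "q \<in> fst c" "q \<in> fst c'" "u = snd c q" using u by blast
    have "lcontract L F u = (\<lambda>es. ext_contract (x q) (transport c q (F (snd c q))) (map (coord c q) es))"
      unfolding q(3) by (rule ext) (rule ev[OF q(1,2)])
    moreover have "ext_contract (x q) (transport c q (F (snd c q))) \<in> alt_forms (n - k) (T q)"
      by (rule ext_contract_alt_forms[OF represents_ext_power[OF L(1) c(1) q(1)] transport_alt_forms[OF F1(2)]])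
        (use q in blast)
    ultimately show ?thesis by (simp only: pullback_coord_alternating[OF c(1) q(1)])
  qed
  fix q es assume q: "q \<in> fst c" "q \<in> fst c'"
  have "lcontract L' F' (snd c' q) es = ext_contract (x q) (transport c q (F (snd c q))) (map (coord c' q) es)"
  proof (rule lcontract_eq_ext_contract[OF L(2) c(2) q(2)])
    show "transport c q (F (snd c q)) \<in> alt_forms n (T q)" using q by (intro transport_alt_forms F1(2)) simp
    fix es
    have "F' (snd c' q) es = transport c q (F (snd c q)) (map (coord c q) (map (D c' c q) es))"
      unfolding transport_coord[OF c(1) q(1)] by (rule corresponding_eval[OF F q])
    then show "F' (snd c' q) es = transport c q (F (snd c q)) (map (coord c' q) es)"
      unfolding map_coord_change[OF c(2,1) q(2,1)] .
  qed
  also have "\<dots> = lcontract L F (snd c q) (map (D c' c q) es)"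
    unfolding ev[OF q] map_coord_change[OF c(2,1) q(2,1)] ..
  finally show "lcontract L' F' (snd c' q) es = lcontract L F (snd c q) (map (D c' c q) es)" .
qed

lemma derived_bracket_change:
  assumes F: "corresponding c c' n F F'" and L: "represents c k L x" "represents c' k L' x"
    and M: "represents c l M y" "represents c' l M' y" and p: "p \<in> fst c" "p \<in> fst c'"
  shows "derived_bracket k l (lcontract L') (lcontract M') F' (snd c' p) []
    = derived_bracket k l (lcontract L) (lcontract M) F (snd c p) []"
proof -
  note 1 = corresponding_lder and 2 = corresponding_lcontract
  have e: "H' (snd c' p) [] = H (snd c p) []" if "corresponding c c' n H H'" for H H' n
    using corresponding_eval[OF that p, of "[]"] by simp
  show ?thesis unfolding derived_bracket_def
    by (simp only: e[OF 1[OF 2[OF 2[OF F M] L]]] e[OF 2[OF 1[OF 2[OF F M]] L]]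
        e[OF 2[OF 1[OF 2[OF F L]] M]] e[OF 2[OF 2[OF 1[OF F] L] M]])
qed

text \<open>The multi-vectors at \<open>p\<close> that represent the derived bracket in two charts agree: to compare
  their values on an alternating form on \<open>T\<^sub>pM\<close>, extend the form to a constant form in one chart,
  and to the corresponding form in the other one.\<close>

lemma derived_bracket_field_unique:
  assumes L: "represents c k L x" "represents c' k L' x" and M: "represents c l M y" "represents c' l M' y"
    and N: "smooth_terms (img c) d N" "\<And>W F u es. open W \<Longrightarrow> W \<subseteq> img c \<Longrightarrow> F \<in> lforms W \<Longrightarrow> u \<in> W \<Longrightarrow>
      derived_bracket k l (lcontract L) (lcontract M) F u es = lcontract N F u es"
    and N': "smooth_terms (img c') d N'" "\<And>W F u es. open W \<Longrightarrow> W \<subseteq> img c' \<Longrightarrow> F \<in> lforms W \<Longrightarrow> u \<in> W \<Longrightarrow>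
      derived_bracket k l (lcontract L') (lcontract M') F u es = lcontract N' F u es"
    and p: "p \<in> fst c" "p \<in> fst c'"
  shows "mvec (T p) (chart_terms c p N) = mvec (T p) (chart_terms c' p N')"
proof
  fix \<beta>
  have t: "mvec_terms d (T p) (chart_terms c p N)" "mvec_terms d (T p) (chart_terms c' p N')"
    using mvec_terms_chart_terms[OF c(1) p(1) N(1)] mvec_terms_chart_terms[OF c(2) p(2) N'(1)] by auto
  show "mvec (T p) (chart_terms c p N) \<beta> = mvec (T p) (chart_terms c' p N') \<beta>"
  proof (cases "\<beta> \<in> alt_forms d (T p)")
    case True
    have alt: "alternating_on (T p) \<beta>" using True by (simp add: alt_forms_iff)
    \<comment> \<open>The reversal compensates for the one in the contraction.\<close>
    define \<beta>r where "\<beta>r = (\<lambda>vs. \<beta> (rev vs))"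
    have \<beta>r: "\<beta>r \<in> alt_forms d (T p)"
      using alternating_on_rev_append[OF alt, of "[]"] alt_forms_outside[OF True]
      by (simp add: \<beta>r_def alt_forms_iff)
    define F :: "'e lform" where "F = (\<lambda>u es. \<beta>r (map (coord c p) es))"
    have F1: "F u \<in> alt_forms d UNIV" for u
      unfolding F_def by (rule pullback_coord_alternating[OF c(1) p(1) \<beta>r])
    have F2: "F \<in> lforms W" for W
      using F1 by (auto simp: lforms_def alt_forms_iff smooth_coeffs_def F_def)
    define F' where "F' = pullback (transition c' c) F"
    have F: "corresponding c c' d F F'"
      unfolding corresponding_def F'_def using F1 F2 by simp
    have F'p: "F' (snd c' p) es = \<beta>r (map (coord c' p) es)" for es
      unfolding F'_def pullback_def F_def map_coord_change[OF c(2,1) p(2,1)] ..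
    have "mvec (T p) (chart_terms c p N) \<beta> = lcontract N F (snd c p) []"
      unfolding mvec_eval[OF t(1) True] lcontract_fst_snd F_def \<beta>r_def
      by (simp add: chart_terms_def o_def rev_map)
    also have "\<dots> = derived_bracket k l (lcontract L) (lcontract M) F (snd c p) []"
      by (rule N(2)[OF open_overlap[OF c] _ F2, symmetric]) (use p in auto)
    also have "\<dots> = derived_bracket k l (lcontract L') (lcontract M') F' (snd c' p) []"
      by (rule derived_bracket_change[OF F L M p, symmetric])
    also have "\<dots> = lcontract N' F' (snd c' p) []"
      by (rule N'(2)[OF open_overlap' _ corresponding_lforms[OF F]]) (use p in auto)
    also have "\<dots> = mvec (T p) (chart_terms c' p N') \<beta>"
      unfolding mvec_eval[OF t(2) True] lcontract_fst_snd F'p \<beta>r_def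
      by (simp add: chart_terms_def o_def rev_map)
    finally show ?thesis .
  qed (simp add: mvec_outside[OF t(1)] mvec_outside[OF t(2)])
qed

end

text \<open>The Schouten bracket \<open>[x, y]\<close> up to sign, characterized by the graded commutator of operators
  \<open>\<iota>\<^bsub>[x,y]\<^esub> = [[d, \<iota>\<^sub>x], \<iota>\<^sub>y]\<close>.\<close>

theorem schouten_bracket_exists:
  assumes x: "x \<in> multivector_fields A k" and y: "y \<in> multivector_fields A l" and kl: "1 \<le> k + l"
  shows "\<exists>v\<in>multivector_fields A (k + l - 1). \<forall>n. \<forall>\<alpha>\<in>diff_forms A n.
    contract v \<alpha> = ext_deriv A (contract x (contract y \<alpha>)) - (-1) ^ k *\<^sub>R contract x (ext_deriv A (contract y \<alpha>))
      - (-1) ^ (Suc k * l) *\<^sub>R (contract y (ext_deriv A (contract x \<alpha>)) - (-1) ^ k *\<^sub>R contract y (contract x (ext_deriv A \<alpha>)))"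
proof -
  let ?d = "k + l - 1"
  have "\<exists>L. \<forall>c\<in>A. represents c k (L c) x"
    by (rule bchoice) (rule ballI, rule multivector_field_represented[OF x])
  then obtain L where L': "\<forall>c\<in>A. represents c k (L c) x" ..
  have "\<exists>M. \<forall>c\<in>A. represents c l (M c) y"
    by (rule bchoice) (rule ballI, rule multivector_field_represented[OF y])
  then obtain M where M': "\<forall>c\<in>A. represents c l (M c) y" ..
  note L = L'[rule_format] and M = M'[rule_format]
  have "\<exists>N. \<forall>c\<in>A. smooth_terms (img c) ?d (N c) \<and> (\<forall>W F u es. open W \<longrightarrow> W \<subseteq> img c \<longrightarrow> F \<in> lforms W \<longrightarrow>
      u \<in> W \<longrightarrow> derived_bracket k l (lcontract (L c)) (lcontract (M c)) F u es = lcontract (N c) F u es)"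
  proof (rule bchoice, rule ballI)
    fix c assume c: "c \<in> A"
    have sm: "smooth_terms (img c) k (L c)" "smooth_terms (img c) l (M c)"
      using L[OF c] M[OF c] by (simp_all only: represents_def)
    obtain N where N: "\<forall>(f, K)\<in>set N. smooth_on (img c) f \<and> Suc (length K) = k + l"
      "\<forall>W F u es. open W \<longrightarrow> W \<subseteq> img c \<longrightarrow> F \<in> lforms W \<longrightarrow> u \<in> W \<longrightarrow>
        derived_bracket k l (lcontract (L c)) (lcontract (M c)) F u es = lcontract N F u es"
      using derived_bracket_is_contraction[OF atlas(2)[OF c] sm] unfolding is_contraction_def by (elim exE conjE)
    have "smooth_terms (img c) ?d N"
      unfolding smooth_terms_def
    proof (intro ballI)
      fix t assume "t \<in> set N"
      then show "case t of (f, K) \<Rightarrow> smooth_on (img c) f \<and> length K = ?d" using N(1) by (cases t) auto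
    qed
    then show "\<exists>N. smooth_terms (img c) ?d N \<and> (\<forall>W F u es. open W \<longrightarrow> W \<subseteq> img c \<longrightarrow> F \<in> lforms W \<longrightarrow>
      u \<in> W \<longrightarrow> derived_bracket k l (lcontract (L c)) (lcontract (M c)) F u es = lcontract N F u es)"
      using N(2) by (intro exI[of _ N] conjI)
  qed
  then obtain N where N: "\<forall>c\<in>A. smooth_terms (img c) ?d (N c) \<and> (\<forall>W F u es. open W \<longrightarrow> W \<subseteq> img c \<longrightarrow> F \<in> lforms W \<longrightarrow>
      u \<in> W \<longrightarrow> derived_bracket k l (lcontract (L c)) (lcontract (M c)) F u es = lcontract (N c) F u es)" ..
  note N1 = N[rule_format, THEN conjunct1] and N2 = N[rule_format, THEN conjunct2, rule_format]
  define v :: "('p, 'e) mvfield" where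
    "v = (\<lambda>p. if p \<in> points A then mvec (T p) (chart_terms (chart_at A p) p (N (chart_at A p))) else 0)"
  have v: "represents c ?d (N c) v" if c: "c \<in> A" for c
    unfolding represents_def
  proof (intro conjI ballI N1[OF c])
    fix p assume p: "p \<in> fst c"
    have c0: "chart_at A p \<in> A" "p \<in> fst (chart_at A p)" using chart_at[OF pointsI[OF c p]] by auto
    have "mvec (T p) (chart_terms (chart_at A p) p (N (chart_at A p))) = mvec (T p) (chart_terms c p (N c))"
      by (rule derived_bracket_field_unique[OF c0(1) c L[OF c0(1)] L[OF c] M[OF c0(1)] M[OF c]
            N1[OF c0(1)] N2[OF c0(1)] N1[OF c] N2[OF c] c0(2) p])
    then show "v p = mvec (T p) (chart_terms c p (N c))" using pointsI[OF c p] by (simp add: v_def)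
  qed
  have vf: "v \<in> multivector_fields A ?d"
  proof (rule multivector_fieldI)
    fix c assume "c \<in> A" then show "\<exists>L. represents c ?d L v" using v by blast
  qed (simp add: v_def)
  moreover have "contract v \<alpha> = ext_deriv A (contract x (contract y \<alpha>)) - (-1) ^ k *\<^sub>R contract x (ext_deriv A (contract y \<alpha>))
      - (-1) ^ (Suc k * l) *\<^sub>R (contract y (ext_deriv A (contract x \<alpha>)) - (-1) ^ k *\<^sub>R contract y (contract x (ext_deriv A \<alpha>)))"
    (is "_ = ?r") if \<alpha>: "\<alpha> \<in> diff_forms A n" for \<alpha> n
  proof (rule form_eqI[OF contract_tangential[OF vf \<alpha>]])
    note xf = contract_diff_forms[OF x] and yf = contract_diff_forms[OF y] and df = ext_deriv_diff_forms
    show "tangential ?r"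
      by (intro tangential_diff tangential_scale ext_deriv_tangential
          diff_forms_tangential[OF xf[OF df[OF yf[OF \<alpha>]]]] diff_forms_tangential[OF yf[OF df[OF xf[OF \<alpha>]]]]
          diff_forms_tangential[OF yf[OF xf[OF df[OF \<alpha>]]]])
    fix c p es assume c: "c \<in> A" and p: "p \<in> fst c"
    let ?F = "local_form A c \<alpha>"
    have F: "?F \<in> lforms (img c)" by (rule local_form_lforms[OF \<alpha> c])
    define eq where "eq \<beta> G \<longleftrightarrow> (\<forall>q\<in>fst c. local_form A c \<beta> (snd c q) = G (snd c q))" for \<beta> and G :: "'e lform"
    have eqD: "local_form A c \<beta> (snd c q) = G (snd c q)" if "eq \<beta> G" "q \<in> fst c" for \<beta> G q
      using that unfolding eq_def by blast
    have c\<alpha>: "eq \<alpha> ?F" unfolding eq_def by blast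
    have cx: "eq (contract x \<beta>) (lcontract (L c) G)" if "\<beta> \<in> diff_forms A n" "eq \<beta> G" for \<beta> n G
      unfolding eq_def
    proof (intro ballI ext)
      fix q es assume q: "q \<in> fst c"
      show "local_form A c (contract x \<beta>) (snd c q) es = lcontract (L c) G (snd c q) es"
        unfolding local_form_contract[OF L[OF c] that(1) c q] by (rule lcontract_cong) (rule eqD[OF that(2) q])
    qed
    have cy: "eq (contract y \<beta>) (lcontract (M c) G)" if "\<beta> \<in> diff_forms A n" "eq \<beta> G" for \<beta> n G
      unfolding eq_def
    proof (intro ballI ext)
      fix q es assume q: "q \<in> fst c"
      show "local_form A c (contract y \<beta>) (snd c q) es = lcontract (M c) G (snd c q) es"
        unfolding local_form_contract[OF M[OF c] that(1) c q] by (rule lcontract_cong) (rule eqD[OF that(2) q])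
    qed
    have cd: "eq (ext_deriv A \<beta>) (lder G)" if "\<beta> \<in> diff_forms A n" "eq \<beta> G" for \<beta> n G
      unfolding eq_def
    proof (intro ballI ext)
      fix q es assume q: "q \<in> fst c"
      show "local_form A c (ext_deriv A \<beta>) (snd c q) es = lder G (snd c q) es"
        unfolding local_form_ext_deriv[OF that(1) c q]
        by (rule lder_cong[OF atlas(2)[OF c]]) (use eqD[OF that(2)] q in blast)+
    qed
    note 1 = eqD[OF cd[OF xf[OF yf[OF \<alpha>]] cx[OF yf[OF \<alpha>] cy[OF \<alpha> c\<alpha>]]] p]
      and 2 = eqD[OF cx[OF df[OF yf[OF \<alpha>]] cd[OF yf[OF \<alpha>] cy[OF \<alpha> c\<alpha>]]] p]
      and 3 = eqD[OF cy[OF df[OF xf[OF \<alpha>]] cd[OF xf[OF \<alpha>] cx[OF \<alpha> c\<alpha>]]] p]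
      and 4 = eqD[OF cy[OF xf[OF df[OF \<alpha>]] cx[OF df[OF \<alpha>] cd[OF \<alpha> c\<alpha>]]] p]
    have "local_form A c (contract v \<alpha>) (snd c p) es = lcontract (N c) ?F (snd c p) es"
      by (rule local_form_contract[OF v[OF c] \<alpha> c p])
    also have "\<dots> = derived_bracket k l (lcontract (L c)) (lcontract (M c)) ?F (snd c p) es"
      by (rule N2[OF c atlas(2)[OF c] order_refl F, symmetric]) (use p in auto)
    also have "\<dots> = local_form A c ?r (snd c p) es"
      by (simp only: derived_bracket_def local_form_diff local_form_scale 1 2 3 4)
    finally show "local_form A c (contract v \<alpha>) (snd c p) es = local_form A c ?r (snd c p) es" .
  qed
  ultimately show ?thesis by blast
qed

end



section \<open>Koszul signs\<close>

abbreviation inversions :: "nat \<Rightarrow> (nat \<Rightarrow> nat) \<Rightarrow> (nat \<times> nat) set" where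
  "inversions n \<sigma> \<equiv> {(r, s). r < s \<and> s < n \<and> \<sigma> s < \<sigma> r}"

lemma finite_inversions: "finite (inversions n \<sigma>)"
  by (rule finite_subset[of _ "{..<n} \<times> {..<n}"]) auto

lemma transpose_less:
  assumes "a < b" "(a, b) \<noteq> (r, Suc r)"
  shows "Transposition.transpose r (Suc r) a < Transposition.transpose r (Suc r) b"
  using assms by (auto simp: Transposition.transpose_def)

lemma inversions_transpose:
  assumes "\<sigma> (Suc r) < \<sigma> r" "Suc r < n"
  defines "\<tau> \<equiv> Transposition.transpose r (Suc r)"
  shows "bij_betw (\<lambda>(a, b). (\<tau> a, \<tau> b)) (inversions n \<sigma> - {(r, Suc r)}) (inversions n (\<sigma> \<circ> \<tau>))"
proof -
  have \<tau>: "\<tau> (\<tau> a) = a" for a by (simp add: \<tau>_def)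
  have bound: "\<tau> a < n" if "a < n" for a using that assms(2) by (auto simp: \<tau>_def Transposition.transpose_def)
  have less: "\<tau> a < \<tau> b" if "a < b" "(a, b) \<noteq> (r, Suc r)" for a b
    using transpose_less[OF that] by (simp add: \<tau>_def)
  have \<tau>r: "\<tau> r = Suc r" "\<tau> (Suc r) = r" by (simp_all add: \<tau>_def)
  show ?thesis
  proof (rule bij_betw_byWitness[where f' = "\<lambda>(a, b). (\<tau> a, \<tau> b)"])
    show "(\<lambda>(a, b). (\<tau> a, \<tau> b)) ` (inversions n \<sigma> - {(r, Suc r)}) \<subseteq> inversions n (\<sigma> \<circ> \<tau>)"
      using less bound by (auto simp: \<tau>)
    show "(\<lambda>(a, b). (\<tau> a, \<tau> b)) ` inversions n (\<sigma> \<circ> \<tau>) \<subseteq> inversions n \<sigma> - {(r, Suc r)}"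
    proof
      fix z assume "z \<in> (\<lambda>(a, b). (\<tau> a, \<tau> b)) ` inversions n (\<sigma> \<circ> \<tau>)"
      then obtain a b where z: "z = (\<tau> a, \<tau> b)" and ab: "a < b" "b < n" "\<sigma> (\<tau> b) < \<sigma> (\<tau> a)" by auto
      have 1: "(a, b) \<noteq> (r, Suc r)" using ab(3) assms(1) by (auto simp: \<tau>r)
      have "(\<tau> a, \<tau> b) \<noteq> (r, Suc r)"
      proof
        assume "(\<tau> a, \<tau> b) = (r, Suc r)"
        then have "\<tau> (\<tau> a) = \<tau> r" "\<tau> (\<tau> b) = \<tau> (Suc r)" by simp_all
        then show False using ab(1) by (simp add: \<tau> \<tau>r)
      qed
      then show "z \<in> inversions n \<sigma> - {(r, Suc r)}" using less[OF ab(1) 1] bound ab z by auto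
    qed
  qed (auto simp: \<tau>)
qed

lemma koszul_sign_transpose:
  assumes "\<sigma> (Suc r) < \<sigma> r" "Suc r < length ds"
  shows "koszul_sign ds \<sigma> = (-1) ^ (ds ! \<sigma> r * ds ! \<sigma> (Suc r)) * koszul_sign ds (\<sigma> \<circ> Transposition.transpose r (Suc r))"
proof -
  let ?\<tau> = "Transposition.transpose r (Suc r)" and ?n = "length ds"
  let ?g = "\<lambda>(a, b). (-1::real) ^ (ds ! \<sigma> a * ds ! \<sigma> b)"
  have "koszul_sign ds (\<sigma> \<circ> ?\<tau>) = (\<Prod>(a, b)\<in>inversions ?n (\<sigma> \<circ> ?\<tau>). ?g (?\<tau> a, ?\<tau> b))"
    by (simp add: koszul_sign_def)
  also have "\<dots> = (\<Prod>z\<in>inversions ?n \<sigma> - {(r, Suc r)}. ?g z)"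
    using prod.reindex_bij_betw[OF inversions_transpose[OF assms],
        of "\<lambda>(a, b). ?g (?\<tau> a, ?\<tau> b)"] by (simp add: case_prod_beta)
  finally have "koszul_sign ds (\<sigma> \<circ> ?\<tau>) = (\<Prod>z\<in>inversions ?n \<sigma> - {(r, Suc r)}. ?g z)" .
  moreover have "koszul_sign ds \<sigma> = ?g (r, Suc r) * (\<Prod>z\<in>inversions ?n \<sigma> - {(r, Suc r)}. ?g z)"
    unfolding koszul_sign_def
    by (rule prod.remove[OF finite_inversions]) (use assms in auto)
  ultimately show ?thesis by simp
qed

lemma no_inversions_id:
  assumes "\<sigma> permutes {..<n}" "inversions n \<sigma> = {}"
  shows "\<sigma> = id"
proof -
  have "strict_mono_on {..<n} \<sigma>"
  proof (rule strict_mono_onI)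
    fix r s assume rs: "r \<in> {..<n}" "s \<in> {..<n}" "r < s"
    then have "\<not> \<sigma> s < \<sigma> r" using assms(2) by auto
    moreover have "\<sigma> s \<noteq> \<sigma> r" using permutes_inj[OF assms(1)] rs(3) by (auto dest: injD)
    ultimately show "\<sigma> r < \<sigma> s" by simp
  qed
  then have "sorted_wrt (<) (map \<sigma> [0..<n])"
    by (auto simp: sorted_wrt_iff_nth_less strict_mono_on_def)
  moreover have "set (map \<sigma> [0..<n]) = {..<n}"
    using permutes_image[OF assms(1)] by (simp add: atLeast0LessThan)
  ultimately have "map \<sigma> [0..<n] = [0..<n]"
    by (intro strict_sorted_equal) (auto simp: atLeast0LessThan)
  then have eq: "map \<sigma> [0..<n] ! r = [0..<n] ! r" for r by (rule arg_cong)
  show ?thesis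
  proof
    fix r show "\<sigma> r = id r"
      using eq[of r] permutes_not_in[OF assms(1), of r] by (cases "r < n") simp_all
  qed
qed

lemma adjacent_inversion:
  assumes "inversions n \<sigma> \<noteq> {}"
  shows "\<exists>r. Suc r < n \<and> \<sigma> (Suc r) < \<sigma> r"
proof (rule ccontr)
  assume *: "\<not> ?thesis"
  have le: "\<sigma> r \<le> \<sigma> (Suc r)" if "Suc r < n" for r using * that by (meson not_le_imp_less)
  have mono: "\<sigma> r \<le> \<sigma> s" if "r \<le> s" "s < n" for r s
    using that(1,2)
  proof (induction s rule: dec_induct)
    case (step s)
    then show ?case using le[of s] by simp
  qed simp
  from assms obtain r s where "r < s" "s < n" "\<sigma> s < \<sigma> r" by auto
  with mono[of r s] show False by simp
qed

text \<open>A function of lists that picks up the Koszul sign under the exchange of two neighbours does so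
  under all permutations: undo the inversions of a permutation one at a time.\<close>

lemma koszul_sign_permutation:
  fixes h :: "'v list \<Rightarrow> 'w::real_vector"
  assumes swap: "\<And>\<rho> as bs x y es fs d e. as @ x # y # bs = map (\<lambda>r. xs ! \<rho> r) [0..<length xs] \<Longrightarrow> \<rho> permutes {..<length xs} \<Longrightarrow>
      es @ d # e # fs = map (\<lambda>r. ds ! \<rho> r) [0..<length xs] \<Longrightarrow> length es = length as \<Longrightarrow>
      h (as @ x # y # bs) = (-1) ^ (d * e) *\<^sub>R h (as @ y # x # bs)"
    and len: "length ds = length xs" and \<sigma>: "\<sigma> permutes {..<length xs}"
  shows "h xs = koszul_sign ds \<sigma> *\<^sub>R h (permute_by \<sigma> [0..<length xs] xs)"
  using \<sigma>
proof (induction "card (inversions (length xs) \<sigma>)" arbitrary: \<sigma> rule: less_induct)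
  case less
  let ?n = "length xs"
  show ?case
  proof (cases "inversions ?n \<sigma> = {}")
    case True
    then have "\<sigma> = id" using no_inversions_id less.prems by blast
    moreover have "inversions (length ds) id = {}" by auto
    then have "koszul_sign ds id = 1" unfolding koszul_sign_def by (simp only: prod.empty)
    ultimately show ?thesis by (simp add: permute_by_def map_nth)
  next
    case False
    then obtain r where r: "Suc r < ?n" "\<sigma> (Suc r) < \<sigma> r" using adjacent_inversion by blast
    define \<rho> where "\<rho> = \<sigma> \<circ> Transposition.transpose r (Suc r)"
    have \<rho>: "\<rho> permutes {..<?n}"
      unfolding \<rho>_def using r by (intro permutes_compose[OF permutes_swap_id less.prems]) auto
    have "card (inversions ?n \<rho>) = card (inversions ?n \<sigma> - {(r, Suc r)})"
      unfolding \<rho>_def by (rule bij_betw_same_card[OF inversions_transpose[OF r(2,1)], symmetric])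
    also have "\<dots> < card (inversions ?n \<sigma>)"
      using r by (intro card_Diff1_less finite_inversions) auto
    finally have "h xs = koszul_sign ds \<rho> *\<^sub>R h (permute_by \<rho> [0..<?n] xs)" by (rule less.hyps[OF _ \<rho>])
    moreover have "h (permute_by \<rho> [0..<?n] xs)
       = (-1) ^ (ds ! \<sigma> r * ds ! \<sigma> (Suc r)) *\<^sub>R h (permute_by \<sigma> [0..<?n] xs)"
    proof -
      have up: "[0..<?n] = [0..<r] @ r # Suc r # [Suc (Suc r)..<?n]"
      proof -
        have "[0..<?n] = [0..<r] @ [r..<?n]" using r(1) upt_add_eq_append[of 0 r "?n - r"] by simp
        also have "[r..<?n] = r # Suc r # [Suc (Suc r)..<?n]" using r(1) by (simp add: upt_conv_Cons)
        finally show ?thesis .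
      qed
      have \<rho>r: "\<rho> r = \<sigma> (Suc r)" "\<rho> (Suc r) = \<sigma> r" by (simp_all add: \<rho>_def)
      have \<rho>s: "\<rho> s = \<sigma> s" if "s \<noteq> r" "s \<noteq> Suc r" for s
        using that by (simp add: \<rho>_def Transposition.transpose_def)
      have s\<sigma>: "map (\<lambda>s. xs ! \<sigma> s) [0..<?n] =
          map (\<lambda>s. xs ! \<sigma> s) [0..<r] @ xs ! \<sigma> r # xs ! \<sigma> (Suc r) # map (\<lambda>s. xs ! \<sigma> s) [Suc (Suc r)..<?n]"
        unfolding up by simp
      have s\<rho>: "map (\<lambda>s. xs ! \<rho> s) [0..<?n] =
          map (\<lambda>s. xs ! \<sigma> s) [0..<r] @ xs ! \<sigma> (Suc r) # xs ! \<sigma> r # map (\<lambda>s. xs ! \<sigma> s) [Suc (Suc r)..<?n]"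
        unfolding up by (simp add: \<rho>r \<rho>s)
      have s\<rho>d: "map (\<lambda>s. ds ! \<rho> s) [0..<?n] =
          map (\<lambda>s. ds ! \<sigma> s) [0..<r] @ ds ! \<sigma> (Suc r) # ds ! \<sigma> r # map (\<lambda>s. ds ! \<sigma> s) [Suc (Suc r)..<?n]"
        unfolding up by (simp add: \<rho>r \<rho>s)
      show ?thesis
        unfolding permute_by_def s\<rho> s\<sigma>
        using swap[OF s\<rho>[symmetric] \<rho> s\<rho>d[symmetric]] by (simp add: mult.commute)
    qed
    moreover have "koszul_sign ds \<sigma> = (-1) ^ (ds ! \<sigma> r * ds ! \<sigma> (Suc r)) * koszul_sign ds \<rho>"
      unfolding \<rho>_def using koszul_sign_transpose[OF r(2)] r(1) len by simp
    ultimately show ?thesis by (simp add: mult.commute)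
  qed
qed


section \<open>Shuffles of two elements with the others\<close>

lemma nths_conv_filter: "nths xs S = map ((!) xs) (filter (\<lambda>i. i \<in> S) [0..<length xs])"
proof -
  have "zip xs [0..<length xs] = map (\<lambda>i. (xs ! i, i)) [0..<length xs]"
    by (intro nth_equalityI) auto
  then show ?thesis by (simp add: nths_def filter_map o_def)
qed

lemma shuffles_perm_2D:
  assumes "\<sigma> \<in> shuffles_perm 2 (n - 2)" "2 \<le> n"
  shows "\<sigma> permutes {..<n}" "\<sigma> 0 < \<sigma> 1" "\<sigma> 1 < n"
    "map \<sigma> [2..<n] = filter (\<lambda>t. t \<noteq> \<sigma> 0 \<and> t \<noteq> \<sigma> 1) [0..<n]"
    "\<And>r s. 2 \<le> r \<Longrightarrow> r < s \<Longrightarrow> s < n \<Longrightarrow> \<sigma> r < \<sigma> s"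
proof -
  have n: "2 + (n - 2) = n" using assms(2) by simp
  from assms(1) have p: "\<sigma> permutes {..<n}" and m: "strict_mono_on {..<2} \<sigma>" "strict_mono_on {2..<n} \<sigma>"
    unfolding shuffles_perm_def n by auto
  show "\<sigma> permutes {..<n}" by (rule p)
  show "\<sigma> 0 < \<sigma> 1" using m(1) by (auto simp: strict_mono_on_def)
  show "\<sigma> 1 < n" using permutes_in_image[OF p, of 1] assms(2) by simp
  show mono: "\<sigma> r < \<sigma> s" if "2 \<le> r" "r < s" "s < n" for r s
    using m(2) that by (auto simp: strict_mono_on_def)
  show "map \<sigma> [2..<n] = filter (\<lambda>t. t \<noteq> \<sigma> 0 \<and> t \<noteq> \<sigma> 1) [0..<n]"
  proof (rule strict_sorted_equal)
    show "sorted_wrt (<) (map \<sigma> [2..<n])"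
      using mono by (auto simp: sorted_wrt_iff_nth_less)
    show "sorted_wrt (<) (filter (\<lambda>t. t \<noteq> \<sigma> 0 \<and> t \<noteq> \<sigma> 1) [0..<n])"
      by (intro sorted_wrt_filter) simp
    have "{2..<n} = {..<n} - {0, 1}" by auto
    then have "\<sigma> ` {2..<n} = \<sigma> ` {..<n} - \<sigma> ` {0, 1}"
      using permutes_inj[OF p] by (simp add: image_set_diff)
    also have "\<dots> = {..<n} - {\<sigma> 0, \<sigma> 1}" using permutes_image[OF p] by simp
    finally show "set (map \<sigma> [2..<n]) = set (filter (\<lambda>t. t \<noteq> \<sigma> 0 \<and> t \<noteq> \<sigma> 1) [0..<n])" by auto
  qed
qed

lemma permute_by_shuffle_rest:
  assumes "\<sigma> \<in> shuffles_perm 2 (n - 2)" "2 \<le> n" "length xs = n"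
  shows "permute_by \<sigma> [2..<n] xs = nths xs (- {\<sigma> 0, \<sigma> 1})"
proof -
  have "permute_by \<sigma> [2..<n] xs = map ((!) xs) (map \<sigma> [2..<n])" by (simp add: permute_by_def)
  then show ?thesis unfolding shuffles_perm_2D(4)[OF assms(1,2)] nths_conv_filter using assms(3) by simp
qed

text \<open>A shuffle of type \<open>(2, n - 2)\<close> is determined by its first two values, since the others follow in
  increasing order.\<close>

lemma sum_shuffles_perm_2:
  assumes n: "2 \<le> n"
  shows "(\<Sum>\<sigma>\<in>shuffles_perm 2 (n - 2). f (\<sigma> 0) (\<sigma> 1)) = (\<Sum>j<n. \<Sum>i<j. f i j :: 'a::comm_monoid_add)"
proof -
  define l where "l i j = i # j # filter (\<lambda>t. t \<noteq> i \<and> t \<noteq> j) [0..<n]" for i j :: nat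
  define s where "s i j = (\<lambda>r. if r < n then l i j ! r else r)" for i j :: nat
  have l: "distinct (l i j)" "set (l i j) = {..<n}" "length (l i j) = n" if "i < j" "j < n" for i j
  proof -
    show d: "distinct (l i j)" using that by (simp add: l_def)
    show s: "set (l i j) = {..<n}" using that by (auto simp: l_def)
    show "length (l i j) = n" using distinct_card[OF d] s by simp
  qed
  have perm: "s i j permutes {..<n}" if "i < j" "j < n" for i j
  proof (rule bij_imp_permutes)
    have "bij_betw ((!) (l i j)) {..<n} {..<n}"
      by (rule bij_betw_nth[OF l(1)[OF that]]) (simp_all only: l(2,3)[OF that])
    moreover have "bij_betw (s i j) {..<n} {..<n} = bij_betw ((!) (l i j)) {..<n} {..<n}"
      by (rule bij_betw_cong) (simp add: s_def)
    ultimately show "bij_betw (s i j) {..<n} {..<n}" by (simp only:)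
  qed (simp add: s_def)
  have s01: "s i j 0 = i" "s i j 1 = j" for i j using n by (simp_all add: s_def l_def)
  have sh: "s i j \<in> shuffles_perm 2 (n - 2)" if "i < j" "j < n" for i j
  proof -
    have "strict_mono_on {..<2} (s i j)"
    proof (rule strict_mono_onI)
      fix a b :: nat assume "a \<in> {..<2}" "b \<in> {..<2}" "a < b"
      then have "a = 0" "b = 1" by auto
      then show "s i j a < s i j b" using that(1) by (simp only: s01)
    qed
    moreover have "strict_mono_on {2..<n} (s i j)"
    proof (rule strict_mono_onI)
      fix a b assume ab: "a \<in> {2..<n}" "b \<in> {2..<n}" "a < b"
      have "sorted_wrt (<) (filter (\<lambda>t. t \<noteq> i \<and> t \<noteq> j) [0..<n])" (is "sorted_wrt _ ?f")
        by (intro sorted_wrt_filter) simp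
      moreover have "length ?f = n - 2" using l(3)[OF that] by (simp add: l_def)
      ultimately have "?f ! (a - 2) < ?f ! (b - 2)"
        using ab by (intro sorted_wrt_nth_less[of "(<)"]) auto
      then show "s i j a < s i j b" using ab by (auto simp: s_def l_def nth_Cons' numeral_2_eq_2)
    qed
    moreover have "2 + (n - 2) = n" using n by simp
    ultimately show ?thesis using perm[OF that] by (simp only: shuffles_perm_def mem_Collect_eq)
  qed
  have inv: "s (\<sigma> 0) (\<sigma> 1) = \<sigma>" if \<sigma>: "\<sigma> \<in> shuffles_perm 2 (n - 2)" for \<sigma>
  proof
    fix r
    note D = shuffles_perm_2D[OF \<sigma> n]
    show "s (\<sigma> 0) (\<sigma> 1) r = \<sigma> r"
    proof (cases "r < n")
      case True
      have "l (\<sigma> 0) (\<sigma> 1) = map \<sigma> [0..<n]"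
        unfolding l_def D(4)[symmetric] using n by (simp add: upt_conv_Cons numeral_2_eq_2)
      then show ?thesis using True by (simp add: s_def)
    next
      case False
      then show ?thesis using permutes_not_in[OF D(1), of r] by (simp add: s_def)
    qed
  qed
  have "(\<Sum>\<sigma>\<in>shuffles_perm 2 (n - 2). f (\<sigma> 0) (\<sigma> 1)) = (\<Sum>(j, i)\<in>Sigma {..<n} (\<lambda>j. {..<j}). f i j)"
  proof (rule sum.reindex_bij_witness[of _ "\<lambda>z. s (snd z) (fst z)" "\<lambda>\<sigma>. (\<sigma> 1, \<sigma> 0)"])
    fix \<sigma> assume \<sigma>: "\<sigma> \<in> shuffles_perm 2 (n - 2)"
    show "s (snd (\<sigma> 1, \<sigma> 0)) (fst (\<sigma> 1, \<sigma> 0)) = \<sigma>" unfolding fst_conv snd_conv by (rule inv[OF \<sigma>])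
    show "(\<sigma> 1, \<sigma> 0) \<in> Sigma {..<n} (\<lambda>j. {..<j})" using shuffles_perm_2D(2,3)[OF \<sigma> n] by simp
    show "(case (\<sigma> 1, \<sigma> 0) of (j, i) \<Rightarrow> f i j) = f (\<sigma> 0) (\<sigma> 1)" by simp
  next
    fix z assume z: "z \<in> Sigma {..<n} (\<lambda>j. {..<j})"
    show "(s (snd z) (fst z) 1, s (snd z) (fst z) 0) = z" unfolding s01 by simp
    show "s (snd z) (fst z) \<in> shuffles_perm 2 (n - 2)" using z by (intro sh) auto
  qed
  then show ?thesis by (simp add: sum.Sigma)
qed

text \<open>The Koszul sign for bringing the factors \<open>i < j\<close> to the front. The last summand makes up for the
  factor \<open>i\<close> being counted in the second one, although \<open>j\<close> does not pass it.\<close>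

definition pair_sign :: "nat list \<Rightarrow> nat \<Rightarrow> nat \<Rightarrow> real" where
  "pair_sign ds i j = (-1) ^ (ds ! i * sum_list (take i ds) + ds ! j * sum_list (take j ds) + ds ! i * ds ! j)"

text \<open>The inversions of such a shuffle are the pairs of one of the two chosen elements with a remaining
  element that is smaller.\<close>

lemma koszul_sign_shuffle_2:
  assumes \<sigma>: "\<sigma> \<in> shuffles_perm 2 (n - 2)" and n: "2 \<le> n" "length ds = n"
  shows "koszul_sign ds \<sigma> = pair_sign ds (\<sigma> 0) (\<sigma> 1)"
proof -
  note D = shuffles_perm_2D[OF \<sigma> n(1)]
  let ?i = "\<sigma> 0" and ?j = "\<sigma> 1"
  have inj: "inj \<sigma>" by (rule permutes_inj[OF D(1)])
  define I where "I k = {s \<in> {2..<n}. \<sigma> s < k}" for k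
  have inv: "inversions n \<sigma> = Pair 0 ` I ?i \<union> Pair 1 ` I ?j"
  proof (intro set_eqI iffI)
    fix z assume "z \<in> inversions n \<sigma>"
    then obtain r s where z: "z = (r, s)" "r < s" "s < n" "\<sigma> s < \<sigma> r" by auto
    have "r < 2" using D(5)[of r s] z by (meson not_less not_less_iff_gr_or_eq)
    moreover have "s \<ge> 2"
    proof (rule ccontr)
      assume "\<not> 2 \<le> s"
      then have "r = 0" "s = 1" using z(2) by auto
      then show False using z(4) D(2) by simp
    qed
    ultimately show "z \<in> Pair 0 ` I ?i \<union> Pair 1 ` I ?j" using z by (auto simp: I_def less_2_cases_iff)
  qed (auto simp: I_def)
  have img: "\<sigma> ` I k = {..<k} - {?i, ?j}" if "k < n" for k
  proof (intro set_eqI iffI)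
    fix t assume t: "t \<in> {..<k} - {?i, ?j}"
    then have "t \<in> set (map \<sigma> [2..<n])" unfolding D(4) using that by auto
    then obtain s where "s \<in> {2..<n}" "t = \<sigma> s" by auto
    then show "t \<in> \<sigma> ` I k" using t by (auto simp: I_def)
  next
    fix t assume "t \<in> \<sigma> ` I k"
    then show "t \<in> {..<k} - {?i, ?j}" using injD[OF inj] by (fastforce simp: I_def)
  qed
  have P: "(\<Prod>s\<in>I k. (-1::real) ^ (d * ds ! \<sigma> s)) = (-1) ^ (d * (\<Sum>t\<in>{..<k} - {?i, ?j}. ds ! t))"
    if "k < n" for k d
  proof -
    have "(\<Prod>s\<in>I k. (-1::real) ^ (d * ds ! \<sigma> s)) = (\<Prod>t\<in>\<sigma> ` I k. (-1) ^ (d * ds ! t))"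
      by (subst prod.reindex) (use inj in \<open>auto intro: inj_on_subset\<close>)
    then show ?thesis unfolding img[OF that] by (simp add: power_sum[symmetric] sum_distrib_left)
  qed
  have take: "sum_list (take k ds) = (\<Sum>t<k. ds ! t)" if "k < n" for k
    using that n(2) by (simp add: sum_list_sum_nth atLeast0LessThan)
  have i: "?i < n" using D(2,3) by simp
  have 1: "(\<Sum>t\<in>{..<?i} - {?i, ?j}. ds ! t) = sum_list (take ?i ds)"
    unfolding take[OF i] using D(2) by (intro sum.cong) auto
  have 2: "(\<Sum>t\<in>{..<?j} - {?i, ?j}. ds ! t) + ds ! ?i = sum_list (take ?j ds)"
  proof -
    have "{..<?j} - {?i, ?j} = {..<?j} - {?i}" by auto
    then show ?thesis unfolding take[OF D(3)] using sum.remove[of "{..<?j}" ?i "(!) ds"] D(2) by simp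
  qed
  have "koszul_sign ds \<sigma> = (\<Prod>(r, s)\<in>Pair 0 ` I ?i. (-1) ^ (ds ! \<sigma> r * ds ! \<sigma> s))
      * (\<Prod>(r, s)\<in>Pair 1 ` I ?j. (-1) ^ (ds ! \<sigma> r * ds ! \<sigma> s))"
    unfolding koszul_sign_def n(2) inv by (rule prod.union_disjoint) (auto simp: I_def)
  also have "\<dots> = (\<Prod>s\<in>I ?i. (-1) ^ (ds ! ?i * ds ! \<sigma> s)) * (\<Prod>s\<in>I ?j. (-1) ^ (ds ! ?j * ds ! \<sigma> s))"
    by (subst (1 2) prod.reindex) (auto simp: inj_on_def)
  also have "\<dots> = (-1) ^ (ds ! ?i * sum_list (take ?i ds)) * (-1) ^ (ds ! ?j * (\<Sum>t\<in>{..<?j} - {?i, ?j}. ds ! t))"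
    unfolding P[OF i] P[OF D(3)] 1 ..
  also have "\<dots> = pair_sign ds ?i ?j"
  proof -
    have "ds ! ?i * sum_list (take ?i ds) + ds ! ?j * ((\<Sum>t\<in>{..<?j} - {?i, ?j}. ds ! t) + ds ! ?i) + ds ! ?i * ds ! ?j
        = ds ! ?i * sum_list (take ?i ds) + ds ! ?j * (\<Sum>t\<in>{..<?j} - {?i, ?j}. ds ! t) + 2 * (ds ! ?i * ds ! ?j)"
      by (simp only: distrib_left mult_2 mult.commute[of "ds ! ?j" "ds ! ?i"] add.assoc)
    then show ?thesis
      unfolding pair_sign_def 2[symmetric] by (simp only: power_add power_mult power_minus1_even) simp
  qed
  finally show ?thesis .
qed



section \<open>Iterated contractions\<close>

context manifold
begin

definition fields :: "nat list \<Rightarrow> ('p, 'e) mvfield list \<Rightarrow> bool" where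
  "fields ks xs \<longleftrightarrow> list_all2 (\<lambda>k x. x \<in> multivector_fields A k) ks xs"

lemma fields_Nil [simp]: "fields ks [] \<longleftrightarrow> ks = []"
  and fields_Cons: "fields ks (x # xs) \<longleftrightarrow> (\<exists>k ks'. ks = k # ks' \<and> x \<in> multivector_fields A k \<and> fields ks' xs)"
  by (auto simp: fields_def list_all2_Cons2)

lemma fields_length: "fields ks xs \<Longrightarrow> length ks = length xs"
  by (simp add: fields_def list_all2_lengthD)

lemma fields_nth: "fields ks xs \<Longrightarrow> j < length xs \<Longrightarrow> xs ! j \<in> multivector_fields A (ks ! j)"
  by (simp add: fields_def list_all2_conv_all_nth)

lemma fields_map_nth:
  assumes "fields ks xs" "set is \<subseteq> {..<length xs}"
  shows "fields (map ((!) ks) is) (map ((!) xs) is)"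
proof -
  have "xs ! i \<in> multivector_fields A (ks ! i)" if "i \<in> set is" for i
    using assms(2) that by (intro fields_nth[OF assms(1)]) auto
  then show ?thesis by (simp add: fields_def list_all2_conv_all_nth)
qed

lemma fields_nths:
  assumes "fields ks xs"
  shows "fields (nths ks S) (nths xs S)"
  unfolding nths_conv_filter fields_length[OF assms] by (rule fields_map_nth[OF assms]) auto

lemma foldr_contract_Cons: "foldr contract (x # xs) \<alpha> = contract x (foldr contract xs \<alpha>)"
  by simp

lemma contract_apply: "contract x \<alpha> p = ext_contract (x p) (\<alpha> p)"
  by (simp add: contract_def)

lemma iter_diff_forms:
  assumes "fields ks xs" "\<alpha> \<in> diff_forms A n"
  shows "foldr contract xs \<alpha> \<in> diff_forms A (n - sum_list ks)"
  using assms(1)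
proof (induction xs arbitrary: ks)
  case (Cons x xs)
  then obtain k ks' where k: "ks = k # ks'" "x \<in> multivector_fields A k" "fields ks' xs"
    unfolding fields_Cons by blast
  from contract_diff_forms[OF k(2) Cons.IH[OF k(3)]] show ?case by (simp add: k(1) add.commute)
qed (simp add: assms(2))

lemma iter_combination:
  assumes "fields ks xs" "\<alpha> \<in> diff_forms A n" "\<beta> \<in> diff_forms A n"
  shows "foldr contract xs (a *\<^sub>R \<alpha> + b *\<^sub>R \<beta>) = a *\<^sub>R foldr contract xs \<alpha> + b *\<^sub>R foldr contract xs \<beta>"
  using assms(1)
proof (induction xs arbitrary: ks)
  case (Cons x xs)
  then obtain k ks' where k: "ks = k # ks'" "x \<in> multivector_fields A k" "fields ks' xs"
    unfolding fields_Cons by blast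
  show ?case
    unfolding foldr_contract_Cons Cons.IH[OF k(3)]
    by (rule contract_combination[OF k(2) iter_diff_forms[OF k(3) assms(2)] iter_diff_forms[OF k(3) assms(3)]])
qed simp

lemma iter_zero: "fields ks xs \<Longrightarrow> foldr contract xs 0 = 0"
  using iter_combination[OF _ diff_forms_zero diff_forms_zero, of ks xs 0 0] by simp

lemma iter_scale: "fields ks xs \<Longrightarrow> \<alpha> \<in> diff_forms A n \<Longrightarrow> foldr contract xs (a *\<^sub>R \<alpha>) = a *\<^sub>R foldr contract xs \<alpha>"
  using iter_combination[of ks xs \<alpha> n \<alpha> a 0] by simp

lemma mv_prod_outside: "fields ks xs \<Longrightarrow> p \<notin> points A \<Longrightarrow> mv_prod A ks xs p \<beta> = 0"
proof (cases xs)
  case (Cons x xs')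
  assume "fields ks xs" "p \<notin> points A"
  then obtain k ks' where k: "ks = k # ks'" "x p = 0" unfolding Cons fields_Cons using multivector_fieldD(1) by blast
  then show ?thesis by (simp add: Cons ext_mult_def)
qed simp

lemma mv_prod_ext_power:
  assumes "fields ks xs" "p \<in> points A"
  shows "mv_prod A ks xs p \<in> ext_power (sum_list ks) (T p)"
  using assms(1)
proof (induction xs arbitrary: ks)
  case Nil
  then show ?case using assms(2) by (simp add: decomposable_Nil_in_ext_power)
next
  case (Cons x xs)
  then obtain k ks' where k: "ks = k # ks'" "x \<in> multivector_fields A k" "fields ks' xs"
    unfolding fields_Cons by blast
  show ?case
    using ext_mult_in_ext_power[OF multivector_fieldD(2)[OF k(2) assms(2)] Cons.IH[OF k(3)]] by (simp add: k(1))
qed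

text \<open>The contraction with a product is the composition of the contractions, \<open>\<iota>\<^bsub>xy\<^esub> = \<iota>\<^sub>x \<iota>\<^sub>y\<close>.\<close>

lemma contract_mv_prod:
  assumes "fields ks xs" "\<alpha> \<in> diff_forms A n"
  shows "contract (mv_prod A ks xs) \<alpha> = foldr contract xs \<alpha>"
proof (rule ext)
  fix p
  show "contract (mv_prod A ks xs) \<alpha> p = foldr contract xs \<alpha> p"
  proof (cases "p \<in> points A")
    case True
    have "ext_contract (mv_prod A ks xs p) (\<alpha> p) = foldr contract xs \<alpha> p"
      using assms(1)
    proof (induction xs arbitrary: ks)
      case Nil
      then show ?case using True decomposable_Nil_contract[OF diff_formsD(2)[OF assms(2) True]] by simp
    next
      case (Cons x xs)
      then obtain k ks' where k: "ks = k # ks'" "x \<in> multivector_fields A k" "fields ks' xs"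
        unfolding fields_Cons by blast
      show ?case
        unfolding k(1) mv_prod.simps foldr_contract_Cons contract_apply[of x "foldr contract xs \<alpha>"]
          Cons.IH[OF k(3), symmetric]
        by (rule ext_contract_ext_mult[OF multivector_fieldD(2)[OF k(2) True] mv_prod_ext_power[OF k(3) True]
            diff_formsD(2)[OF assms(2) True]])
    qed
    then show ?thesis by (simp only: contract_apply)
  next
    case False
    have "foldr contract xs \<alpha> p = 0" by (rule diff_formsD(1)[OF iter_diff_forms[OF assms] False])
    moreover have "contract (mv_prod A ks xs) \<alpha> p = 0"
      by (rule ext) (simp add: contract_def ext_contract_def mv_prod_outside[OF assms(1) False])
    ultimately show ?thesis by simp
  qed
qed

text \<open>This is what allows the contraction with any one field to be performed first, directly on \<open>\<omega>\<close>.\<close>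

lemma contract_iter_commute:
  assumes x: "x \<in> multivector_fields A k" and ys: "fields ls ys" and \<alpha>: "\<alpha> \<in> diff_forms A n"
  shows "contract x (foldr contract ys \<alpha>) = (-1) ^ (k * sum_list ls) *\<^sub>R foldr contract ys (contract x \<alpha>)"
  using ys
proof (induction ys arbitrary: ls)
  case (Cons y ys)
  then obtain l ls' where l: "ls = l # ls'" "y \<in> multivector_fields A l" "fields ls' ys"
    unfolding fields_Cons by blast
  have "contract x (foldr contract (y # ys) \<alpha>) = (-1) ^ (k * l) *\<^sub>R contract y (contract x (foldr contract ys \<alpha>))"
    using contract_commute[OF x l(2) iter_diff_forms[OF l(3) \<alpha>]] by simp
  also have "contract y (contract x (foldr contract ys \<alpha>))
      = (-1) ^ (k * sum_list ls') *\<^sub>R foldr contract (y # ys) (contract x \<alpha>)"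
    unfolding Cons.IH[OF l(3)]
    using contract_scale[OF l(2) iter_diff_forms[OF l(3) contract_diff_forms[OF x \<alpha>]]] by simp
  finally show ?case by (simp add: l(1) power_add distrib_left)
qed simp

text \<open>Bring \<open>x\<close> next to \<open>\<alpha>\<close> by passing it through the fields to its right.\<close>

lemma iter_move:
  assumes "fields ks xs" "x \<in> multivector_fields A k" "fields ls ys" "\<alpha> \<in> diff_forms A n"
  shows "foldr contract (xs @ x # ys) \<alpha> = (-1) ^ (k * sum_list ls) *\<^sub>R foldr contract (xs @ ys) (contract x \<alpha>)"
  using contract_iter_commute[OF assms(2-4)]
    iter_scale[OF assms(1) iter_diff_forms[OF assms(3) contract_diff_forms[OF assms(2,4)]]]
  by simp

text \<open>The value of an iterated contraction depends on a multi-vector field \<open>x\<close> only through \<open>\<iota>\<^sub>x \<omega>\<close>.\<close>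

lemma contract_iter_eq:
  assumes "x \<in> multivector_fields A k" "y \<in> multivector_fields A k" "fields ls ys" "\<omega> \<in> diff_forms A n"
    "contract x \<omega> = contract y \<omega>"
  shows "contract x (foldr contract ys \<omega>) = contract y (foldr contract ys \<omega>)"
  unfolding contract_iter_commute[OF assms(1,3,4)] contract_iter_commute[OF assms(2,3,4)] assms(5) ..

lemma iter_eq:
  assumes "fields ks xs" "fields ks ys" "\<omega> \<in> diff_forms A n"
    "\<And>s. s < length xs \<Longrightarrow> contract (xs ! s) \<omega> = contract (ys ! s) \<omega>"
  shows "foldr contract xs \<omega> = foldr contract ys \<omega>"
  using assms(1,2,4)
proof (induction xs arbitrary: ks ys)
  case Nil
  then show ?case using fields_length by fastforce
next
  case (Cons x xs)
  then obtain k ks' where k: "ks = k # ks'" "x \<in> multivector_fields A k" "fields ks' xs"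
    unfolding fields_Cons by blast
  with Cons.prems(2) obtain y ys' where y: "ys = y # ys'" "y \<in> multivector_fields A k" "fields ks' ys'"
    by (auto simp: fields_def list_all2_Cons1)
  have "foldr contract xs \<omega> = foldr contract ys' \<omega>"
    using Cons.prems(3)[of "Suc _"] by (intro Cons.IH[OF k(3) y(3)]) (simp add: y(1))
  moreover have "contract x (foldr contract ys' \<omega>) = contract y (foldr contract ys' \<omega>)"
    using Cons.prems(3)[of 0] by (intro contract_iter_eq[OF k(2) y(2,3) assms(3)]) (simp add: y(1))
  ultimately show ?case by (simp add: y(1))
qed

lemma iter_zero_factor:
  assumes "fields ks xs" "\<omega> \<in> diff_forms A n" "x \<in> set xs" "contract x \<omega> = 0"
  shows "foldr contract xs \<omega> = 0"
proof -
  obtain as bs where xs: "xs = as @ x # bs" using assms(3) by (auto simp: in_set_conv_decomp)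
  obtain ks1 k ks2 where "fields ks1 as" "x \<in> multivector_fields A k" "fields ks2 bs"
    using assms(1) unfolding xs fields_def by (auto simp: list_all2_append2 list_all2_Cons2)
  moreover from this have "fields (ks1 @ ks2) (as @ bs)"
    unfolding fields_def by (intro list_all2_appendI)
  ultimately show ?thesis using iter_move[OF _ _ _ assms(2)] iter_zero assms(4) unfolding xs by simp
qed

lemma iter_permute:
  assumes f: "fields ds xs" and \<omega>: "\<omega> \<in> diff_forms A n" and \<sigma>: "\<sigma> permutes {..<length xs}"
  shows "foldr contract xs \<omega> = koszul_sign ds \<sigma> *\<^sub>R foldr contract (permute_by \<sigma> [0..<length xs] xs) \<omega>"
proof (rule koszul_sign_permutation[OF _ fields_length[OF f] \<sigma>])
  fix \<rho> as bs x y es fs d e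
  assume xs: "as @ x # y # bs = map (\<lambda>r. xs ! \<rho> r) [0..<length xs]" and \<rho>: "\<rho> permutes {..<length xs}"
    and ds: "es @ d # e # fs = map (\<lambda>r. ds ! \<rho> r) [0..<length xs]" and len: "length es = length as"
  have "set (map \<rho> [0..<length xs]) \<subseteq> {..<length xs}"
    using permutes_image[OF \<rho>] by (simp add: atLeast0LessThan)
  from fields_map_nth[OF f this] have "fields (es @ d # e # fs) (as @ x # y # bs)"
    unfolding xs ds by (simp only: map_map o_def)
  then have l: "fields es as" "x \<in> multivector_fields A d" "y \<in> multivector_fields A e" "fields fs bs"
    unfolding fields_def list_all2_append[OF len] by simp_all
  show "foldr contract (as @ x # y # bs) \<omega> = (-1) ^ (d * e) *\<^sub>R foldr contract (as @ y # x # bs) \<omega>"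
    unfolding foldr_append o_apply foldr_contract_Cons contract_commute[OF l(2,3) iter_diff_forms[OF l(4) \<omega>]]
    by (rule iter_scale[OF l(1) contract_diff_forms[OF l(3) contract_diff_forms[OF l(2) iter_diff_forms[OF l(4) \<omega>]]]])
qed


section \<open>The exterior derivative of an iterated contraction\<close>

text \<open>A product of \<open>k\<close> vectors leaves no value of a form of degree less than \<open>k\<close>.\<close>

lemma contract_above:
  assumes "x \<in> multivector_fields A k" "\<alpha> \<in> diff_forms A n" "n < k"
  shows "contract x \<alpha> = 0"
proof (intro ext)
  fix p vs
  show "contract x \<alpha> p vs = 0 p vs"
  proof (cases "p \<in> points A")
    case True
    obtain L where L: "mvec_terms k (T p) L" "x p = mvec (T p) L"
      by (rule ext_power_mvec[OF multivector_fieldD(2)[OF assms(1) True]])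
    have "contract x \<alpha> p vs = (\<Sum>t\<leftarrow>L. fst t * \<alpha> p (rev (snd t) @ vs))"
      unfolding contract_def L(2) by (rule ext_contract_mvec[OF L(1) diff_formsD(2)[OF assms(2) True]])
    also have "\<dots> = (\<Sum>t\<leftarrow>L. 0)"
    proof (intro arg_cong[where f = sum_list] map_cong refl)
      fix t assume "t \<in> set L"
      then have "\<alpha> p (rev (snd t) @ vs) = 0"
        using mvec_terms_snd[OF L(1)] assms(3) by (intro alt_forms_outside[OF diff_formsD(2)[OF assms(2) True]]) auto
      then show "fst t * \<alpha> p (rev (snd t) @ vs) = 0" by simp
    qed
    finally show ?thesis by simp
  next
    case False
    then show ?thesis using contract_tangential[OF assms(1,2)] by (simp add: tangential_def)
  qed
qed

text \<open>The graded commutator \<open>[d, \<iota>\<^sub>x]\<close>.\<close>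

definition lie_derivative :: "nat \<Rightarrow> ('p, 'e) mvfield \<Rightarrow> ('p, 'e) form \<Rightarrow> ('p, 'e) form" where
  "lie_derivative k x \<alpha> = ext_deriv A (contract x \<alpha>) - (-1) ^ k *\<^sub>R contract x (ext_deriv A \<alpha>)"

lemma ext_deriv_contract_diff_forms:
  assumes "x \<in> multivector_fields A k" "\<alpha> \<in> diff_forms A n"
  shows "ext_deriv A (contract x \<alpha>) \<in> diff_forms A (Suc n - k)"
proof (cases "n < k")
  case True
  then show ?thesis using contract_above[OF assms] by (simp add: ext_deriv_zero diff_forms_zero)
next
  case False
  then show ?thesis using ext_deriv_diff_forms[OF contract_diff_forms[OF assms]] by (simp add: Suc_diff_le)
qed

lemma lie_derivative_diff_forms:
  assumes "x \<in> multivector_fields A k" "\<alpha> \<in> diff_forms A n"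
  shows "lie_derivative k x \<alpha> \<in> diff_forms A (Suc n - k)"
  unfolding lie_derivative_def
  by (intro subspace_diff[OF subspace_diff_forms] subspace_scale[OF subspace_diff_forms]
      ext_deriv_contract_diff_forms[OF assms] contract_diff_forms[OF assms(1) ext_deriv_diff_forms[OF assms(2)]])

text \<open>The relation \<open>\<iota>\<^sub>v = [[d, \<iota>\<^sub>x], \<iota>\<^sub>y]\<close>, in the form in which \<open>[d, \<iota>\<^sub>x]\<close> is commuted past \<open>\<iota>\<^sub>y\<close>.\<close>

definition is_schouten :: "nat \<Rightarrow> nat \<Rightarrow> ('p, 'e) mvfield \<Rightarrow> ('p, 'e) mvfield \<Rightarrow> ('p, 'e) mvfield \<Rightarrow> bool" where
  "is_schouten k l x y v \<longleftrightarrow> v \<in> multivector_fields A (k + l - 1) \<and> (\<forall>n. \<forall>\<alpha>\<in>diff_forms A n.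
     contract v \<alpha> = lie_derivative k x (contract y \<alpha>) - (-1) ^ (Suc k * l) *\<^sub>R contract y (lie_derivative k x \<alpha>))"

lemma is_schouten_exists:
  assumes x: "x \<in> multivector_fields A k" and y: "y \<in> multivector_fields A l" and kl: "1 \<le> k + l"
  shows "\<exists>v. is_schouten k l x y v"
proof -
  obtain v where v: "v \<in> multivector_fields A (k + l - 1)" "\<forall>n. \<forall>\<alpha>\<in>diff_forms A n.
    contract v \<alpha> = ext_deriv A (contract x (contract y \<alpha>)) - (-1) ^ k *\<^sub>R contract x (ext_deriv A (contract y \<alpha>))
      - (-1) ^ (Suc k * l) *\<^sub>R (contract y (ext_deriv A (contract x \<alpha>)) - (-1) ^ k *\<^sub>R contract y (contract x (ext_deriv A \<alpha>)))"
    using schouten_bracket_exists[OF assms] by blast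
  have "contract y (lie_derivative k x \<alpha>)
      = contract y (ext_deriv A (contract x \<alpha>)) - (-1) ^ k *\<^sub>R contract y (contract x (ext_deriv A \<alpha>))"
    if \<alpha>: "\<alpha> \<in> diff_forms A n" for \<alpha> n
    unfolding lie_derivative_def
    using contract_combination[OF y ext_deriv_contract_diff_forms[OF x \<alpha>]
        contract_diff_forms[OF x ext_deriv_diff_forms[OF \<alpha>]], of 1 "- ((-1) ^ k)"] by simp
  then show ?thesis using v unfolding is_schouten_def by (intro exI[of _ v]) (simp add: lie_derivative_def)
qed

lemma contract_sum:
  assumes "x \<in> multivector_fields A k" "finite I" "\<And>i. i \<in> I \<Longrightarrow> \<alpha> i \<in> diff_forms A n"
  shows "contract x (\<Sum>i\<in>I. c i *\<^sub>R \<alpha> i) = (\<Sum>i\<in>I. c i *\<^sub>R contract x (\<alpha> i))"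
  using assms(2,3)
proof (induction I rule: finite_induct)
  case empty
  show ?case unfolding sum.empty by (rule contract_zero_form[OF assms(1)])
next
  case (insert i I)
  have "(\<Sum>i\<in>I. c i *\<^sub>R \<alpha> i) \<in> diff_forms A n"
    using insert.prems by (intro subspace_sum[OF subspace_diff_forms] subspace_scale[OF subspace_diff_forms]) auto
  note comb = contract_combination[OF assms(1) insert.prems[OF insertI1] this, of "c i" 1]
  have IH: "contract x (\<Sum>i\<in>I. c i *\<^sub>R \<alpha> i) = (\<Sum>i\<in>I. c i *\<^sub>R contract x (\<alpha> i))"
    by (rule insert.IH) (rule insert.prems[OF insertI2])
  from comb show ?case unfolding sum.insert[OF insert.hyps(1,2)] scaleR_one IH .
qed

lemma sum_list_nths_delete:
  "j < length ls \<Longrightarrow> sum_list (nths ls (- {j})) + ls ! j = (sum_list ls :: nat)"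
proof (induction ls arbitrary: j)
  case (Cons l ls)
  show ?case
  proof (cases j)
    case 0
    have "{i. Suc i \<in> - {0}} = UNIV" by auto
    then show ?thesis by (simp add: 0 nths_Cons nths_all)
  next
    case (Suc i)
    have "{ia. Suc ia \<in> - {Suc i}} = - {i}" by auto
    then show ?thesis using Cons.IH[of i] Cons.prems by (simp add: Suc nths_Cons)
  qed
qed simp

lemma nths_delete_Cons:
  "nths (x # xs) (- {0}) = xs" "nths (x # xs) (- {Suc j}) = x # nths xs (- {j})"
  "nths (x # xs) (- {0, Suc j}) = nths xs (- {j})"
  "nths (x # xs) (- {Suc i, Suc j}) = x # nths xs (- {i, j})"
proof -
  have "{i. Suc i \<in> - {0}} = UNIV" "{i. Suc i \<in> - {Suc j}} = - {j}" "{i. Suc i \<in> - {0, Suc j}} = - {j}"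
    "{ia. Suc ia \<in> - {Suc i, Suc j}} = - {i, j}" by auto
  then show "nths (x # xs) (- {0}) = xs" "nths (x # xs) (- {Suc j}) = x # nths xs (- {j})"
    "nths (x # xs) (- {0, Suc j}) = nths xs (- {j})" "nths (x # xs) (- {Suc i, Suc j}) = x # nths xs (- {i, j})"
    by (simp_all add: nths_Cons nths_all)
qed

lemma minus_one_power_cong: "even m = even n \<Longrightarrow> (-1 :: real) ^ m = (-1) ^ n"
  by (cases "even m") simp_all

text \<open>The operator \<open>[d, \<iota>\<^sub>x]\<close> passes each \<open>\<iota>\<^sub>y\<close> at the cost of a term with \<open>\<iota>\<^bsub>[x,y]\<^esub>\<close>, which is moved to
  the front.\<close>

lemma lie_derivative_iter:
  assumes x: "x \<in> multivector_fields A k" and k: "1 \<le> k" and ys: "fields ls ys" and ls: "\<forall>l\<in>set ls. 1 \<le> l"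
    and \<alpha>: "\<alpha> \<in> diff_forms A n" and V: "\<forall>j<length ys. is_schouten k (ls ! j) x (ys ! j) (V j)"
  shows "lie_derivative k x (foldr contract ys \<alpha>) =
    (\<Sum>j<length ys. (-1) ^ (ls ! j * sum_list (take j ls)) *\<^sub>R contract (V j) (foldr contract (nths ys (- {j})) \<alpha>))
      + (-1) ^ (Suc k * sum_list ls) *\<^sub>R foldr contract ys (lie_derivative k x \<alpha>)"
  using ys ls V
proof (induction ys arbitrary: ls V)
  case (Cons y ys)
  then obtain l ls' where l: "ls = l # ls'" "y \<in> multivector_fields A l" "fields ls' ys"
    unfolding fields_Cons by blast
  let ?\<beta> = "foldr contract ys \<alpha>" and ?V = "\<lambda>j. V (Suc j)"
  let ?\<gamma> = "\<lambda>j. foldr contract (nths ys (- {j})) \<alpha>"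
  let ?N = "n - (k + sum_list ls' - 1)"
  have len: "length ls' = length ys" by (rule fields_length[OF l(3)])
  have sc: "is_schouten k (ls' ! j) x (ys ! j) (?V j)" if "j < length ys" for j
    using Cons.prems(3) that by (auto simp: l(1))
  have Vf: "?V j \<in> multivector_fields A (k + ls' ! j - 1)" if "j < length ys" for j
    using sc[OF that] unfolding is_schouten_def by blast
  have pos: "1 \<le> ls' ! j" if "j < length ys" for j using Cons.prems(2) that len by (auto simp: l(1))
  have \<gamma>: "?\<gamma> j \<in> diff_forms A (n - sum_list (nths ls' (- {j})))" for j
    by (rule iter_diff_forms[OF fields_nths[OF l(3)] \<alpha>])
  have V\<gamma>: "contract (?V j) (?\<gamma> j) \<in> diff_forms A ?N" if "j < length ys" for j
  proof -
    have "n - sum_list (nths ls' (- {j})) - (k + ls' ! j - 1) = ?N"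
      using sum_list_nths_delete[of j ls'] that len pos[OF that] k by simp
    then show ?thesis using contract_diff_forms[OF Vf[OF that] \<gamma>[of j]] by metis
  qed
  have X: "foldr contract ys (lie_derivative k x \<alpha>) \<in> diff_forms A ?N"
  proof -
    have "Suc n - k - sum_list ls' = ?N" using k by simp
    then show ?thesis using iter_diff_forms[OF l(3) lie_derivative_diff_forms[OF x \<alpha>]] by metis
  qed
  have "contract (V 0) ?\<beta> = lie_derivative k x (contract y ?\<beta>) - (-1) ^ (Suc k * l) *\<^sub>R contract y (lie_derivative k x ?\<beta>)"
    using Cons.prems(3) iter_diff_forms[OF l(3) \<alpha>] unfolding is_schouten_def by (force simp: l(1))
  then have 1: "lie_derivative k x (foldr contract (y # ys) \<alpha>)
      = contract (V 0) ?\<beta> + (-1) ^ (Suc k * l) *\<^sub>R contract y (lie_derivative k x ?\<beta>)" by simp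
  let ?c = "\<lambda>j. (-1) ^ (ls' ! j * sum_list (take j ls')) :: real"
  let ?S = "\<Sum>j<length ys. ?c j *\<^sub>R contract (?V j) (?\<gamma> j)"
  have S: "?S \<in> diff_forms A ?N"
    using V\<gamma> by (intro subspace_sum[OF subspace_diff_forms] subspace_scale[OF subspace_diff_forms]) auto
  have IH: "lie_derivative k x ?\<beta> = ?S + (-1) ^ (Suc k * sum_list ls') *\<^sub>R foldr contract ys (lie_derivative k x \<alpha>)"
    by (rule Cons.IH[OF l(3)]) (use Cons.prems(2) sc in \<open>auto simp: l(1)\<close>)
  have 2: "contract y (lie_derivative k x ?\<beta>)
      = contract y ?S + (-1) ^ (Suc k * sum_list ls') *\<^sub>R contract y (foldr contract ys (lie_derivative k x \<alpha>))"
    unfolding IH using contract_combination[OF l(2) S X, of 1] by simp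
  have 3: "contract y ?S = (\<Sum>j<length ys. ?c j *\<^sub>R ((-1) ^ (l * (k + ls' ! j - 1)) *\<^sub>R contract (?V j) (contract y (?\<gamma> j))))"
  proof -
    have "contract y ?S = (\<Sum>j<length ys. ?c j *\<^sub>R contract y (contract (?V j) (?\<gamma> j)))"
      by (rule contract_sum[OF l(2) finite_lessThan]) (rule V\<gamma>, simp only: lessThan_iff)
    also have "\<dots> = (\<Sum>j<length ys. ?c j *\<^sub>R ((-1) ^ (l * (k + ls' ! j - 1)) *\<^sub>R contract (?V j) (contract y (?\<gamma> j))))"
      by (intro sum.cong refl arg_cong2[where f = scaleR] contract_commute[OF l(2) Vf \<gamma>]) (simp only: lessThan_iff)
    finally show ?thesis .
  qed
  have 4: "(-1) ^ (Suc k * l) *\<^sub>R (?c j *\<^sub>R ((-1) ^ (l * (k + ls' ! j - 1)) *\<^sub>R z)) = (-1) ^ (ls' ! j * (l + sum_list (take j ls'))) *\<^sub>R z"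
    if "j < length ys" for j and z :: "('p, 'e) form"
  proof -
    have "even (Suc k * l + ls' ! j * sum_list (take j ls') + l * (k + ls' ! j - 1)) = even (ls' ! j * (l + sum_list (take j ls')))"
      using k pos[OF that] by auto
    from minus_one_power_cong[OF this] show ?thesis by (simp add: power_add mult.assoc)
  qed
  have 5: "(-1) ^ (Suc k * l) *\<^sub>R contract y ?S =
      (\<Sum>j<length ys. (-1) ^ (ls' ! j * (l + sum_list (take j ls'))) *\<^sub>R contract (?V j) (contract y (?\<gamma> j)))"
    unfolding 3 scaleR_sum_right by (rule sum.cong) (simp_all only: 4 lessThan_iff)
  let ?G = "\<lambda>j. (-1) ^ (ls ! j * sum_list (take j ls)) *\<^sub>R contract (V j) (foldr contract (nths (y # ys) (- {j})) \<alpha>)"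
  have G0: "?G 0 = contract (V 0) ?\<beta>"
    by (simp only: nths_delete_Cons(1) take_0 sum_list.Nil mult_0_right power_0 scaleR_one)
  have GS: "?G (Suc j) = (-1) ^ (ls' ! j * (l + sum_list (take j ls'))) *\<^sub>R contract (?V j) (contract y (?\<gamma> j))" for j
    by (simp only: l(1) nth_Cons_Suc take_Suc_Cons sum_list.Cons nths_delete_Cons(2) foldr_contract_Cons)
  have "(\<Sum>j<length (y # ys). ?G j) = contract (V 0) ?\<beta> + (-1) ^ (Suc k * l) *\<^sub>R contract y ?S"
    unfolding 5 by (simp only: length_Cons sum.lessThan_Suc_shift G0 GS)
  moreover have "(-1) ^ (Suc k * sum_list ls) *\<^sub>R foldr contract (y # ys) (lie_derivative k x \<alpha>) =
      (-1) ^ (Suc k * l) *\<^sub>R (-1) ^ (Suc k * sum_list ls') *\<^sub>R contract y (foldr contract ys (lie_derivative k x \<alpha>))"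
    by (simp only: l(1) sum_list.Cons distrib_left power_add scaleR_scaleR foldr_contract_Cons)
  ultimately show ?case unfolding 1 2 by (simp only: scaleR_add_right add.assoc)
qed simp

lemma pair_sign_Cons:
  "pair_sign (d # ds) 0 (Suc j) = (-1) ^ (ds ! j * sum_list (take j ds))"
  "pair_sign (d # ds) (Suc i) (Suc j) = (-1) ^ (d * (ds ! i + ds ! j)) * pair_sign ds i j"
proof -
  show "pair_sign (d # ds) 0 (Suc j) = (-1) ^ (ds ! j * sum_list (take j ds))"
    unfolding pair_sign_def by (rule minus_one_power_cong) auto
  show "pair_sign (d # ds) (Suc i) (Suc j) = (-1) ^ (d * (ds ! i + ds ! j)) * pair_sign ds i j"
    unfolding pair_sign_def power_add[symmetric] by (rule minus_one_power_cong) auto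
qed

text \<open>By induction on the number of fields: \<open>d \<iota>\<^sub>x = [d, \<iota>\<^sub>x] + (-1)\<^sup>k \<iota>\<^sub>x d\<close>, where the first term gives the pairs
  that contain \<open>x\<close> by \<open>lie_derivative_iter\<close>, and the second the other pairs. Any fields \<open>V i j\<close> with
  the right contraction of \<open>\<omega>\<close> may be used in place of the Schouten brackets.\<close>

theorem ext_deriv_iter:
  assumes xs: "fields ds xs" and ds: "\<forall>d\<in>set ds. 1 \<le> d" and \<omega>: "\<omega> \<in> diff_forms A n" "ext_deriv A \<omega> = 0"
    and ham: "\<forall>x\<in>set xs. ext_deriv A (contract x \<omega>) = 0"
    and V: "\<And>i j. i < j \<Longrightarrow> j < length xs \<Longrightarrow> V i j \<in> multivector_fields A (ds ! i + ds ! j - 1) \<and>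
      contract (V i j) \<omega> = ext_deriv A (contract (xs ! i) (contract (xs ! j) \<omega>))"
  shows "ext_deriv A (foldr contract xs \<omega>) =
    (\<Sum>j<length xs. \<Sum>i<j. pair_sign ds i j *\<^sub>R contract (V i j) (foldr contract (nths xs (- {i, j})) \<omega>))"
  using xs ds ham V
proof (induction xs arbitrary: ds V)
  case Nil
  then show ?case by (simp add: \<omega>)
next
  case (Cons x xs)
  then obtain k ls where k: "ds = k # ls" "x \<in> multivector_fields A k" "fields ls xs"
    unfolding fields_Cons by blast
  let ?\<beta> = "foldr contract xs \<omega>"
  have len: "length ls = length xs" by (rule fields_length[OF k(3)])
  have k1: "1 \<le> k" and pos: "\<And>j. j < length xs \<Longrightarrow> 1 \<le> ls ! j" using Cons.prems(2) len by (auto simp: k(1))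
  note ham = Cons.prems(3)
  have lie0: "lie_derivative k x \<omega> = 0"
    unfolding lie_derivative_def \<omega>(2) contract_zero_form[OF k(2)] bspec[OF ham list.set_intros(1)]
    by (simp only: scale_zero_right diff_self)
  have "\<exists>W. \<forall>j\<in>{..<length xs}. is_schouten k (ls ! j) x (xs ! j) (W j)"
    using is_schouten_exists[OF k(2) fields_nth[OF k(3)]] k1 by (intro bchoice ballI) simp
  then obtain W where W: "\<forall>j<length xs. is_schouten k (ls ! j) x (xs ! j) (W j)" by auto
  have WV: "contract (W j) (foldr contract (nths xs (- {j})) \<omega>) = contract (V 0 (Suc j)) (foldr contract (nths xs (- {j})) \<omega>)"
    if j: "j < length xs" for j
  proof (rule contract_iter_eq[OF _ _ fields_nths[OF k(3)] \<omega>(1)])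
    have y: "xs ! j \<in> multivector_fields A (ls ! j)" by (rule fields_nth[OF k(3) j])
    have W': "is_schouten k (ls ! j) x (xs ! j) (W j)" using W j by blast
    then show "W j \<in> multivector_fields A (k + ls ! j - 1)" unfolding is_schouten_def by blast
    show "V 0 (Suc j) \<in> multivector_fields A (k + ls ! j - 1)" using Cons.prems(4)[of 0 "Suc j"] j by (simp add: k(1))
    have "contract (W j) \<omega> = lie_derivative k x (contract (xs ! j) \<omega>) - (-1) ^ (Suc k * ls ! j) *\<^sub>R contract (xs ! j) (lie_derivative k x \<omega>)"
      using W' \<omega>(1) unfolding is_schouten_def by blast
    also have "\<dots> = ext_deriv A (contract x (contract (xs ! j) \<omega>))"
    proof -
      have 0: "ext_deriv A (contract (xs ! j) \<omega>) = 0" using ham nth_mem[OF j] by (metis list.set_intros(2))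
      show ?thesis
        unfolding lie0 contract_zero_form[OF y] unfolding lie_derivative_def 0 contract_zero_form[OF k(2)]
        by (simp only: scale_zero_right diff_0_right)
    qed
    also have "\<dots> = contract (V 0 (Suc j)) \<omega>" using Cons.prems(4)[of 0 "Suc j"] j by simp
    finally show "contract (W j) \<omega> = contract (V 0 (Suc j)) \<omega>" .
  qed
  have 1: "ext_deriv A (contract x ?\<beta>) = lie_derivative k x ?\<beta> + (-1) ^ k *\<^sub>R contract x (ext_deriv A ?\<beta>)"
    by (simp add: lie_derivative_def)
  have 2: "lie_derivative k x ?\<beta> = (\<Sum>j<length xs. (-1) ^ (ls ! j * sum_list (take j ls)) *\<^sub>R
      contract (V 0 (Suc j)) (foldr contract (nths xs (- {j})) \<omega>))"
    using lie_derivative_iter[OF k(2) k1 k(3) _ \<omega>(1) W] Cons.prems(2) WV iter_zero[OF k(3)]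
    by (simp add: k(1) lie0)
  let ?V = "\<lambda>i j. V (Suc i) (Suc j)" and ?\<gamma> = "\<lambda>i j. foldr contract (nths xs (- {i, j})) \<omega>"
  have IH: "ext_deriv A ?\<beta> = (\<Sum>j<length xs. \<Sum>i<j. pair_sign ls i j *\<^sub>R contract (?V i j) (?\<gamma> i j))"
  proof (rule Cons.IH[OF k(3)])
    show "\<And>i j. i < j \<Longrightarrow> j < length xs \<Longrightarrow> ?V i j \<in> multivector_fields A (ls ! i + ls ! j - 1) \<and>
      contract (?V i j) \<omega> = ext_deriv A (contract (xs ! i) (contract (xs ! j) \<omega>))"
      using Cons.prems(4)[of "Suc _" "Suc _"] by (simp add: k(1))
  qed (use Cons.prems(2,3) in \<open>auto simp: k(1)\<close>)
  have V': "?V i j \<in> multivector_fields A (ls ! i + ls ! j - 1)" if "i < j" "j < length xs" for i j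
    using Cons.prems(4)[of "Suc i" "Suc j"] that by (simp add: k(1))
  have \<gamma>: "?\<gamma> i j \<in> diff_forms A (n - sum_list (nths ls (- {i, j})))" for i j
    by (rule iter_diff_forms[OF fields_nths[OF k(3)] \<omega>(1)])
  have 3: "(-1) ^ k *\<^sub>R contract x (ext_deriv A ?\<beta>) = (\<Sum>j<length xs. \<Sum>i<j.
      pair_sign ds (Suc i) (Suc j) *\<^sub>R contract (?V i j) (contract x (?\<gamma> i j)))"
  proof -
    let ?I = "Sigma {..<length xs} (\<lambda>j. {..<j})"
    have tot: "sum_list (nths ls (- {i, j})) + ls ! i + ls ! j = sum_list ls" if "i < j" "j < length ls" for i j
      using that
    proof (induction ls arbitrary: i j)
      case (Cons l ls)
      obtain j' where j': "j = Suc j'" using Cons.prems by (cases j) auto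
      show ?case
      proof (cases i)
        case 0
        then show ?thesis using sum_list_nths_delete[of j' ls] Cons.prems by (simp add: j' nths_delete_Cons)
      next
        case (Suc i')
        then show ?thesis using Cons.IH[of i' j'] Cons.prems by (simp add: j' nths_delete_Cons)
      qed
    qed simp
    have V\<gamma>: "contract (?V i j) (?\<gamma> i j) \<in> diff_forms A (n - (sum_list ls - 1))" if "i < j" "j < length xs" for i j
    proof -
      have "n - sum_list (nths ls (- {i, j})) - (ls ! i + ls ! j - 1) = n - (sum_list ls - 1)"
        using tot[of i j] that len pos[of j] by simp
      then show ?thesis using contract_diff_forms[OF V'[OF that] \<gamma>[of i j]] by metis
    qed
    have "contract x (ext_deriv A ?\<beta>) = contract x (\<Sum>z\<in>?I. pair_sign ls (snd z) (fst z) *\<^sub>R contract (?V (snd z) (fst z)) (?\<gamma> (snd z) (fst z)))"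
      unfolding IH by (simp add: sum.Sigma case_prod_beta)
    also have "\<dots> = (\<Sum>z\<in>?I. pair_sign ls (snd z) (fst z) *\<^sub>R contract x (contract (?V (snd z) (fst z)) (?\<gamma> (snd z) (fst z))))"
      by (rule contract_sum[OF k(2)]) (auto intro!: V\<gamma>)
    also have "\<dots> = (\<Sum>j<length xs. \<Sum>i<j. pair_sign ls i j *\<^sub>R contract x (contract (?V i j) (?\<gamma> i j)))"
      by (simp add: sum.Sigma case_prod_beta)
    finally have "(-1) ^ k *\<^sub>R contract x (ext_deriv A ?\<beta>)
        = (\<Sum>j<length xs. \<Sum>i<j. (-1) ^ k *\<^sub>R pair_sign ls i j *\<^sub>R contract x (contract (?V i j) (?\<gamma> i j)))"
      by (simp add: scaleR_sum_right)
    also have "\<dots> = (\<Sum>j<length xs. \<Sum>i<j. pair_sign ds (Suc i) (Suc j) *\<^sub>R contract (?V i j) (contract x (?\<gamma> i j)))"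
    proof (intro sum.cong refl)
      fix i j assume "j \<in> {..<length xs}" "i \<in> {..<j}"
      then have ij: "i < j" "j < length xs" by auto
      have "even (k + k * (ls ! i + ls ! j - 1)) = even (k * (ls ! i + ls ! j))"
        using pos[of j] ij by auto
      from minus_one_power_cong[OF this]
      have "pair_sign ds (Suc i) (Suc j) = (-1) ^ k * (-1) ^ (k * (ls ! i + ls ! j - 1)) * pair_sign ls i j"
        by (simp add: k(1) pair_sign_Cons power_add)
      then show "(-1) ^ k *\<^sub>R pair_sign ls i j *\<^sub>R contract x (contract (?V i j) (?\<gamma> i j))
          = pair_sign ds (Suc i) (Suc j) *\<^sub>R contract (?V i j) (contract x (?\<gamma> i j))"
        using contract_commute[OF k(2) V'[OF ij] \<gamma>] by (simp add: mult_ac)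
    qed
    finally show ?thesis .
  qed
  have "ext_deriv A (foldr contract (x # xs) \<omega>) = (\<Sum>j<length xs. (-1) ^ (ls ! j * sum_list (take j ls)) *\<^sub>R
      contract (V 0 (Suc j)) (foldr contract (nths xs (- {j})) \<omega>)) + (\<Sum>j<length xs. \<Sum>i<j.
      pair_sign ds (Suc i) (Suc j) *\<^sub>R contract (?V i j) (contract x (?\<gamma> i j)))"
    using 1 unfolding 2 3 by simp
  moreover have "(\<Sum>j<length (x # xs). \<Sum>i<j. pair_sign ds i j *\<^sub>R contract (V i j) (foldr contract (nths (x # xs) (- {i, j})) \<omega>))
    = (\<Sum>j<length xs. \<Sum>i<Suc j. pair_sign ds i (Suc j) *\<^sub>R contract (V i (Suc j)) (foldr contract (nths (x # xs) (- {i, Suc j})) \<omega>))"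
    by (simp only: length_Cons sum.lessThan_Suc_shift lessThan_0 sum.empty add_0)
  moreover have "\<dots> = (\<Sum>j<length xs. (-1) ^ (ls ! j * sum_list (take j ls)) *\<^sub>R
      contract (V 0 (Suc j)) (foldr contract (nths xs (- {j})) \<omega>)) + (\<Sum>j<length xs. \<Sum>i<j.
      pair_sign ds (Suc i) (Suc j) *\<^sub>R contract (?V i j) (contract x (?\<gamma> i j)))"
    by (simp only: sum.lessThan_Suc_shift sum.distrib nths_delete_Cons(3,4) foldr_contract_Cons k(1) pair_sign_Cons(1))
  ultimately show ?case by (simp only:)
qed

end



section \<open>The graded space and its brackets\<close>

lemma scaleR_fun_apply: "(r *\<^sub>R f) x = r *\<^sub>R f x"
  by (simp add: scaleR_fun_def)

lemma sum_fun_apply: "(\<Sum>k\<in>K. f k) x = (\<Sum>k\<in>K. f k x)"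
  by (induction K rule: infinite_finite_induct) simp_all

lemma in_bidegree_zero: "in_bidegree i j 0 = 0"
  and in_bidegree_add: "in_bidegree i j (\<alpha> + \<beta>) = in_bidegree i j \<alpha> + in_bidegree i j \<beta>"
  and in_bidegree_scale: "in_bidegree i j (r *\<^sub>R \<alpha>) = r *\<^sub>R in_bidegree i j \<alpha>"
  by (intro ext; simp add: in_bidegree_def scaleR_fun_def)+

lemma in_bidegree_sum: "in_bidegree i j (\<Sum>z\<in>S. f z) = (\<Sum>z\<in>S. in_bidegree i j (f z))"
proof (induction S rule: infinite_finite_induct)
  case (insert x S)
  show ?case unfolding sum.insert[OF insert.hyps] in_bidegree_add insert.IH ..
next
  case (infinite S)
  show ?case unfolding sum.infinite[OF infinite] in_bidegree_zero ..
qed (simp only: sum.empty in_bidegree_zero)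

locale pre_multisymplectic_manifold = manifold X A
  for X :: "'p topology" and A :: "('p, 'e::real_inner) chart set" +
  fixes m :: nat and \<omega> :: "('p, 'e) form"
  assumes \<omega>: "\<omega> \<in> diff_forms A (m + 1)" and closed: "ext_deriv A \<omega> = 0"
begin

abbreviation l :: "('p, 'e) bigraded list \<Rightarrow> ('p, 'e) bigraded" where "l \<equiv> Xi_bracket A m \<omega>"

lemma hamiltonian_pair_zero: "1 \<le> k \<Longrightarrow> k \<le> m \<Longrightarrow> hamiltonian_pair A m \<omega> k 0 0"
  unfolding hamiltonian_pair_def contract_zero_field ext_deriv_zero
  using diff_forms_zero subspace_0[OF subspace_multivector_fields] by blast

lemma hamiltonian_pair_combination:
  assumes "hamiltonian_pair A m \<omega> k x \<alpha>" "hamiltonian_pair A m \<omega> k y \<beta>"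
  shows "hamiltonian_pair A m \<omega> k (a *\<^sub>R x + b *\<^sub>R y) (a *\<^sub>R \<alpha> + b *\<^sub>R \<beta>)"
proof -
  note H = assms[unfolded hamiltonian_pair_def]
  have "a *\<^sub>R x + b *\<^sub>R y \<in> multivector_fields A k"
    using H by (intro subspace_add[OF subspace_multivector_fields] subspace_scale[OF subspace_multivector_fields]) blast+
  moreover have "a *\<^sub>R \<alpha> + b *\<^sub>R \<beta> \<in> diff_forms A (m - k)" using H by (intro diff_forms_combination) blast+
  moreover have "contract (a *\<^sub>R x + b *\<^sub>R y) \<omega> = ext_deriv A (a *\<^sub>R \<alpha> + b *\<^sub>R \<beta>)"
    using H by (simp only: contract_combination_field ext_deriv_combination[of \<alpha> "m - k" \<beta>])
  ultimately show ?thesis using H unfolding hamiltonian_pair_def by blast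
qed

lemma subspace_ham_forms: "1 \<le> k \<Longrightarrow> k \<le> m \<Longrightarrow> subspace (ham_forms A m \<omega> k)"
proof -
  assume k: "1 \<le> k" "k \<le> m"
  have "a *\<^sub>R \<alpha> + b *\<^sub>R \<beta> \<in> ham_forms A m \<omega> k" if "\<alpha> \<in> ham_forms A m \<omega> k" "\<beta> \<in> ham_forms A m \<omega> k" for \<alpha> \<beta> a b
    using that hamiltonian_pair_combination unfolding ham_forms_def by blast
  from this[of _ _ 1 1] this[of _ _ _ 0] have "\<alpha> + \<beta> \<in> ham_forms A m \<omega> k" "r *\<^sub>R \<alpha> \<in> ham_forms A m \<omega> k"
    if "\<alpha> \<in> ham_forms A m \<omega> k" "\<beta> \<in> ham_forms A m \<omega> k" for \<alpha> \<beta> r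
    using that by (simp_all only: scaleR_one scale_zero_left add_0_right) 
  moreover have "0 \<in> ham_forms A m \<omega> k" using hamiltonian_pair_zero[OF k] unfolding ham_forms_def by blast
  ultimately show ?thesis unfolding subspace_def by blast
qed

lemma subspace_Xi_comp: "subspace (Xi_comp A m \<omega> i j)"
  unfolding Xi_comp_def using subspace_ham_forms[of "1 + j"] subspace_diff_forms subspace_single_0 by simp

lemma Xi_comp_diff_forms: "Xi_comp A m \<omega> i j \<subseteq> diff_forms A (m - i - j)"
  unfolding Xi_comp_def ham_forms_def hamiltonian_pair_def using diff_forms_zero by (auto simp: diff_diff_left)

text \<open>A subspace that contains the direct sum. Only single components of the arguments of the brackets matter,
  so multilinearity is proved on all of it, without a finiteness condition.\<close>

definition Xi_all :: "('p, 'e) bigraded set" where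
  "Xi_all = {a. \<forall>i j. a i j \<in> Xi_comp A m \<omega> i j}"

lemma subspace_Xi_all: "subspace Xi_all"
proof -
  have "0 \<in> Xi_all" unfolding Xi_all_def using subspace_0[OF subspace_Xi_comp] by simp
  moreover have "a + b \<in> Xi_all" if "a \<in> Xi_all" "b \<in> Xi_all" for a b
    using that subspace_add[OF subspace_Xi_comp] unfolding Xi_all_def by simp
  moreover have "r *\<^sub>R a \<in> Xi_all" if "a \<in> Xi_all" for r a
    using that subspace_scale[OF subspace_Xi_comp] unfolding Xi_all_def mem_Collect_eq scaleR_fun_apply by blast
  ultimately show ?thesis unfolding subspace_def by blast
qed

lemma Xi_component: "a \<in> Xi A m \<omega> k \<Longrightarrow> a i j \<in> (if i + j = k then Xi_comp A m \<omega> i j else {0})"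
  unfolding Xi_def by blast

lemma Xi_component_zero: "a \<in> Xi A m \<omega> k \<Longrightarrow> i + j \<noteq> k \<Longrightarrow> a i j = 0"
  using Xi_component[of a k i j] by (simp only: if_False singleton_iff)

lemma Xi_subset_Xi_all: "Xi A m \<omega> k \<subseteq> Xi_all"
proof
  fix a assume a: "a \<in> Xi A m \<omega> k"
  have "a i j \<in> Xi_comp A m \<omega> i j" for i j
  proof (cases "i + j = k")
    case True
    then show ?thesis using Xi_component[OF a, of i j] by (simp only: simp_thms if_True)
  next
    case False
    show ?thesis unfolding Xi_component_zero[OF a False] by (rule subspace_0[OF subspace_Xi_comp])
  qed
  then show "a \<in> Xi_all" unfolding Xi_all_def by blast
qed

lemma Xi_0: "a \<in> Xi A m \<omega> 0 \<Longrightarrow> a = 0"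
proof (intro ext)
  fix i j p vs assume a: "a \<in> Xi A m \<omega> 0"
  have "a i j = 0"
  proof (cases "i + j = 0")
    case True
    then have "Xi_comp A m \<omega> i j = {0}" by (simp add: Xi_comp_def)
    then show ?thesis using Xi_component[OF a, of i j] True by (simp only: simp_thms if_True singleton_iff)
  qed (rule Xi_component_zero[OF a])
  then show "a i j p vs = 0 i j p vs" by (simp only: zero_fun_apply)
qed

lemma subspace_Xi: "subspace (Xi A m \<omega> k)"
proof -
  have s: "subspace (if i + j = k then Xi_comp A m \<omega> i j else {0})" for i j
    by (simp only: subspace_Xi_comp subspace_single_0 split: if_split) simp
  have "0 \<in> Xi A m \<omega> k"
    unfolding Xi_def by (intro CollectI allI) (simp only: zero_fun_apply subspace_0[OF s])
  moreover have "a + b \<in> Xi A m \<omega> k" if "a \<in> Xi A m \<omega> k" "b \<in> Xi A m \<omega> k" for a b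
    using that subspace_add[OF s] unfolding Xi_def mem_Collect_eq plus_fun_apply by blast
  moreover have "r *\<^sub>R a \<in> Xi A m \<omega> k" if "a \<in> Xi A m \<omega> k" for r a
    using that subspace_scale[OF s] unfolding Xi_def mem_Collect_eq scaleR_fun_apply by blast
  ultimately show ?thesis unfolding subspace_def by blast
qed

lemma pos_graded_space_Xi: "pos_graded_space (Xi A m \<omega>)"
  unfolding pos_graded_space_def
proof (intro conjI allI impI subspace_Xi)
  show "Xi A m \<omega> 0 = {0}" using Xi_0 subspace_0[OF subspace_Xi] by blast
next
  fix f :: "nat \<Rightarrow> ('p, 'e) bigraded" and n k
  assume f: "\<forall>k<n. f k \<in> Xi A m \<omega> k" and s: "(\<Sum>k<n. f k) = 0" and k: "k < n"
  have "f k i j = 0" for i j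
  proof (cases "i + j = k")
    case True
    have "(\<Sum>k'<n. f k' i j) = f k i j + (\<Sum>k'\<in>{..<n} - {k}. f k' i j)"
      by (rule sum.remove) (use k in simp_all)
    also have "(\<Sum>k'\<in>{..<n} - {k}. f k' i j) = 0"
      using f True by (intro sum.neutral ballI Xi_component_zero) auto
    finally have "f k i j = (\<Sum>k'<n. f k' i j)" by (simp only: add_0_right)
    also have "\<dots> = (\<Sum>k<n. f k) i j" by (simp only: sum_fun_apply)
    finally show ?thesis by (simp only: s zero_fun_apply)
  next
    case False
    then show ?thesis using f k by (intro Xi_component_zero) auto
  qed
  then show "f k = 0" by (intro ext) (simp only: zero_fun_apply)
qed

lemma total_space_subset: "total_space (Xi A m \<omega>) \<subseteq> Xi_all"
  unfolding total_space_def by (rule span_minimal[OF _ subspace_Xi_all]) (use Xi_subset_Xi_all in blast)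

text \<open>The multi-vector field of degree \<open>d\<close> that the brackets attach to an element: a hamiltonian
  one for the component of total degree \<open>d\<close> in the first row, and zero in the degrees where that
  component vanishes.\<close>

definition fld :: "nat \<Rightarrow> ('p, 'e) bigraded \<Rightarrow> ('p, 'e) mvfield" where
  "fld d a = (if 1 \<le> d \<and> d \<le> m then ham_mvfield A m \<omega> d (a 1 (d - 1)) else 0)"

lemma fld:
  assumes "a \<in> Xi_all" "1 \<le> d"
  shows "fld d a \<in> multivector_fields A d" "contract (fld d a) \<omega> = ext_deriv A (a 1 (d - 1))"
proof -
  have "fld d a \<in> multivector_fields A d \<and> contract (fld d a) \<omega> = ext_deriv A (a 1 (d - 1))"
  proof (cases "d \<le> m")
    case True
    have "a 1 (d - 1) \<in> Xi_comp A m \<omega> 1 (d - 1)" using assms(1) unfolding Xi_all_def by blast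
    moreover have "Xi_comp A m \<omega> 1 (d - 1) = ham_forms A m \<omega> d"
    proof -
      have "d - 1 < m" using True assms(2) by simp
      then show ?thesis using assms(2) by (simp add: Xi_comp_def)
    qed
    ultimately have "a 1 (d - 1) \<in> ham_forms A m \<omega> d" by blast
    then have "hamiltonian_pair A m \<omega> d (ham_mvfield A m \<omega> d (a 1 (d - 1))) (a 1 (d - 1))"
      unfolding ham_forms_def ham_mvfield_def mem_Collect_eq by (rule someI_ex)
    then show ?thesis using True assms(2) unfolding fld_def hamiltonian_pair_def by simp
  next
    case False
    have "a 1 (d - 1) \<in> Xi_comp A m \<omega> 1 (d - 1)" using assms(1) unfolding Xi_all_def by blast
    moreover have "Xi_comp A m \<omega> 1 (d - 1) = {0}"
    proof -
      have "\<not> d - 1 < m" using False by simp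
      then show ?thesis by (simp add: Xi_comp_def)
    qed
    ultimately have 0: "a 1 (d - 1) = 0" by blast
    have f0: "fld d a = 0" using False by (simp add: fld_def)
    show ?thesis
      unfolding f0 0 ext_deriv_zero contract_zero_field using subspace_0[OF subspace_multivector_fields] by blast
  qed
  then show "fld d a \<in> multivector_fields A d" "contract (fld d a) \<omega> = ext_deriv A (a 1 (d - 1))" by blast+
qed

definition flds :: "nat list \<Rightarrow> ('p, 'e) bigraded list \<Rightarrow> ('p, 'e) mvfield list" where
  "flds ds as = map2 fld ds as"

lemma fields_flds:
  assumes "length ds = length as" "set as \<subseteq> Xi_all" "\<forall>d\<in>set ds. 1 \<le> d"
  shows "fields ds (flds ds as)"
  using assms
proof (induction ds as rule: list_induct2)
  case (Cons d ds a as)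
  then show ?case using fld(1)[of a d] by (simp add: flds_def fields_def)
qed (simp add: flds_def)

lemma nth_flds: "length ds = length as \<Longrightarrow> s < length as \<Longrightarrow> flds ds as ! s = fld (ds ! s) (as ! s)"
  by (simp add: flds_def)

lemma length_flds: "length ds = length as \<Longrightarrow> length (flds ds as) = length as"
  by (simp add: flds_def)

abbreviation iter :: "nat list \<Rightarrow> ('p, 'e) bigraded list \<Rightarrow> ('p, 'e) form" where
  "iter ds as \<equiv> foldr contract (flds ds as) \<omega>"

lemma iter_closed_component:
  assumes "length ds = length as" "set as \<subseteq> Xi_all" "\<forall>d\<in>set ds. 1 \<le> d" "s < length as"
    "ext_deriv A ((as ! s) 1 (ds ! s - 1)) = 0"
  shows "iter ds as = 0"
proof (rule iter_zero_factor[OF fields_flds[OF assms(1-3)] \<omega>])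
  show "flds ds as ! s \<in> set (flds ds as)" using assms(4) by (simp add: length_flds assms(1))
  have "as ! s \<in> Xi_all" "1 \<le> ds ! s" using assms by auto
  from fld(2)[OF this] show "contract (flds ds as ! s) \<omega> = 0" unfolding nth_flds[OF assms(1,4)] assms(5) .
qed

definition degrees :: "nat \<Rightarrow> nat \<Rightarrow> nat list set" where
  "degrees n j = {js. length js = n \<and> set js \<subseteq> {..<m} \<and> sum_list js = j}"

lemma finite_degrees: "finite (degrees n j)"
  by (rule finite_subset[OF _ finite_lists_length_eq[of "{..<m}" n]]) (auto simp: degrees_def)

lemma bracket_component:
  assumes "2 \<le> length as" "set as \<subseteq> Xi_all"
  shows "l as i j = (if i = length as - 1 then \<Sum>js\<in>degrees (length as) j. iter (map Suc js) as else 0)"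
proof -
  have cp: "contract_prod A \<omega> js (map2 (\<lambda>j a. ham_mvfield A m \<omega> (1 + j) (a 1 j)) js as) = iter (map Suc js) as"
    if "js \<in> degrees (length as) j" for js
  proof -
    have js: "length js = length as" "set js \<subseteq> {..<m}" using that by (auto simp: degrees_def)
    have "map2 (\<lambda>j a. ham_mvfield A m \<omega> (1 + j) (a 1 j)) js as = flds (map Suc js) as"
      using js by (induction js as rule: list_induct2) (auto simp: flds_def fld_def)
    moreover have "fields (map Suc js) (flds (map Suc js) as)"
      using js assms(2) by (intro fields_flds) auto
    ultimately show ?thesis by (simp only: contract_prod_def contract_mv_prod[OF _ \<omega>])
  qed
  have c: "(length as = 1 \<and> 1 \<le> i) = False" "(2 \<le> length as) = True" using assms(1) by auto
  have "(\<Sum>js\<in>degrees (length as) j. contract_prod A \<omega> js (map2 (\<lambda>j a. ham_mvfield A m \<omega> (1 + j) (a 1 j)) js as))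
      = (\<Sum>js\<in>degrees (length as) j. iter (map Suc js) as)" by (rule sum.cong[OF refl cp])
  then show ?thesis
    unfolding Xi_bracket_def degrees_def[symmetric] by (simp only: c if_False simp_thms)
qed

lemma bracket_single:
  "l [a] i j = (if 1 \<le> i then - ext_deriv A (a (Suc i) j) else 0)"
  by (simp only: Xi_bracket_def list.size(3,4) list.sel(1) add_0 One_nat_def simp_thms) simp

text \<open>In the sum over all \<open>j\<^sub>1 + \<cdots> + j\<^sub>k = j\<close> that defines the bracket, every term but one involves a
  component of the first row that is zero, and vanishes.\<close>

lemma bracket_one_component:
  assumes as: "2 \<le> length as" "set as \<subseteq> Xi_all" and js: "length js = length as"
    and one: "\<And>s j. s < length as \<Longrightarrow> j \<noteq> js ! s \<Longrightarrow> (as ! s) 1 j = 0"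
  shows "l as = in_bidegree (length as - 1) (sum_list js) (iter (map Suc js) as)"
proof (intro ext)
  fix i j p vs
  have other: "iter (map Suc js') as = 0" if js': "js' \<in> degrees (length as) j" "js' \<noteq> js" for js'
  proof -
    have len: "length js' = length as" using js' by (simp add: degrees_def)
    obtain s where s: "s < length as" "js' ! s \<noteq> js ! s"
      using js'(2) len unfolding list_eq_iff_nth_eq js by auto
    have "map Suc js' ! s - 1 = js' ! s" using s(1) len by simp
    then have 0: "(as ! s) 1 (map Suc js' ! s - 1) = 0" by (simp only: one[OF s])
    show ?thesis
    proof (rule iter_closed_component[OF _ as(2) _ s(1)])
      show "ext_deriv A ((as ! s) 1 (map Suc js' ! s - 1)) = 0" unfolding 0 by (rule ext_deriv_zero)
    qed (simp_all add: len)
  qed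
  have js0: "iter (map Suc js) as = 0" if large: "\<not> set js \<subseteq> {..<m}"
  proof -
    obtain x where x: "x \<in> set js" "\<not> x < m" using large by auto
    from x(1) obtain s where "s < length js" "js ! s = x" unfolding in_set_conv_nth by blast
    with x(2) js have s: "s < length as" "\<not> js ! s < m" by simp_all
    have "as ! s \<in> Xi_all" using s(1) as(2) by auto
    then have "(as ! s) 1 (js ! s) \<in> Xi_comp A m \<omega> 1 (js ! s)" unfolding Xi_all_def by blast
    moreover have "Xi_comp A m \<omega> 1 (js ! s) = {0}" using s(2) by (simp add: Xi_comp_def)
    ultimately have "(as ! s) 1 (js ! s) = 0" by blast
    moreover have "map Suc js ! s - 1 = js ! s" using s(1) js by simp
    ultimately have 0: "(as ! s) 1 (map Suc js ! s - 1) = 0" by (simp only:)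
    show ?thesis
    proof (rule iter_closed_component[OF _ as(2) _ s(1)])
      show "ext_deriv A ((as ! s) 1 (map Suc js ! s - 1)) = 0" unfolding 0 by (rule ext_deriv_zero)
    qed (simp_all add: js)
  qed
  have "(\<Sum>js'\<in>degrees (length as) j. iter (map Suc js') as) = (if sum_list js = j then iter (map Suc js) as else 0)"
  proof (cases "js \<in> degrees (length as) j")
    case True
    then have "(\<Sum>js'\<in>degrees (length as) j. iter (map Suc js') as) = iter (map Suc js) as
        + (\<Sum>js'\<in>degrees (length as) j - {js}. iter (map Suc js') as)" by (rule sum.remove[OF finite_degrees])
    also have "(\<Sum>js'\<in>degrees (length as) j - {js}. iter (map Suc js') as) = 0"
      using other by (intro sum.neutral ballI) blast
    finally have "(\<Sum>js'\<in>degrees (length as) j. iter (map Suc js') as) = iter (map Suc js) as"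
      by (simp only: add_0_right)
    moreover have "sum_list js = j" using True by (simp add: degrees_def)
    ultimately show ?thesis by (simp only: if_True simp_thms)
  next
    case False
    then have "(\<Sum>js'\<in>degrees (length as) j. iter (map Suc js') as) = 0"
      using other by (intro sum.neutral ballI) blast
    moreover have "sum_list js = j \<Longrightarrow> iter (map Suc js) as = 0"
      using False js js0 by (simp add: degrees_def)
    ultimately show ?thesis by presburger
  qed
  then have "l as i j = in_bidegree (length as - 1) (sum_list js) (iter (map Suc js) as) i j"
    unfolding bracket_component[OF as] in_bidegree_def by auto
  then show "l as i j p vs = in_bidegree (length as - 1) (sum_list js) (iter (map Suc js) as) i j p vs" by (rule fun_cong[OF fun_cong])
qed

lemma homogeneousD:
  assumes "homogeneous (Xi A m \<omega>) ds as"
  shows "length ds = length as" "set as \<subseteq> Xi_all" "\<And>s. s < length as \<Longrightarrow> as ! s \<in> Xi A m \<omega> (ds ! s)"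
proof -
  show len: "length ds = length as" using assms by (simp add: homogeneous_def list_all2_lengthD)
  show nth: "as ! s \<in> Xi A m \<omega> (ds ! s)" if "s < length as" for s
    using assms that by (simp add: homogeneous_def list_all2_conv_all_nth)
  show "set as \<subseteq> Xi_all"
  proof
    fix a assume "a \<in> set as"
    then obtain s where "s < length as" "a = as ! s" by (auto simp: in_set_conv_nth)
    then show "a \<in> Xi_all" using nth Xi_subset_Xi_all by blast
  qed
qed

lemma sum_list_pred: "\<forall>d\<in>set ds. 1 \<le> d \<Longrightarrow> sum_list (map (\<lambda>d. d - 1) ds) = sum_list ds - length ds \<and> length ds \<le> sum_list ds"
  by (induction ds) auto

lemma bracket_homogeneous:
  assumes h: "homogeneous (Xi A m \<omega>) ds as" and n: "2 \<le> length as" and ds: "\<forall>d\<in>set ds. 1 \<le> d"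
  shows "l as = in_bidegree (length as - 1) (sum_list ds - length as) (iter ds as)"
proof -
  note H = homogeneousD[OF h]
  have Suc: "map Suc (map (\<lambda>d. d - 1) ds) = ds" using ds by (induction ds) auto
  have "l as = in_bidegree (length as - 1) (sum_list (map (\<lambda>d. d - 1) ds)) (iter (map Suc (map (\<lambda>d. d - 1) ds)) as)"
  proof (rule bracket_one_component[OF n H(2)])
    fix s j assume s: "s < length as" "j \<noteq> map (\<lambda>d. d - 1) ds ! s"
    have "1 \<le> ds ! s" using ds s(1) H(1) by simp
    then have "1 + j \<noteq> ds ! s" using s H(1) by auto
    then show "(as ! s) 1 j = 0" by (rule Xi_component_zero[OF H(3)[OF s(1)]])
  qed (simp add: H(1))
  then show ?thesis unfolding Suc sum_list_pred[OF ds, THEN conjunct1] H(1) .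
qed

end



context pre_multisymplectic_manifold
begin

section \<open>Degrees of the brackets\<close>

text \<open>The bracket of two hamiltonian multi-vector fields is hamiltonian: in \<open>[[d, \<iota>\<^sub>x], \<iota>\<^sub>y] \<omega>\<close> all terms other
  than \<open>d \<iota>\<^sub>x \<iota>\<^sub>y \<omega>\<close> contain \<open>d \<omega>\<close>, \<open>d \<iota>\<^sub>x \<omega>\<close> or \<open>d \<iota>\<^sub>y \<omega>\<close>.\<close>

lemma hamiltonian_bracket:
  assumes x: "x \<in> multivector_fields A k" and y: "y \<in> multivector_fields A k'" and kk: "1 \<le> k + k'"
    and 0: "ext_deriv A (contract x \<omega>) = 0" "ext_deriv A (contract y \<omega>) = 0"
  shows "\<exists>v\<in>multivector_fields A (k + k' - 1). contract v \<omega> = ext_deriv A (contract x (contract y \<omega>))"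
proof -
  obtain v where v: "is_schouten k k' x y v" using is_schouten_exists[OF x y kk] by blast
  have lie0: "lie_derivative k x \<omega> = 0"
    unfolding lie_derivative_def 0 closed contract_zero_form[OF x] by (simp only: scale_zero_right diff_self)
  have "contract v \<omega> = lie_derivative k x (contract y \<omega>) - (-1) ^ (Suc k * k') *\<^sub>R contract y (lie_derivative k x \<omega>)"
    using v \<omega> unfolding is_schouten_def by blast
  also have "\<dots> = ext_deriv A (contract x (contract y \<omega>))"
    unfolding lie0 contract_zero_form[OF y] unfolding lie_derivative_def 0 contract_zero_form[OF x]
    by (simp only: scale_zero_right diff_0_right)
  finally show ?thesis using v unfolding is_schouten_def by blast
qed

lemma Xi_all_diff_forms: "a \<in> Xi_all \<Longrightarrow> a i j \<in> diff_forms A (m - i - j)"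
  using Xi_comp_diff_forms[of i j] unfolding Xi_all_def by blast

lemma component_closed: "a \<in> Xi_all \<Longrightarrow> ext_deriv A (ext_deriv A (a i j)) = 0"
  by (rule ext_deriv_ext_deriv[OF Xi_all_diff_forms])

lemma fld_closed: "a \<in> Xi_all \<Longrightarrow> 1 \<le> d \<Longrightarrow> ext_deriv A (contract (fld d a) \<omega>) = 0"
  by (simp only: fld(2) component_closed)

lemma iter_above:
  assumes "fields ks xs" "n < sum_list ks" "\<alpha> \<in> diff_forms A n"
  shows "foldr contract xs \<alpha> = 0"
  using assms(1,2)
proof (induction xs arbitrary: ks)
  case (Cons x xs)
  then obtain k ks' where k: "ks = k # ks'" "x \<in> multivector_fields A k" "fields ks' xs"
    unfolding fields_Cons by blast
  show ?case
  proof (cases "n < sum_list ks'")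
    case True
    show ?thesis unfolding foldr_contract_Cons Cons.IH[OF k(3) True] by (rule contract_zero_form[OF k(2)])
  next
    case False
    show ?thesis unfolding foldr_contract_Cons
      by (rule contract_above[OF k(2) iter_diff_forms[OF k(3) assms(3)]]) (use Cons.prems(2) False in \<open>simp add: k(1)\<close>)
  qed
qed simp

lemma Xi_comp_zero: "0 \<in> Xi_comp A m \<omega> i j"
  by (rule subspace_0[OF subspace_Xi_comp])

text \<open>The point is the passage from the second row to the first: exact forms are hamiltonian, with the zero
  multi-vector field.\<close>

lemma ext_deriv_Xi_comp:
  assumes a: "a \<in> Xi_comp A m \<omega> (Suc i) j" and i: "1 \<le> i"
  shows "- ext_deriv A a \<in> Xi_comp A m \<omega> i j"
proof (cases "Suc i + j \<le> m")
  case True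
  have 1: "Xi_comp A m \<omega> (Suc i) j = diff_forms A (m - Suc i - j)" using True i by (simp add: Xi_comp_def)
  have "Suc (m - Suc i - j) = m - i - j" using True by simp
  then have "ext_deriv A a \<in> diff_forms A (m - i - j)" using ext_deriv_diff_forms[OF a[unfolded 1]] by simp
  then have d: "- ext_deriv A a \<in> diff_forms A (m - i - j)" by (rule subspace_neg[OF subspace_diff_forms])
  show ?thesis
  proof (cases "i = 1")
    case i1: True
    have neg: "- ext_deriv A a = (-1) *\<^sub>R ext_deriv A a + 0 *\<^sub>R ext_deriv A a"
      by (simp only: scaleR_minus_left scaleR_one scale_zero_left add_0_right)
    have "ext_deriv A (- ext_deriv A a) = 0"
      unfolding neg ext_deriv_combination[OF ext_deriv_diff_forms[OF a[unfolded 1]] ext_deriv_diff_forms[OF a[unfolded 1]]]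
        ext_deriv_ext_deriv[OF a[unfolded 1]] by (simp only: scale_zero_right add_0_right)
    then have "hamiltonian_pair A m \<omega> (1 + j) 0 (- ext_deriv A a)"
      unfolding hamiltonian_pair_def contract_zero_field
      using d True i1 subspace_0[OF subspace_multivector_fields] by simp
    moreover have "Xi_comp A m \<omega> i j = ham_forms A m \<omega> (1 + j)" using True i1 by (simp add: Xi_comp_def)
    ultimately show ?thesis unfolding ham_forms_def by blast
  next
    case False
    then have "Xi_comp A m \<omega> i j = diff_forms A (m - i - j)" using i True by (simp add: Xi_comp_def)
    then show ?thesis using d by simp
  qed
next
  case False
  then have "Xi_comp A m \<omega> (Suc i) j = {0}" using i by (simp add: Xi_comp_def)
  then have a0: "a = 0" using a by blast
  have "- ext_deriv A a = 0" unfolding a0 ext_deriv_zero by (rule minus_zero)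
  then show ?thesis using Xi_comp_zero by simp
qed

text \<open>The binary bracket lands in the hamiltonian forms by \<open>hamiltonian_bracket\<close>. Outside the range of \<open>\<Xi>(M)\<close>,
  more vectors are contracted than \<open>\<omega>\<close> has arguments.\<close>

lemma iter_Xi_comp:
  assumes h: "length ds = length as" "set as \<subseteq> Xi_all" and n: "2 \<le> length as" and ds: "\<forall>d\<in>set ds. 1 \<le> d"
  shows "iter ds as \<in> Xi_comp A m \<omega> (length as - 1) (sum_list ds - length as)"
proof -
  let ?n = "length as" and ?J = "sum_list ds - length as"
  have f: "fields ds (flds ds as)" by (rule fields_flds[OF h ds])
  have le: "?n \<le> sum_list ds" using sum_list_pred[OF ds] h(1) by simp
  show ?thesis
  proof (cases "sum_list ds \<le> m + 1")
    case True
    have deg: "m + 1 - sum_list ds = m - (?n - 1) - ?J" using le n by simp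
    have d: "iter ds as \<in> diff_forms A (m - (?n - 1) - ?J)"
      using iter_diff_forms[OF f \<omega>] unfolding deg .
    show ?thesis
    proof (cases "?n = 2")
      case n2: True
      then obtain a b where as: "as = [a, b]" by (auto simp: length_Suc_conv numeral_2_eq_2)
      obtain d1 d2 where dd: "ds = [d1, d2]" using h(1) by (auto simp: as length_Suc_conv)
      have d12: "1 \<le> d1" "1 \<le> d2" and ab: "a \<in> Xi_all" "b \<in> Xi_all" using ds h(2) by (auto simp: as dd)
      have it: "iter ds as = contract (fld d1 a) (contract (fld d2 b) \<omega>)" by (simp add: as dd flds_def)
      obtain v where v: "v \<in> multivector_fields A (d1 + d2 - 1)" "contract v \<omega> = ext_deriv A (iter ds as)"
        using hamiltonian_bracket[OF fld(1)[OF ab(1) d12(1)] fld(1)[OF ab(2) d12(2)] _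
            fld_closed[OF ab(1) d12(1)] fld_closed[OF ab(2) d12(2)]] d12 unfolding it by auto
      have J: "1 + ?J = d1 + d2 - 1" using d12 by (simp add: as dd)
      have "hamiltonian_pair A m \<omega> (1 + ?J) v (iter ds as)"
        unfolding hamiltonian_pair_def using v d True n2 le h(1)
        by (simp only: J[symmetric]) (simp add: dd as diff_diff_left)
      moreover have "?J < m" using True n2 le by simp
      then have "Xi_comp A m \<omega> (?n - 1) ?J = ham_forms A m \<omega> (1 + ?J)"
        using n2 by (simp add: Xi_comp_def)
      ultimately show ?thesis unfolding ham_forms_def by blast
    next
      case False
      then have "?n - 1 \<noteq> 1" "2 \<le> ?n - 1" "?n - 1 + ?J \<le> m" using n True le by simp_all
      then have "Xi_comp A m \<omega> (?n - 1) ?J = diff_forms A (m - (?n - 1) - ?J)"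
        by (simp only: Xi_comp_def simp_thms if_True if_False)
      then show ?thesis using d by simp
    qed
  next
    case False
    have "iter ds as = 0" by (rule iter_above[OF f _ \<omega>]) (use False in simp)
    then show ?thesis using Xi_comp_zero by simp
  qed
qed

lemma in_bidegree_Xi:
  assumes "\<alpha> \<in> Xi_comp A m \<omega> i j"
  shows "in_bidegree i j \<alpha> \<in> Xi A m \<omega> (i + j)"
  unfolding Xi_def
proof (intro CollectI allI)
  fix i' j'
  show "in_bidegree i j \<alpha> i' j' \<in> (if i' + j' = i + j then Xi_comp A m \<omega> i' j' else {0})"
    using assms Xi_comp_zero[of i' j'] by (cases "i' = i \<and> j' = j") (simp_all only: in_bidegree_def simp_thms if_True if_False, simp split: if_split)
qed


section \<open>Multilinearity and symmetry\<close>

lemma bracket_zero_nth: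
  assumes as: "2 \<le> length as" "set as \<subseteq> Xi_all" "0 \<in> set as"
  shows "l as = 0"
proof -
  obtain s where s: "s < length as" "as ! s = 0" using as(3) by (auto simp: in_set_conv_nth)
  have "iter (map Suc js) as = 0" if js: "js \<in> degrees (length as) j" for js j
  proof (rule iter_closed_component[OF _ as(2) _ s(1)])
    show "ext_deriv A ((as ! s) 1 (map Suc js ! s - 1)) = 0" by (simp only: s(2) zero_fun_apply ext_deriv_zero)
  qed (use js in \<open>auto simp: degrees_def\<close>)
  then have "l as i j = 0" for i j
    unfolding bracket_component[OF as(1,2)] by (simp only: sum.neutral_const if_cancel cong: sum.cong)
  then show ?thesis by (intro ext) (simp only: zero_fun_apply)
qed

lemma bracket_zero:
  assumes as: "as \<noteq> []" "set as \<subseteq> Xi_all" "0 \<in> set as"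
  shows "l as = 0"
proof (cases "2 \<le> length as")
  case True
  then show ?thesis by (rule bracket_zero_nth[OF _ as(2,3)])
next
  case False
  have "as = [0]" using as False by (cases as; cases "tl as") auto
  moreover have "l [0] i j = 0" for i j
    by (simp only: bracket_single zero_fun_apply ext_deriv_zero minus_zero if_cancel)
  ultimately show ?thesis by (intro ext) (simp only: zero_fun_apply)
qed

lemma bracket_degree:
  assumes h: "homogeneous (Xi A m \<omega>) ds as" and ne: "as \<noteq> []"
  shows "l as \<in> Xi A m \<omega> (sum_list ds - 1)"
proof -
  note H = homogeneousD[OF h]
  show ?thesis
  proof (cases "\<forall>d\<in>set ds. 1 \<le> d")
    case False
    then obtain s where "s < length ds" "ds ! s = 0" unfolding in_set_conv_nth Ball_def by (auto simp: not_le)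
    then have "as ! s = 0" "s < length as" using H(3)[of s] H(1) Xi_0 by simp_all
    then have "0 \<in> set as" by (metis nth_mem)
    from bracket_zero[OF ne H(2) this] show ?thesis using subspace_0[OF subspace_Xi] by simp
  next
    case True
    show ?thesis
    proof (cases "2 \<le> length as")
      case n: True
      have "length as \<le> sum_list ds" using sum_list_pred[OF True] H(1) by simp
      then have "length as - 1 + (sum_list ds - length as) = sum_list ds - 1" using n by simp
      then show ?thesis
        using in_bidegree_Xi[OF iter_Xi_comp[OF H(1,2) n True]] bracket_homogeneous[OF h n True] by simp
    next
      case False
      then obtain a where as: "as = [a]" using ne by (cases as; cases "tl as") auto
      obtain d where ds: "ds = [d]" using H(1) by (auto simp: as length_Suc_conv)
      have a: "a \<in> Xi A m \<omega> d" and d: "1 \<le> d" using H(3)[of 0] True by (simp_all add: as ds)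
      have "l [a] i j \<in> (if i + j = d - 1 then Xi_comp A m \<omega> i j else {0})" for i j
      proof (cases "1 \<le> i \<and> Suc i + j = d")
        case True
        then have "a (Suc i) j \<in> Xi_comp A m \<omega> (Suc i) j" "i + j = d - 1" using Xi_component[OF a, of "Suc i" j] by auto
        then show ?thesis using ext_deriv_Xi_comp True unfolding bracket_single by simp
      next
        case False
        have "l [a] i j = 0"
        proof (cases "1 \<le> i")
          case True
          then have 0: "a (Suc i) j = 0" using False by (intro Xi_component_zero[OF a]) simp
          show ?thesis unfolding bracket_single 0 ext_deriv_zero by (simp only: minus_zero if_cancel)
        qed (simp only: bracket_single if_False)
        then show ?thesis using Xi_comp_zero[of i j] by (simp only: insertI1 split: if_split) simp
      qed
      then show ?thesis unfolding Xi_def as ds by simp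
    qed
  qed
qed

text \<open>The hamiltonian multi-vector fields that are chosen by \<open>fld\<close> need not depend linearly on the forms. But
  after moving the one in question next to \<open>\<omega>\<close>, only \<open>d\<close> of the form is left of it.\<close>

lemma iter_combination_slot:
  assumes us: "set us \<subseteq> Xi_all" and ws: "set ws \<subseteq> Xi_all" and x: "x \<in> Xi_all" and y: "y \<in> Xi_all"
    and len: "length ds = length us + Suc (length ws)" and ds: "\<forall>d\<in>set ds. 1 \<le> d"
  shows "iter ds (us @ (a *\<^sub>R x + b *\<^sub>R y) # ws) = a *\<^sub>R iter ds (us @ x # ws) + b *\<^sub>R iter ds (us @ y # ws)"
proof -
  obtain ds1 d ds2 where dd: "ds = ds1 @ d # ds2" "length ds1 = length us" "length ds2 = length ws"
  proof
    show "ds = take (length us) ds @ ds ! length us # drop (Suc (length us)) ds" using len by (intro id_take_nth_drop) simp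
  qed (use len in simp_all)
  have d: "1 \<le> d" "\<forall>d\<in>set ds1. 1 \<le> d" "\<forall>d\<in>set ds2. 1 \<le> d" using ds by (auto simp: dd(1))
  note f1 = fields_flds[OF dd(2) us d(2)] and f2 = fields_flds[OF dd(3) ws d(3)]
  have f12: "fields (ds1 @ ds2) (flds ds1 us @ flds ds2 ws)"
    using f1 f2 unfolding fields_def by (intro list_all2_appendI)
  define c :: real where "c = (-1) ^ (d * sum_list ds2)"
  let ?R = "foldr contract (flds ds1 us @ flds ds2 ws)"
  have it: "iter ds (us @ z # ws) = c *\<^sub>R ?R (ext_deriv A (z 1 (d - 1)))" if z: "z \<in> Xi_all" for z
  proof -
    have "flds ds (us @ z # ws) = flds ds1 us @ fld d z # flds ds2 ws" by (simp add: flds_def dd)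
    then show ?thesis
      using iter_move[OF f1 fld(1)[OF z d(1)] f2 \<omega>] by (simp only: c_def fld(2)[OF z d(1)])
  qed
  have xyA: "a *\<^sub>R x + b *\<^sub>R y \<in> Xi_all"
    by (intro subspace_add[OF subspace_Xi_all] subspace_scale[OF subspace_Xi_all] x y)
  have xyd: "x 1 (d - 1) \<in> diff_forms A (m - 1 - (d - 1))" "y 1 (d - 1) \<in> diff_forms A (m - 1 - (d - 1))"
    by (rule Xi_all_diff_forms[OF x], rule Xi_all_diff_forms[OF y])
  have "(a *\<^sub>R x + b *\<^sub>R y) 1 (d - 1) = a *\<^sub>R x 1 (d - 1) + b *\<^sub>R y 1 (d - 1)"
    by (simp only: plus_fun_apply scaleR_fun_apply)
  then have "?R (ext_deriv A ((a *\<^sub>R x + b *\<^sub>R y) 1 (d - 1)))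
      = a *\<^sub>R ?R (ext_deriv A (x 1 (d - 1))) + b *\<^sub>R ?R (ext_deriv A (y 1 (d - 1)))"
    by (simp only: ext_deriv_combination[OF xyd]
        iter_combination[OF f12 ext_deriv_diff_forms[OF xyd(1)] ext_deriv_diff_forms[OF xyd(2)]])
  then show ?thesis
    unfolding it[OF x] it[OF y] it[OF xyA] by (simp only: scaleR_add_right scaleR_scaleR mult.commute)
qed

lemma bracket_multilinear_aux:
  assumes us: "set us \<subseteq> Xi_all" and ws: "set ws \<subseteq> Xi_all" and x: "x \<in> Xi_all" and y: "y \<in> Xi_all"
  shows "l (us @ (a *\<^sub>R x + b *\<^sub>R y) # ws) i j = a *\<^sub>R l (us @ x # ws) i j + b *\<^sub>R l (us @ y # ws) i j"
proof (cases "us = [] \<and> ws = []")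
  case True
  have d: "x (Suc i) j \<in> diff_forms A (m - Suc i - j)" "y (Suc i) j \<in> diff_forms A (m - Suc i - j)"
    by (rule Xi_all_diff_forms[OF x], rule Xi_all_diff_forms[OF y])
  have e: "us @ z # ws = [z]" for z using True by simp
  show ?thesis
  proof (cases "1 \<le> i")
    case True
    then show ?thesis unfolding e bracket_single
      by (simp only: if_True plus_fun_apply scaleR_fun_apply ext_deriv_combination[OF d] minus_add_distrib scaleR_minus_right)
  qed (simp only: e bracket_single if_False scale_zero_right add_0_right)
next
  case False
  have xyA: "a *\<^sub>R x + b *\<^sub>R y \<in> Xi_all"
    by (intro subspace_add[OF subspace_Xi_all] subspace_scale[OF subspace_Xi_all] x y)
  let ?n = "length us + Suc (length ws)"
  have n: "length (us @ z # ws) = ?n" for z by simp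
  have n2: "2 \<le> ?n" using False by (cases us; cases ws) auto
  have c: "l (us @ z # ws) i j = (if i = ?n - 1 then \<Sum>js\<in>degrees ?n j. iter (map Suc js) (us @ z # ws) else 0)"
    if z: "z \<in> Xi_all" for z
    using bracket_component[of "us @ z # ws" i j] n2 us ws z unfolding n by simp
  show ?thesis
  proof (cases "i = ?n - 1")
    case True
    have "(\<Sum>js\<in>degrees ?n j. iter (map Suc js) (us @ (a *\<^sub>R x + b *\<^sub>R y) # ws))
        = (\<Sum>js\<in>degrees ?n j. a *\<^sub>R iter (map Suc js) (us @ x # ws) + b *\<^sub>R iter (map Suc js) (us @ y # ws))"
      by (rule sum.cong[OF refl], rule iter_combination_slot[OF us ws x y]) (auto simp: degrees_def)
    then show ?thesis unfolding c[OF x] c[OF y] c[OF xyA]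
      by (simp only: True if_True simp_thms sum.distrib scaleR_sum_right)
  next
    case False
    then show ?thesis unfolding c[OF x] c[OF y] c[OF xyA] by (simp only: if_False scale_zero_right add_0_right)
  qed
qed

lemma bracket_multilinear: "multilinear_on (total_space (Xi A m \<omega>)) l"
  unfolding multilinear_on_def
proof (intro allI impI)
  fix us ws x y a b
  assume "set us \<subseteq> total_space (Xi A m \<omega>)" "set ws \<subseteq> total_space (Xi A m \<omega>)"
    "x \<in> total_space (Xi A m \<omega>)" "y \<in> total_space (Xi A m \<omega>)"
  then have "set us \<subseteq> Xi_all" "set ws \<subseteq> Xi_all" "x \<in> Xi_all" "y \<in> Xi_all"
    using total_space_subset by blast+
  note * = bracket_multilinear_aux[OF this]
  show "l (us @ (a *\<^sub>R x + b *\<^sub>R y) # ws) = a *\<^sub>R l (us @ x # ws) + b *\<^sub>R l (us @ y # ws)"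
    by (rule ext, rule ext) (simp only: plus_fun_apply scaleR_fun_apply *)
qed

lemma length_permute_by [simp]: "length (permute_by \<sigma> rs xs) = length rs"
  by (simp add: permute_by_def)

lemma set_permute_by:
  assumes "\<sigma> permutes {..<length zs}"
  shows "set (permute_by \<sigma> [0..<length zs] zs) = set zs"
proof -
  have "set (permute_by \<sigma> [0..<length zs] zs) = (!) zs ` (\<sigma> ` {..<length zs})"
    by (simp add: permute_by_def image_image atLeast0LessThan)
  also have "\<dots> = (!) zs ` {..<length zs}" unfolding permutes_image[OF assms] ..
  also have "\<dots> = set zs" by (auto simp: in_set_conv_nth)
  finally show ?thesis .
qed

lemma homogeneous_permute_by:
  assumes "homogeneous L ds xs" "\<And>r. r \<in> set rs \<Longrightarrow> \<sigma> r < length xs"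
  shows "homogeneous L (permute_by \<sigma> rs ds) (permute_by \<sigma> rs xs)"
proof -
  have "xs ! \<sigma> r \<in> L (ds ! \<sigma> r)" if "r \<in> set rs" for r
    using assms(1) assms(2)[OF that] by (simp add: homogeneous_def list_all2_conv_all_nth)
  then show ?thesis by (simp add: homogeneous_def permute_by_def list_all2_conv_all_nth)
qed

lemma flds_permute_by:
  assumes "length ds = length xs" "\<And>r. r \<in> set rs \<Longrightarrow> \<sigma> r < length xs"
  shows "flds (permute_by \<sigma> rs ds) (permute_by \<sigma> rs xs) = permute_by \<sigma> rs (flds ds xs)"
  using assms(2) by (induction rs) (simp_all add: flds_def permute_by_def assms(1))

lemma sum_list_permute_by:
  assumes "\<sigma> permutes {..<length ds}"
  shows "sum_list (permute_by \<sigma> [0..<length ds] ds) = (sum_list ds :: nat)"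
proof -
  have "sum_list (permute_by \<sigma> [0..<length ds] ds) = (\<Sum>r<length ds. ds ! \<sigma> r)"
    by (simp add: permute_by_def sum_list_sum_nth atLeast0LessThan)
  also have "\<dots> = (\<Sum>r<length ds. ds ! r)" by (rule sum.permute[OF assms, unfolded o_def, symmetric])
  finally show ?thesis by (simp add: sum_list_sum_nth atLeast0LessThan)
qed

lemma zero_degree_element:
  assumes "homogeneous (Xi A m \<omega>) ds xs" "\<not> (\<forall>d\<in>set ds. 1 \<le> d)"
  obtains s where "s < length xs" "xs ! s = 0"
proof -
  note H = homogeneousD[OF assms(1)]
  obtain d where "d \<in> set ds" "\<not> 1 \<le> d" using assms(2) by blast
  then obtain s where s: "s < length ds" "ds ! s = 0" by (auto simp: in_set_conv_nth)
  then have "xs ! s = 0" using H(3)[of s] H(1) by (intro Xi_0) simp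
  then show ?thesis using that s(1) H(1) by simp
qed

lemma bracket_symmetric:
  assumes h: "homogeneous (Xi A m \<omega>) ds xs" and ne: "xs \<noteq> []" and \<sigma>: "\<sigma> permutes {..<length xs}"
  shows "l xs = koszul_sign ds \<sigma> *\<^sub>R l (permute_by \<sigma> [0..<length xs] xs)"
proof -
  note H = homogeneousD[OF h]
  let ?n = "length xs" and ?ys = "permute_by \<sigma> [0..<length xs] xs" and ?es = "permute_by \<sigma> [0..<length xs] ds"
  have \<sigma>n: "\<sigma> r < ?n" if "r \<in> set [0..<?n]" for r using permutes_in_image[OF \<sigma>, of r] that by simp
  have hp: "homogeneous (Xi A m \<omega>) ?es ?ys" by (rule homogeneous_permute_by[OF h \<sigma>n])
  have sets: "set ?ys = set xs" "set ?es = set ds"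
    using set_permute_by[OF \<sigma>] set_permute_by[of \<sigma> ds] \<sigma> H(1) by simp_all
  consider "\<not> (\<forall>d\<in>set ds. 1 \<le> d)" | "\<forall>d\<in>set ds. 1 \<le> d" "2 \<le> ?n" | "?n = 1" using ne by (cases xs; cases "tl xs") auto
  then show ?thesis
  proof cases
    case 1
    obtain s where "s < ?n" "xs ! s = 0" by (rule zero_degree_element[OF h 1])
    then have z: "0 \<in> set xs" by (metis nth_mem)
    have "?ys \<noteq> []" using ne by (simp add: permute_by_def)
    then have "l ?ys = 0" by (rule bracket_zero) (use sets H(2) z in auto)
    then show ?thesis using bracket_zero[OF ne H(2) z] by (simp only: scale_zero_right)
  next
    case 2
    have "iter ds xs = koszul_sign ds \<sigma> *\<^sub>R foldr contract (permute_by \<sigma> [0..<length (flds ds xs)] (flds ds xs)) \<omega>"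
      by (rule iter_permute[OF fields_flds[OF H(1,2) 2(1)] \<omega>]) (use \<sigma> in \<open>simp add: length_flds H(1)\<close>)
    also have "permute_by \<sigma> [0..<length (flds ds xs)] (flds ds xs) = flds ?es ?ys"
      unfolding length_flds[OF H(1)] by (rule flds_permute_by[OF H(1), symmetric]) (rule \<sigma>n)
    finally have it: "iter ds xs = koszul_sign ds \<sigma> *\<^sub>R iter ?es ?ys" .
    have "l ?ys = in_bidegree (?n - 1) (sum_list ds - ?n) (iter ?es ?ys)"
      using bracket_homogeneous[OF hp] 2 sets sum_list_permute_by[of \<sigma> ds] \<sigma> H(1) by simp
    then show ?thesis unfolding bracket_homogeneous[OF h 2(2,1)] it in_bidegree_scale by (simp only:)
  next
    case 3
    then have id: "\<sigma> = id" using \<sigma> permutes_superset by (intro no_inversions_id[OF \<sigma>]) auto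
    have "inversions (length ds) id = {}" by auto
    then have k1: "koszul_sign ds id = 1" unfolding koszul_sign_def by (simp only: prod.empty)
    have "permute_by id [0..<?n] xs = xs" by (simp add: permute_by_def map_nth)
    then show ?thesis unfolding id k1 by (simp only: scaleR_one)
  qed
qed

end



context pre_multisymplectic_manifold
begin

section \<open>The generalized Jacobi identity\<close>

lemma shuffles_permD:
  assumes "\<sigma> \<in> shuffles_perm i (n - i)" "i \<le> n"
  shows "\<sigma> permutes {..<n}" "\<And>r. r < n \<Longrightarrow> \<sigma> r < n"
proof -
  have "i + (n - i) = n" using assms(2) by simp
  then show p: "\<sigma> permutes {..<n}" using assms(1) unfolding shuffles_perm_def by simp
  show "\<And>r. r < n \<Longrightarrow> \<sigma> r < n" using permutes_in_image[OF p] by simp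
qed

lemma permute_by_append: "permute_by \<sigma> rs xs @ permute_by \<sigma> ts xs = permute_by \<sigma> (rs @ ts) xs"
  by (simp add: permute_by_def)

lemma split_range: "i \<le> n \<Longrightarrow> [0..<i] @ [i..<n] = [0..<n]"
  using upt_add_eq_append[of 0 i "n - i"] by simp

context
  fixes ds xs assumes h: "homogeneous (Xi A m \<omega>) ds xs" and ne: "xs \<noteq> []"
begin

abbreviation (input) front :: "nat \<Rightarrow> (nat \<Rightarrow> nat) \<Rightarrow> 'z list \<Rightarrow> 'z list" where
  "front i \<sigma> zs \<equiv> permute_by \<sigma> [0..<i] zs"

abbreviation (input) rear :: "nat \<Rightarrow> (nat \<Rightarrow> nat) \<Rightarrow> 'z list \<Rightarrow> 'z list" where
  "rear i \<sigma> zs \<equiv> permute_by \<sigma> [i..<length xs] zs"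

lemmas H = homogeneousD[OF h]

lemma parts:
  assumes i: "1 \<le> i" "i \<le> length xs" and \<sigma>: "\<sigma> \<in> shuffles_perm i (length xs - i)"
  shows "homogeneous (Xi A m \<omega>) (front i \<sigma> ds) (front i \<sigma> xs)" "front i \<sigma> xs \<noteq> []"
    "homogeneous (Xi A m \<omega>) (rear i \<sigma> ds) (rear i \<sigma> xs)"
    "l (front i \<sigma> xs) \<in> Xi A m \<omega> (sum_list (front i \<sigma> ds) - 1)"
    "homogeneous (Xi A m \<omega>) ((sum_list (front i \<sigma> ds) - 1) # rear i \<sigma> ds) (l (front i \<sigma> xs) # rear i \<sigma> xs)"
    "set (front i \<sigma> xs) \<union> set (rear i \<sigma> xs) = set xs" "set (front i \<sigma> ds) \<union> set (rear i \<sigma> ds) = set ds"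
    "sum_list (front i \<sigma> ds) + sum_list (rear i \<sigma> ds) = sum_list ds"
proof -
  note \<sigma>D = shuffles_permD[OF \<sigma> i(2)]
  show f: "homogeneous (Xi A m \<omega>) (front i \<sigma> ds) (front i \<sigma> xs)"
    by (rule homogeneous_permute_by[OF h]) (use \<sigma>D(2) i in auto)
  show fne: "front i \<sigma> xs \<noteq> []" using i by (simp add: permute_by_def)
  show b: "homogeneous (Xi A m \<omega>) (rear i \<sigma> ds) (rear i \<sigma> xs)"
    by (rule homogeneous_permute_by[OF h]) (use \<sigma>D(2) i in auto)
  show lf: "l (front i \<sigma> xs) \<in> Xi A m \<omega> (sum_list (front i \<sigma> ds) - 1)" by (rule bracket_degree[OF f fne])
  show "homogeneous (Xi A m \<omega>) ((sum_list (front i \<sigma> ds) - 1) # rear i \<sigma> ds) (l (front i \<sigma> xs) # rear i \<sigma> xs)"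
    using lf b by (simp add: homogeneous_def)
  have p': "front i \<sigma> zs @ rear i \<sigma> zs = permute_by \<sigma> [0..<length xs] zs" for zs :: "nat list"
    unfolding permute_by_append split_range[OF i(2)] ..
  have px: "front i \<sigma> xs @ rear i \<sigma> xs = permute_by \<sigma> [0..<length xs] xs"
    unfolding permute_by_append split_range[OF i(2)] ..
  show "set (front i \<sigma> xs) \<union> set (rear i \<sigma> xs) = set xs"
    unfolding set_append[symmetric] px by (rule set_permute_by[OF \<sigma>D(1)])
  show "set (front i \<sigma> ds) \<union> set (rear i \<sigma> ds) = set ds"
    unfolding set_append[symmetric] p' using set_permute_by[of \<sigma> ds] \<sigma>D(1) H(1) by simp
  show "sum_list (front i \<sigma> ds) + sum_list (rear i \<sigma> ds) = sum_list ds"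
    unfolding sum_list_append[symmetric] p' using sum_list_permute_by[of \<sigma> ds] \<sigma>D(1) H(1) by simp
qed

lemma composite_zero_element:
  assumes i: "1 \<le> i" "i \<le> length xs" and \<sigma>: "\<sigma> \<in> shuffles_perm i (length xs - i)" and z: "0 \<in> set xs"
  shows "l (l (front i \<sigma> xs) # rear i \<sigma> xs) = 0"
proof -
  note P = parts[OF i \<sigma>]
  have "0 \<in> set (l (front i \<sigma> xs) # rear i \<sigma> xs)"
  proof (cases "0 \<in> set (front i \<sigma> xs)")
    case True
    have "l (front i \<sigma> xs) = 0" by (rule bracket_zero[OF P(2) homogeneousD(2)[OF P(1)] True])
    then show ?thesis by simp
  next
    case False
    then show ?thesis using P(6) z by auto
  qed
  then show ?thesis by (intro bracket_zero homogeneousD(2)[OF P(5)]) simp_all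
qed

text \<open>The compositions of brackets with an inner bracket of arity other than \<open>2\<close> and \<open>n\<close> vanish: an
  inner bracket of arity \<open>1\<close> yields an exact form, of which the hamiltonian multi-vector field can be
  taken to be zero, and one of arity at least \<open>3\<close> takes its values outside the first row.\<close>

lemma composite_zero:
  assumes i: "1 \<le> i" "i < length xs" "i \<noteq> 2" and \<sigma>: "\<sigma> \<in> shuffles_perm i (length xs - i)"
    and ds: "\<forall>d\<in>set ds. 1 \<le> d"
  shows "l (l (front i \<sigma> xs) # rear i \<sigma> xs) = 0"
proof -
  have i': "i \<le> length xs" using i by simp
  note P = parts[OF i(1) i' \<sigma>]
  let ?b = "l (front i \<sigma> xs)" and ?d = "sum_list (front i \<sigma> ds) - 1"
  let ?as = "?b # rear i \<sigma> xs" and ?es = "?d # rear i \<sigma> ds"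
  have len: "2 \<le> length ?as" using i by (simp add: permute_by_def)
  note HP = homogeneousD[OF P(5)]
  have b_Xi: "?b \<in> Xi_all" using HP(2) by simp
  show ?thesis
  proof (cases "?d = 0")
    case True
    then have "?b = 0" using P(4) Xi_0 by metis
    then show ?thesis by (intro bracket_zero[OF _ HP(2)]) simp_all
  next
    case False
    then have es: "\<forall>d\<in>set ?es. 1 \<le> d" using P(7) ds by auto
    have "ext_deriv A (?b 1 (?d - 1)) = 0"
    proof (cases "i = 1")
      case True
      define a where "a = xs ! \<sigma> 0"
      have a: "front i \<sigma> xs = [a]" unfolding True a_def by (simp add: permute_by_def)
      have aX: "a \<in> Xi_all" using homogeneousD(2)[OF P(1)] by (simp add: a)
      have b: "?b 1 j = (-1) *\<^sub>R ext_deriv A (a 2 j) + 0 *\<^sub>R ext_deriv A (a 2 j)" for j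
        unfolding a bracket_single by (simp only: numeral_2_eq_2 One_nat_def order_refl if_True scaleR_minus_left scaleR_one scale_zero_left add_0_right)
      note e = ext_deriv_diff_forms[OF Xi_all_diff_forms[OF aX]]
      show ?thesis unfolding b ext_deriv_combination[OF e e] component_closed[OF aX]
        by (simp only: scale_zero_right add_0_right)
    next
      case False
      then have "2 \<le> length (front i \<sigma> xs)" "1 \<noteq> length (front i \<sigma> xs) - 1" using i by auto
      then have "?b 1 j = 0" for j
        using bracket_component[OF _ homogeneousD(2)[OF P(1)], of 1 j] by (simp only: if_False)
      then show ?thesis by (simp only: ext_deriv_zero)
    qed
    then have "iter ?es ?as = 0"
      by (intro iter_closed_component[OF HP(1,2) es, of 0]) simp_all
    then show ?thesis unfolding bracket_homogeneous[OF P(5) len es] by (simp only: in_bidegree_zero)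
  qed
qed

text \<open>The outer bracket contracts with a hamiltonian multi-vector field of \<open>l\<^sub>2\<close> of the first two elements and
  with the fields of the remaining ones.\<close>

lemma composite_pair:
  assumes n: "3 \<le> length xs" and \<sigma>: "\<sigma> \<in> shuffles_perm 2 (length xs - 2)" and ds: "\<forall>d\<in>set ds. 1 \<le> d"
  shows "l (l (front 2 \<sigma> xs) # rear 2 \<sigma> xs) = in_bidegree (length xs - 2) (sum_list ds - length xs)
      (contract (fld (ds ! \<sigma> 0 + ds ! \<sigma> 1 - 1) (l [xs ! \<sigma> 0, xs ! \<sigma> 1]))
        (foldr contract (nths (flds ds xs) (- {\<sigma> 0, \<sigma> 1})) \<omega>))"
proof -
  have i: "1 \<le> (2::nat)" "2 \<le> length xs" using n by simp_all
  note P = parts[OF i \<sigma>]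
  have up: "[0..<2] = [0, 1]" by (simp add: upt_rec)
  have fx: "front 2 \<sigma> xs = [xs ! \<sigma> 0, xs ! \<sigma> 1]" and fd: "sum_list (front 2 \<sigma> ds) = ds ! \<sigma> 0 + ds ! \<sigma> 1"
    by (simp_all add: permute_by_def up)
  let ?d = "ds ! \<sigma> 0 + ds ! \<sigma> 1 - 1" and ?b = "l [xs ! \<sigma> 0, xs ! \<sigma> 1]"
  have P5: "homogeneous (Xi A m \<omega>) (?d # rear 2 \<sigma> ds) (?b # rear 2 \<sigma> xs)" using P(5) unfolding fx fd .
  have pos: "1 \<le> ds ! \<sigma> r" if "r < length xs" for r using ds shuffles_permD(2)[OF \<sigma> i(2) that] H(1) by simp
  have d1: "1 \<le> ?d" proof -
    have "1 \<le> ds ! \<sigma> 0" "1 \<le> ds ! \<sigma> 1" by (rule pos, use n in linarith)+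
    then show ?thesis by linarith
  qed
  have es: "\<forall>d\<in>set (?d # rear 2 \<sigma> ds). 1 \<le> d" using P(7) ds d1 by auto
  have len: "2 \<le> length (?b # rear 2 \<sigma> xs)" using n by simp
  have F: "flds (rear 2 \<sigma> ds) (rear 2 \<sigma> xs) = nths (flds ds xs) (- {\<sigma> 0, \<sigma> 1})"
    unfolding permute_by_shuffle_rest[OF \<sigma> i(2) length_flds[OF H(1)], symmetric]
    by (rule flds_permute_by[OF H(1)]) (use shuffles_permD(2)[OF \<sigma> i(2)] in simp)
  have it: "iter (?d # rear 2 \<sigma> ds) (?b # rear 2 \<sigma> xs)
      = contract (fld ?d ?b) (foldr contract (nths (flds ds xs) (- {\<sigma> 0, \<sigma> 1})) \<omega>)"
    unfolding F[symmetric] by (simp add: flds_def)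
  have e1: "length (?b # rear 2 \<sigma> xs) - 1 = length xs - 2" using n by simp
  have e2: "sum_list (?d # rear 2 \<sigma> ds) - length (?b # rear 2 \<sigma> xs) = sum_list ds - length xs"
    using P(8) d1 n unfolding fd by simp
  show ?thesis unfolding fx bracket_homogeneous[OF P5 len es] it e1 e2 ..
qed

text \<open>An element of degree \<open>0\<close> is zero and makes all terms vanish. Otherwise only the arities \<open>2\<close> and \<open>n\<close> of the
  inner bracket remain, and for \<open>n \<ge> 3\<close> they cancel by \<open>ext_deriv_iter\<close>.\<close>

lemma jacobi:
  "(\<Sum>i\<in>{1..length xs}. \<Sum>\<sigma>\<in>shuffles_perm i (length xs - i). koszul_sign ds \<sigma> *\<^sub>R
     l (l (permute_by \<sigma> [0..<i] xs) # permute_by \<sigma> [i..<length xs] xs)) = 0" (is "(\<Sum>i\<in>?I. ?T i) = 0")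
proof (cases "\<forall>d\<in>set ds. 1 \<le> d")
  case False
  obtain s where "s < length xs" "xs ! s = 0" by (rule zero_degree_element[OF h False])
  then have z: "0 \<in> set xs" by (metis nth_mem)
  show ?thesis
  proof (intro sum.neutral ballI)
    fix i \<sigma> assume "i \<in> ?I" "\<sigma> \<in> shuffles_perm i (length xs - i)"
    then show "koszul_sign ds \<sigma> *\<^sub>R l (l (front i \<sigma> xs) # rear i \<sigma> xs) = 0"
      using composite_zero_element[OF _ _ _ z] by (simp only: atLeastAtMost_iff scale_zero_right)
  qed
next
  case ds: True
  let ?n = "length xs"
  have T0: "?T i = 0" if "1 \<le> i" "i < ?n" "i \<noteq> 2" for i
  proof (intro sum.neutral ballI)
    fix \<sigma> assume "\<sigma> \<in> shuffles_perm i (?n - i)"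
    then show "koszul_sign ds \<sigma> *\<^sub>R l (l (front i \<sigma> xs) # rear i \<sigma> xs) = 0"
      using composite_zero[OF that _ ds] by (simp only: scale_zero_right)
  qed
  have n1: "1 \<le> ?n" using ne by (cases xs) auto
  have Tn: "?T ?n = l [l xs]"
  proof -
    have "shuffles_perm ?n (?n - ?n) = {id}"
    proof
      show "shuffles_perm ?n (?n - ?n) \<subseteq> {id}"
      proof
        fix \<sigma> assume \<sigma>: "\<sigma> \<in> shuffles_perm ?n (?n - ?n)"
        have mono: "strict_mono_on {..<?n} \<sigma>" using \<sigma> unfolding shuffles_perm_def by blast
        have "\<not> \<sigma> s < \<sigma> r" if "r < s" "s < ?n" for r s
          using strict_mono_onD[OF mono, of r s] that by simp
        then have "inversions ?n \<sigma> = {}" by blast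
        then show "\<sigma> \<in> {id}" using no_inversions_id[OF shuffles_permD(1)[OF \<sigma> order_refl]] by blast
      qed
      show "{id} \<subseteq> shuffles_perm ?n (?n - ?n)"
        unfolding shuffles_perm_def by (simp add: permutes_id strict_mono_on_def)
    qed
    then have "?T ?n = koszul_sign ds id *\<^sub>R l (l (front ?n id xs) # rear ?n id xs)"
      by (simp only: sum.insert[OF finite.emptyI] sum.empty empty_iff not_False_eq_True add_0_right)
    moreover have "inversions (length ds) id = {}" by auto
    then have "koszul_sign ds id = 1" unfolding koszul_sign_def by (simp only: prod.empty)
    moreover have "front ?n id xs = xs" "rear ?n id xs = []" by (simp_all add: permute_by_def map_nth)
    ultimately show ?thesis by (simp only: scaleR_one)
  qed
  consider "?n = 1" | "?n = 2" | "3 \<le> ?n" using n1 by linarith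
  then show ?thesis
  proof cases
    case 1
    then obtain a where a: "xs = [a]" by (auto simp: length_Suc_conv)
    have aX: "a \<in> Xi_all" using H(2) by (simp add: a)
    have "l [l [a]] i j = 0" for i j
    proof (cases "1 \<le> i")
      case True
      have b: "l [a] (Suc i) j = (-1) *\<^sub>R ext_deriv A (a (Suc (Suc i)) j) + 0 *\<^sub>R ext_deriv A (a (Suc (Suc i)) j)"
        using True unfolding bracket_single
        by (simp only: le_SucI if_True scaleR_minus_left scaleR_one scale_zero_left add_0_right)
      note e = ext_deriv_diff_forms[OF Xi_all_diff_forms[OF aX]]
      show ?thesis
        unfolding bracket_single[of "l [a]"] b ext_deriv_combination[OF e e] component_closed[OF aX]
        by (simp only: scale_zero_right add_0_right minus_zero if_cancel)
    qed (simp only: bracket_single if_False)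
    then have "l [l xs] = 0" unfolding a by (intro ext) (simp only: zero_fun_apply)
    moreover have "{1..?n} = {?n}" using 1 by simp
    ultimately show ?thesis using Tn by (simp only: sum.insert[OF finite.emptyI] sum.empty empty_iff not_False_eq_True add_0_right)
  next
    case 2
    have hom: "l xs = in_bidegree 1 (sum_list ds - 2) (iter ds xs)"
      using bracket_homogeneous[OF h _ ds] 2 by simp
    have "l [l xs] i j = 0" for i j
    proof (cases "1 \<le> i")
      case True
      then have "l xs (Suc i) j = 0" unfolding hom in_bidegree_def by simp
      then show ?thesis by (simp only: bracket_single ext_deriv_zero minus_zero if_cancel)
    qed (simp only: bracket_single if_False)
    then have l0: "l [l xs] = 0" by (intro ext) (simp only: zero_fun_apply)
    have "?T i = 0" if "i \<in> ?I" for i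
    proof (cases "i = ?n")
      case True
      show ?thesis unfolding True by (simp only: Tn l0)
    next
      case False
      then show ?thesis using that 2 by (intro T0) auto
    qed
    then show ?thesis by (rule sum.neutral[OF ballI])
  next
    case 3
    let ?J = "sum_list ds - ?n"
    let ?F = "flds ds xs"
    let ?V = "\<lambda>i j. fld (ds ! i + ds ! j - 1) (l [xs ! i, xs ! j])"
    have fF: "fields ds ?F" by (rule fields_flds[OF H(1,2) ds])
    have T2: "?T 2 = in_bidegree (?n - 2) ?J (ext_deriv A (iter ds xs))"
    proof -
      have "?T 2 = (\<Sum>\<sigma>\<in>shuffles_perm 2 (?n - 2). in_bidegree (?n - 2) ?J
          (pair_sign ds (\<sigma> 0) (\<sigma> 1) *\<^sub>R contract (?V (\<sigma> 0) (\<sigma> 1)) (foldr contract (nths ?F (- {\<sigma> 0, \<sigma> 1})) \<omega>)))"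
      proof (rule sum.cong[OF refl])
        fix \<sigma> assume \<sigma>: "\<sigma> \<in> shuffles_perm 2 (?n - 2)"
        have "koszul_sign ds \<sigma> = pair_sign ds (\<sigma> 0) (\<sigma> 1)" by (rule koszul_sign_shuffle_2[OF \<sigma>]) (use 3 H(1) in simp_all)
        then show "koszul_sign ds \<sigma> *\<^sub>R l (l (front 2 \<sigma> xs) # rear 2 \<sigma> xs) = in_bidegree (?n - 2) ?J
          (pair_sign ds (\<sigma> 0) (\<sigma> 1) *\<^sub>R contract (?V (\<sigma> 0) (\<sigma> 1)) (foldr contract (nths ?F (- {\<sigma> 0, \<sigma> 1})) \<omega>))"
          by (simp only: composite_pair[OF 3 \<sigma> ds] in_bidegree_scale)
      qed
      also have "\<dots> = (\<Sum>j<?n. \<Sum>i<j. in_bidegree (?n - 2) ?J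
          (pair_sign ds i j *\<^sub>R contract (?V i j) (foldr contract (nths ?F (- {i, j})) \<omega>)))"
        using sum_shuffles_perm_2[of ?n "\<lambda>i j. in_bidegree (?n - 2) ?J
          (pair_sign ds i j *\<^sub>R contract (?V i j) (foldr contract (nths ?F (- {i, j})) \<omega>))"] 3 by simp
      also have "\<dots> = in_bidegree (?n - 2) ?J (\<Sum>j<length ?F. \<Sum>i<j.
          pair_sign ds i j *\<^sub>R contract (?V i j) (foldr contract (nths ?F (- {i, j})) \<omega>))"
        by (simp only: in_bidegree_sum length_flds[OF H(1)])
      also have "(\<Sum>j<length ?F. \<Sum>i<j. pair_sign ds i j *\<^sub>R contract (?V i j) (foldr contract (nths ?F (- {i, j})) \<omega>))
          = ext_deriv A (iter ds xs)"
      proof (rule ext_deriv_iter[OF fF ds \<omega> closed, symmetric])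
        show "\<forall>x\<in>set ?F. ext_deriv A (contract x \<omega>) = 0"
        proof
          fix x assume "x \<in> set ?F"
          then obtain s where s: "s < length xs" "x = fld (ds ! s) (xs ! s)"
            unfolding in_set_conv_nth length_flds[OF H(1)] using nth_flds[OF H(1)] by auto
          show "ext_deriv A (contract x \<omega>) = 0"
            unfolding s(2) by (rule fld_closed) (use s(1) H ds in auto)
        qed
        fix i j assume ij: "i < j" "j < length ?F"
        then have s: "i < length xs" "j < length xs" by (simp_all add: length_flds[OF H(1)])
        have d: "1 \<le> ds ! i" "1 \<le> ds ! j" using ds s H(1) by simp_all
        have x: "xs ! i \<in> Xi_all" "xs ! j \<in> Xi_all" using H(2) s by auto
        have hp: "homogeneous (Xi A m \<omega>) [ds ! i, ds ! j] [xs ! i, xs ! j]" using H(3) s by (simp add: homogeneous_def)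
        have lp: "l [xs ! i, xs ! j] = in_bidegree 1 (ds ! i + ds ! j - 2) (iter [ds ! i, ds ! j] [xs ! i, xs ! j])"
          using bracket_homogeneous[OF hp] d by (simp add: numeral_2_eq_2)
        have lX: "l [xs ! i, xs ! j] \<in> Xi_all" using bracket_degree[OF hp] Xi_subset_Xi_all by blast
        have dd: "1 \<le> ds ! i + ds ! j - 1" "ds ! i + ds ! j - 1 - 1 = ds ! i + ds ! j - 2" using d by simp_all
        have "l [xs ! i, xs ! j] 1 (ds ! i + ds ! j - 1 - 1) = contract (?F ! i) (contract (?F ! j) \<omega>)"
          unfolding lp dd(2) nth_flds[OF H(1) s(1)] nth_flds[OF H(1) s(2)] by (simp add: in_bidegree_def flds_def)
        then show "?V i j \<in> multivector_fields A (ds ! i + ds ! j - 1) \<and>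
            contract (?V i j) \<omega> = ext_deriv A (contract (?F ! i) (contract (?F ! j) \<omega>))"
          using fld[OF lX dd(1)] by simp
      qed
      finally show ?thesis .
    qed
    have hom: "l xs = in_bidegree (?n - 1) ?J (iter ds xs)"
      using bracket_homogeneous[OF h _ ds] 3 by simp
    have Tn': "l [l xs] = - in_bidegree (?n - 2) ?J (ext_deriv A (iter ds xs))"
    proof (intro ext)
      fix i j p vs
      have "l [l xs] i j = - in_bidegree (?n - 2) ?J (ext_deriv A (iter ds xs)) i j"
      proof (cases "i = ?n - 2 \<and> j = ?J")
        case True
        then have "1 \<le> i" "Suc i = ?n - 1" using 3 by auto
        then show ?thesis using True unfolding hom bracket_single in_bidegree_def by (simp only: if_True simp_thms)
      next
        case False
        have "1 \<le> i \<Longrightarrow> l xs (Suc i) j = 0"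
          using False 3 unfolding hom in_bidegree_def by (intro if_not_P) auto
        then show ?thesis
          using False unfolding bracket_single in_bidegree_def by (auto simp only: if_not_P ext_deriv_zero minus_zero split: if_split)
      qed
      then show "l [l xs] i j p vs = (- in_bidegree (?n - 2) ?J (ext_deriv A (iter ds xs))) i j p vs"
        by (simp only: uminus_apply)
    qed
    have "(\<Sum>i\<in>?I. ?T i) = (\<Sum>i\<in>{2, ?n}. ?T i)"
    proof (rule sum.mono_neutral_right)
      show "\<forall>i\<in>?I - {2, ?n}. ?T i = 0" using T0 by simp
    qed (use 3 in auto)
    also have "\<dots> = ?T 2 + ?T ?n"
    proof -
      have "2 \<notin> {?n}" using 3 by simp
      then show ?thesis
        by (simp only: sum.insert[OF finite.insertI[OF finite.emptyI]] sum.insert[OF finite.emptyI] sum.empty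
            empty_iff not_False_eq_True add_0_right)
    qed
    also have "\<dots> = 0" unfolding T2 Tn Tn' by (rule right_minus)
    finally show ?thesis .
  qed
qed

end

theorem L_infinity_Xi: "L_infinity_algebra (Xi A m \<omega>) l"
  unfolding L_infinity_algebra_def
  using pos_graded_space_Xi bracket_multilinear bracket_degree bracket_symmetric jacobi by blast

theorem bracket_hamiltonian_pairs:
  assumes n: "2 \<le> length js" "length \<alpha>s = length js" "length xs = length js"
    and pair: "\<forall>s<length js. hamiltonian_pair A m \<omega> (1 + js ! s) (xs ! s) (\<alpha>s ! s)"
  shows "l (map2 (in_bidegree 1) js \<alpha>s) = in_bidegree (length js - 1) (sum_list js) (contract_prod A \<omega> js xs)"
proof -
  let ?as = "map2 (in_bidegree 1) js \<alpha>s"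
  have len: "length ?as = length js" using n by simp
  have nth: "?as ! s = in_bidegree 1 (js ! s) (\<alpha>s ! s)" if "s < length js" for s using that n by simp
  have as: "?as ! s \<in> Xi_all" if s: "s < length js" for s
  proof -
    have p: "hamiltonian_pair A m \<omega> (1 + js ! s) (xs ! s) (\<alpha>s ! s)" using pair s by blast
    then have "js ! s < m" unfolding hamiltonian_pair_def by simp
    then have "Xi_comp A m \<omega> 1 (js ! s) = ham_forms A m \<omega> (1 + js ! s)" by (simp add: Xi_comp_def)
    then have "\<alpha>s ! s \<in> Xi_comp A m \<omega> 1 (js ! s)" using p unfolding ham_forms_def by blast
    from in_bidegree_Xi[OF this] show ?thesis unfolding nth[OF s] using Xi_subset_Xi_all by blast
  qed
  then have asX: "set ?as \<subseteq> Xi_all" using len by (metis in_set_conv_nth subsetI)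
  have x: "fields (map Suc js) xs"
    using pair n by (auto simp: fields_def list_all2_conv_all_nth hamiltonian_pair_def)
  have "l ?as = in_bidegree (length js - 1) (sum_list js) (iter (map Suc js) ?as)"
    using bracket_one_component[of ?as js] asX n nth unfolding len by (simp add: in_bidegree_def)
  also have "iter (map Suc js) ?as = foldr contract xs \<omega>"
  proof (rule iter_eq[OF fields_flds x \<omega>])
    fix s assume "s < length (flds (map Suc js) ?as)"
    then have s: "s < length js" using n by (simp add: length_flds)
    have 1: "1 \<le> Suc (js ! s)" by simp
    have "contract (flds (map Suc js) ?as ! s) \<omega> = contract (fld (Suc (js ! s)) (?as ! s)) \<omega>"
      using nth_flds[of "map Suc js" ?as s] s len by simp
    also have "\<dots> = ext_deriv A (\<alpha>s ! s)"
    proof -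
      have "(?as ! s) 1 (Suc (js ! s) - 1) = \<alpha>s ! s" unfolding nth[OF s] by (simp add: in_bidegree_def)
      with fld(2)[OF as[OF s] 1] show ?thesis by (simp only:)
    qed
    also have "\<dots> = contract (xs ! s) \<omega>" using pair s unfolding hamiltonian_pair_def by simp
    finally show "contract (flds (map Suc js) ?as ! s) \<omega> = contract (xs ! s) \<omega>" .
  qed (use asX n in simp_all)
  also have "\<dots> = contract_prod A \<omega> js xs"
    unfolding contract_prod_def by (rule contract_mv_prod[OF x \<omega>, symmetric])
  finally show ?thesis .
qed

end

theorem theorem4p4:
  fixes X :: "'p topology"
    and A :: "('p, 'e::real_inner) chart set"
    and m :: nat
    and \<omega> :: "('p, 'e) form"
  assumes "pre_multisymplectic X A m \<omega>"
  shows "L_infinity_algebra (Xi A m \<omega>) (Xi_bracket A m \<omega>) \<and>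
    (\<forall>js \<alpha>s xs. 2 \<le> length js \<longrightarrow> length \<alpha>s = length js \<longrightarrow> length xs = length js \<longrightarrow>
       (\<forall>s<length js. hamiltonian_pair A m \<omega> (1 + js ! s) (xs ! s) (\<alpha>s ! s)) \<longrightarrow>
       Xi_bracket A m \<omega> (map2 (in_bidegree 1) js \<alpha>s) =
         in_bidegree (length js - 1) (sum_list js) (contract_prod A \<omega> js xs))"
proof -
  interpret pre_multisymplectic_manifold X A m \<omega>
    using assms unfolding pre_multisymplectic_def by unfold_locales blast+
  show ?thesis using L_infinity_Xi bracket_hamiltonian_pairs by blast
qed

end
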